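(* For $2\le k\le n$: the $\hat\mu_k(\lambda)$ are rational functions in $\lambda$. The highest term in $\lambda$ when $\lambda\to\infty$ is $\lambda^{2-k}\mu_k$, where $\mu_k$ is the higher Beltrami differential from the $n$-complex structure. For $\lambda\to0$ one gets as lowest term $\lambda^{k-2}\,{}_k\mu$, where ${}_k\mu$ is the conjugated $n$-complex structure. The $\hat t_k(\lambda)$ are also rational functions in $\lambda$. For $\lambda\to\infty$, the highest term is given by $\lambda^{k-1}t_k$, and the lowest term for $\lambda\to0$ is given by $\lambda^{1-k}\,{}_kt$, where $$t_k=\operatorname{tr}A_1\Phi_1^{k-1}\quad\text{and}\quad{}_kt=\operatorname{tr}A_1(\Phi_2^* )^{k-1}.$$
   Context: Locally on a surface $\Sigma$ with complex coordinate $z$, consider $\mathcal{A}(\lambda)=\lambda\Phi+A+\lambda^{-1}\Phi^*$, $\lambda\in\mathbb{C}^*$. Here $\Phi=\Phi_1dz+\Phi_2d\bar z$ comes from an $n$-complex structure with higher Beltrami differentials $\mu_2,\dots,\mu_n$: $\Phi_1\in\mathfrak{sl}_n(\mathbb{C})$ is principal (regular) nilpotent and $\Phi_2=\mu_2\Phi_1+\dots+\mu_n\Phi_1^{n-1}$. $\Phi^*=\Phi_2^*dz+\Phi_1^*d\bar z$ is a conjugated higher complex structure: $\Phi_1^*,\Phi_2^*$ are commuting nilpotent matrices with $\Phi_1^*={}_2\mu\,\Phi_2^*+\dots+{}_n\mu\,(\Phi_2^* )^{n-1}$, where the conjugated $n$-complex structure $({}_k\mu)$ is defined by rewriting the complex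 conjugate ideal $\langle\bar p^n,-p+\bar\mu_2\bar p+\dots+\bar\mu_n\bar p^{n-1}\rangle$ in the form $\langle p^n,-\bar p+{}_2\mu\,p+\dots+{}_n\mu\,p^{n-1}\rangle$. $A=A_1+A_2$ is a $\mathfrak{sl}_n(\mathbb{C})$-connection form decomposed into its $(1,0)$- and $(0,1)$-parts. Put $\mathcal{A}_1(\lambda)=\lambda\Phi_1+A_1+\lambda^{-1}\Phi_2^*$, $\mathcal{A}_2(\lambda)=\lambda\Phi_2+A_2+\lambda^{-1}\Phi_1^*$, $\nabla=\partial+\mathcal{A}_1(\lambda)$, $\bar\nabla=\bar\partial+\mathcal{A}_2(\lambda)$. The connection is assumed parabolic: its curvature in a suitable gauge is concentrated in the last column, and by a gauge transformation whose last row vanishes except for its last entry ("parabolic gauge"), $\mathcal{A}(\lambda)$ is written in a basis of the form $(s,\nabla s,\dots,\nabla^{n-1}s)$ for a generic section $s$. The coordinates $\hat t_k(\lambda),\hat\mu_k(\lambda)$ are then defined by $$\nabla^ns=\hat t_n(\lambda)s+\hat t_{n-1}(\lambda)\nabla s+\dots+\hat t_2(\lambda)\nabla^{n-2}s,\qquad\bar\nabla s=\hat\mu_1(\lambda)s+\hat\mu_2(\lambda)\nabla s+\dots+\hat\mu_n(\lambda)\nabla^{n-1}s .$$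
   Formalization: The traces t_k and _kt are taken in a gauge where Φ_1, resp. Φ_2^*, is locally constant (the formulas are not gauge invariant). Generic s means: up to a scalar factor polynomial in λ, with top and lowest coefficients cyclic for Φ_1 and Φ_2^* (so Φ_2^* is principal). *)

theory Defs
  imports
    "HOL-Analysis.Analysis"
    "HOL-Computational_Algebra.Polynomial"
    "Jordan_Normal_Form.Determinant"
    "Jordan_Normal_Form.Jordan_Normal_Form"
begin

text \<open>
  Matrices and vectors are those of Jordan_Normal_Form, with indices \<open>0..<n\<close>. Importing
  HOL-Analysis first makes the unqualified names denote the Jordan_Normal_Form notions; the
  notation for the other kind of vectors is switched off.
\<close>

unbundle no vec_syntax

section \<open>Smooth functions and Wirtinger derivatives\<close>

text \<open>Differentiability is real (Frechet) differentiability on the plane.\<close>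

primrec Ck_on :: "nat \<Rightarrow> complex set \<Rightarrow> (complex \<Rightarrow> complex) \<Rightarrow> bool" where
  "Ck_on 0 U f \<longleftrightarrow> continuous_on U f"
| "Ck_on (Suc k) U f \<longleftrightarrow> (\<forall>z\<in>U. f differentiable (at z)) \<and>
     (\<forall>v. Ck_on k U (\<lambda>z. frechet_derivative f (at z) v))"

definition smooth_on :: "complex set \<Rightarrow> (complex \<Rightarrow> complex) \<Rightarrow> bool" where
  "smooth_on U f \<longleftrightarrow> (\<forall>k. Ck_on k U f)"

definition smooth_vec :: "nat \<Rightarrow> complex set \<Rightarrow> (complex \<Rightarrow> complex vec) \<Rightarrow> bool" where
  "smooth_vec n U v \<longleftrightarrow> (\<forall>z\<in>U. v z \<in> carrier_vec n) \<and> (\<forall>i<n. smooth_on U (\<lambda>z. v z $ i))"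

definition smooth_mat :: "nat \<Rightarrow> complex set \<Rightarrow> (complex \<Rightarrow> complex mat) \<Rightarrow> bool" where
  "smooth_mat n U M \<longleftrightarrow> (\<forall>z\<in>U. M z \<in> carrier_mat n n) \<and>
     (\<forall>i<n. \<forall>j<n. smooth_on U (\<lambda>z. M z $$ (i,j)))"

definition dz :: "(complex \<Rightarrow> complex) \<Rightarrow> complex \<Rightarrow> complex" where
  "dz f z = (frechet_derivative f (at z) 1 - \<i> * frechet_derivative f (at z) \<i>) / 2"

definition dzbar :: "(complex \<Rightarrow> complex) \<Rightarrow> complex \<Rightarrow> complex" where
  "dzbar f z = (frechet_derivative f (at z) 1 + \<i> * frechet_derivative f (at z) \<i>) / 2"

text \<open>Entrywise application of \<open>D\<close>, which is \<^const>\<open>dz\<close> or \<^const>\<open>dzbar\<close>.\<close>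

definition vec_deriv ::
  "((complex \<Rightarrow> complex) \<Rightarrow> complex \<Rightarrow> complex) \<Rightarrow> nat \<Rightarrow> (complex \<Rightarrow> complex vec) \<Rightarrow> complex \<Rightarrow> complex vec" where
  "vec_deriv D n v z = vec n (\<lambda>i. D (\<lambda>w. v w $ i) z)"

definition mat_deriv ::
  "((complex \<Rightarrow> complex) \<Rightarrow> complex \<Rightarrow> complex) \<Rightarrow> nat \<Rightarrow> (complex \<Rightarrow> complex mat) \<Rightarrow> complex \<Rightarrow> complex mat" where
  "mat_deriv D n M z = mat n n (\<lambda>(i,j). D (\<lambda>w. M w $$ (i,j)) z)"

section \<open>Linear algebra\<close>

definition mat_trace :: "complex mat \<Rightarrow> complex" where
  "mat_trace M = sum_list (diag_mat M)"

definition nilpotent_mat :: "nat \<Rightarrow> complex mat \<Rightarrow> bool" where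
  "nilpotent_mat n M \<longleftrightarrow> M \<in> carrier_mat n n \<and> (\<exists>m. M ^\<^sub>m m = 0\<^sub>m n n)"

definition principal_nilpotent :: "nat \<Rightarrow> complex mat \<Rightarrow> bool" where
  "principal_nilpotent n M \<longleftrightarrow> M \<in> carrier_mat n n \<and> similar_mat M (jordan_block n 0)"

definition lin_comb :: "nat \<Rightarrow> nat set \<Rightarrow> (nat \<Rightarrow> complex) \<Rightarrow> (nat \<Rightarrow> complex vec) \<Rightarrow> complex vec" where
  "lin_comb n I c v = vec n (\<lambda>i. \<Sum>k\<in>I. c k * v k $ i)"

text \<open>The matrix \<open>c 2 M + c 3 M^2 + ... + c n M^(n-1)\<close>.\<close>

definition beltrami_mat :: "nat \<Rightarrow> (nat \<Rightarrow> complex) \<Rightarrow> complex mat \<Rightarrow> complex mat" where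
  "beltrami_mat n c M = mat n n (\<lambda>(i,j). \<Sum>k=2..n. c k * (M ^\<^sub>m (k - 1)) $$ (i,j))"

text \<open>The vectors \<open>v, M v, ..., M^(n-1) v\<close> form a basis.\<close>

definition cyclic_vec :: "nat \<Rightarrow> complex mat \<Rightarrow> complex vec \<Rightarrow> bool" where
  "cyclic_vec n M v \<longleftrightarrow> invertible_mat (mat_of_cols n (map (\<lambda>j. (M ^\<^sub>m j) *\<^sub>v v) [0..<n]))"

section \<open>The conjugated higher complex structure\<close>

text \<open>
  \<^typ>\<open>complex poly poly\<close> is the polynomial ring in two variables: the inner variable is \<open>p\<close> and
  the outer variable is its conjugate.
\<close>

definition pvar :: "complex poly poly" where "pvar = [:[:0, 1:]:]"

definition pbar :: "complex poly poly" where "pbar = [:0, 1:]"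

definition scalar :: "complex \<Rightarrow> complex poly poly" where "scalar c = [:[:c:]:]"

definition ideal_gen2 :: "complex poly poly \<Rightarrow> complex poly poly \<Rightarrow> complex poly poly set" where
  "ideal_gen2 a b = {x * a + y * b | x y. True}"

definition conjugated_structure :: "nat \<Rightarrow> (nat \<Rightarrow> complex) \<Rightarrow> (nat \<Rightarrow> complex) \<Rightarrow> bool" where
  "conjugated_structure n \<mu> \<nu> \<longleftrightarrow>
     ideal_gen2 (pbar ^ n) (- pvar + (\<Sum>k=2..n. scalar (cnj (\<mu> k)) * pbar ^ (k - 1))) =
     ideal_gen2 (pvar ^ n) (- pbar + (\<Sum>k=2..n. scalar (\<nu> k) * pvar ^ (k - 1)))"

section \<open>The connection\<close>

definition conn_form ::
  "(complex \<Rightarrow> complex mat) \<Rightarrow> (complex \<Rightarrow> complex mat) \<Rightarrow> (complex \<Rightarrow> complex mat) \<Rightarrow>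
   complex \<Rightarrow> complex \<Rightarrow> complex mat" where
  "conn_form X A Y l z = l \<cdot>\<^sub>m X z + A z + inverse l \<cdot>\<^sub>m Y z"

definition nabla :: "nat \<Rightarrow> (complex \<Rightarrow> complex mat) \<Rightarrow> (complex \<Rightarrow> complex vec) \<Rightarrow> complex \<Rightarrow> complex vec" where
  "nabla n B v z = vec_deriv dz n v z + B z *\<^sub>v v z"

definition nabla_bar :: "nat \<Rightarrow> (complex \<Rightarrow> complex mat) \<Rightarrow> (complex \<Rightarrow> complex vec) \<Rightarrow> complex \<Rightarrow> complex vec" where
  "nabla_bar n B v z = vec_deriv dzbar n v z + B z *\<^sub>v v z"

text \<open>The matrix whose columns are \<open>v, \<nabla>v, ..., \<nabla>^(n-1) v\<close>.\<close>

definition frame :: "nat \<Rightarrow> (complex \<Rightarrow> complex mat) \<Rightarrow> (complex \<Rightarrow> complex vec) \<Rightarrow> complex \<Rightarrow> complex mat" where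
  "frame n B v z = mat_of_cols n (map (\<lambda>j. (nabla n B ^^ j) v z) [0..<n])"

text \<open>Coefficient of \<open>dz \<and> dzbar\<close> in the curvature of \<open>d + B1 dz + B2 dzbar\<close>.\<close>

definition curvature ::
  "nat \<Rightarrow> (complex \<Rightarrow> complex mat) \<Rightarrow> (complex \<Rightarrow> complex mat) \<Rightarrow> complex \<Rightarrow> complex mat" where
  "curvature n B1 B2 z =
     mat_deriv dz n B2 z - mat_deriv dzbar n B1 z + (B1 z * B2 z - B2 z * B1 z)"

text \<open>
  A gauge transformation \<open>g\<close> on \<open>V\<close>, together with its pointwise inverse \<open>h\<close>. The columns of \<open>g\<close>
  are the new basis, so an endomorphism \<open>M\<close> becomes \<open>h M g\<close> and the \<open>(1,0)\<close>-part \<open>A\<close> of a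
  connection form becomes \<open>h A g + h \<partial>g\<close>.
\<close>

definition gauge_on ::
  "nat \<Rightarrow> complex set \<Rightarrow> (complex \<Rightarrow> complex mat) \<Rightarrow> (complex \<Rightarrow> complex mat) \<Rightarrow> bool" where
  "gauge_on n V g h \<longleftrightarrow> smooth_mat n V g \<and>
     (\<forall>z\<in>V. h z \<in> carrier_mat n n \<and> g z * h z = 1\<^sub>m n \<and> h z * g z = 1\<^sub>m n)"

definition gauge_endo ::
  "(complex \<Rightarrow> complex mat) \<Rightarrow> (complex \<Rightarrow> complex mat) \<Rightarrow> (complex \<Rightarrow> complex mat) \<Rightarrow> complex \<Rightarrow> complex mat" where
  "gauge_endo g h M z = h z * M z * g z"

definition gauge_conn ::
  "nat \<Rightarrow> (complex \<Rightarrow> complex mat) \<Rightarrow> (complex \<Rightarrow> complex mat) \<Rightarrow> (complex \<Rightarrow> complex mat) \<Rightarrow>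
   complex \<Rightarrow> complex mat" where
  "gauge_conn n g h A z = h z * A z * g z + h z * mat_deriv dz n g z"

text \<open>
  The trace of \<open>A M^(k-1)\<close> is not invariant under gauge transformations, because of the term
  \<open>h \<partial>g\<close>. The traces \<open>tr A1 \<Phi>1^(k-1)\<close> and \<open>tr A1 (\<Phi>2*)^(k-1)\<close> are therefore taken in a gauge in
  which the principal nilpotent matrix (\<open>\<Phi>1\<close>, respectively \<open>\<Phi>2*\<close>) is locally constant. If the
  matrix is constant to begin with, \<open>g = h = 1\<close> is such a gauge and the trace is the literal one.
\<close>

definition adapted_gauge ::
  "nat \<Rightarrow> complex set \<Rightarrow> complex \<Rightarrow> (complex \<Rightarrow> complex mat) \<Rightarrow>
   complex set \<Rightarrow> (complex \<Rightarrow> complex mat) \<Rightarrow> (complex \<Rightarrow> complex mat) \<Rightarrow> bool" where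
  "adapted_gauge n U z0 M V g h \<longleftrightarrow>
     open V \<and> z0 \<in> V \<and> V \<subseteq> U \<and> gauge_on n V g h \<and>
     (\<forall>z\<in>V. gauge_endo g h M z = gauge_endo g h M z0)"

definition trace_coord ::
  "nat \<Rightarrow> (complex \<Rightarrow> complex mat) \<Rightarrow> (complex \<Rightarrow> complex mat) \<Rightarrow>
   (complex \<Rightarrow> complex mat) \<Rightarrow> (complex \<Rightarrow> complex mat) \<Rightarrow> nat \<Rightarrow> complex \<Rightarrow> complex" where
  "trace_coord n g h A M k z =
     mat_trace (gauge_conn n g h A z * (gauge_endo g h M z ^\<^sub>m (k - 1)))"

lemma trace_coord_identity_gauge:
  assumes "A z \<in> carrier_mat n n" and "M z \<in> carrier_mat n n"
  shows "trace_coord n (\<lambda>_. 1\<^sub>m n) (\<lambda>_. 1\<^sub>m n) A M k z = mat_trace (A z * (M z ^\<^sub>m (k - 1)))"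
proof -
  have d: "dz (\<lambda>w. c) z = 0" for c :: complex
    by (simp add: dz_def)
  have "mat_deriv dz n (\<lambda>_. 1\<^sub>m n) z = 0\<^sub>m n n"
    by (rule eq_matI) (simp_all add: mat_deriv_def d)
  then show ?thesis
    using assms unfolding trace_coord_def gauge_conn_def gauge_endo_def
    by (metis left_mult_one_mat right_mult_one_mat right_add_zero_mat zero_carrier_mat)
qed

lemma adapted_gauge_identity:
  assumes "open V" "z0 \<in> V" "V \<subseteq> U" "M z0 \<in> carrier_mat n n" "\<And>z. z \<in> V \<Longrightarrow> M z = M z0"
  shows "adapted_gauge n U z0 M V (\<lambda>_. 1\<^sub>m n) (\<lambda>_. 1\<^sub>m n)"
proof -
  have "Ck_on k V (\<lambda>z. c)" for k and c :: complex
    by (induction k arbitrary: c) simp_all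
  then have "smooth_mat n V (\<lambda>_. 1\<^sub>m n)"
    unfolding smooth_mat_def smooth_on_def by (metis one_carrier_mat)
  moreover have "1\<^sub>m n * M z * 1\<^sub>m n = 1\<^sub>m n * M z0 * 1\<^sub>m n" if "z \<in> V" for z
    using assms(5)[OF that] by (rule arg_cong)
  ultimately show ?thesis
    using assms(1-3) unfolding adapted_gauge_def gauge_on_def gauge_endo_def
    by (metis left_mult_one_mat one_carrier_mat)
qed

text \<open>
  Parabolicity at one parameter value: near \<open>z0\<close> there is a gauge \<open>g\<close> in which the curvature
  vanishes outside the last column, and a parabolic matrix \<open>P\<close> (last row zero except for its last
  entry) that takes this gauge to the basis \<open>v, \<nabla>v, ..., \<nabla>^(n-1) v\<close>.
\<close>

definition parabolic_mat :: "nat \<Rightarrow> complex mat \<Rightarrow> bool" where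
  "parabolic_mat n P \<longleftrightarrow> P \<in> carrier_mat n n \<and> invertible_mat P \<and> (\<forall>j<n - 1. P $$ (n - 1, j) = 0)"

definition parabolic_at ::
  "nat \<Rightarrow> complex set \<Rightarrow> complex \<Rightarrow> (complex \<Rightarrow> complex mat) \<Rightarrow> (complex \<Rightarrow> complex mat) \<Rightarrow>
   (complex \<Rightarrow> complex vec) \<Rightarrow> bool" where
  "parabolic_at n U z0 B1 B2 v \<longleftrightarrow>
     (\<exists>V g h P. open V \<and> z0 \<in> V \<and> V \<subseteq> U \<and> gauge_on n V g h \<and> smooth_mat n V P \<and>
        (\<forall>z\<in>V. (\<forall>i<n. \<forall>j<n - 1. gauge_endo g h (curvature n B1 B2) z $$ (i,j) = 0) \<and>
               parabolic_mat n (P z) \<and> frame n B1 v z = g z * P z))"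

text \<open>
  A generic family of sections. Requiring that \<open>\<nabla>^n s\<close> has no component along \<open>\<nabla>^(n-1) s\<close>
  normalises \<open>s\<close> by a scalar factor that depends on \<open>\<lambda>\<close> (not rationally in general: it is an
  \<open>n\<close>-th root of a determinant). Up to such a nowhere vanishing factor \<open>f\<close>, the section is allowed
  to be independent of \<open>\<lambda>\<close> (the case \<open>d = 0\<close>) or, more generally, polynomial in \<open>\<lambda>\<close> with smooth
  coefficients \<open>\<sigma> 0, ..., \<sigma> d\<close>; a family that is rational in \<open>\<lambda>\<close> has this form after clearing
  denominators. Generic means that the leading coefficient is cyclic for \<open>M\<close> and the lowest one
  is cyclic for \<open>N\<close>. These are the matrices that dominate \<open>\<nabla>\<close> at infinity and at \<open>0\<close>;
  a nilpotent \<open>N\<close> with a cyclic vector is principal.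
  The factor \<open>f\<close> need only exist near \<open>z0\<close>, for each \<open>\<lambda>\<close> separately.
\<close>

definition generic_section ::
  "nat \<Rightarrow> complex set \<Rightarrow> complex \<Rightarrow> (complex \<Rightarrow> complex mat) \<Rightarrow> (complex \<Rightarrow> complex mat) \<Rightarrow>
   (complex \<Rightarrow> complex \<Rightarrow> complex vec) \<Rightarrow> bool" where
  "generic_section n U z0 M N s \<longleftrightarrow>
     (\<exists>d \<sigma>. (\<forall>j\<le>d. smooth_vec n U (\<sigma> j)) \<and>
        cyclic_vec n (M z0) (\<sigma> d z0) \<and> cyclic_vec n (N z0) (\<sigma> 0 z0) \<and>
        (\<forall>l. l \<noteq> 0 \<longrightarrow> (\<exists>V f. open V \<and> z0 \<in> V \<and> V \<subseteq> U \<and> smooth_on V f \<and>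
           (\<forall>z\<in>V. f z \<noteq> 0 \<and> s l z = f z \<cdot>\<^sub>v lin_comb n {..d} (\<lambda>j. l ^ j) (\<lambda>j. \<sigma> j z)))))"

text \<open>
  The coordinates near \<open>z0\<close>, for one value of \<open>\<lambda>\<close>:
  \<open>\<nabla>^n v = th n v + th (n-1) \<nabla>v + ... + th 2 \<nabla>^(n-2) v\<close> and
  \<open>\<nabla>bar v = muh 1 v + muh 2 \<nabla>v + ... + muh n \<nabla>^(n-1) v\<close>.
\<close>

definition coordinates_near ::
  "nat \<Rightarrow> complex set \<Rightarrow> complex \<Rightarrow> (complex \<Rightarrow> complex mat) \<Rightarrow> (complex \<Rightarrow> complex mat) \<Rightarrow>
   (complex \<Rightarrow> complex vec) \<Rightarrow> (nat \<Rightarrow> complex \<Rightarrow> complex) \<Rightarrow> (nat \<Rightarrow> complex \<Rightarrow> complex) \<Rightarrow> bool" where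
  "coordinates_near n U z0 B1 B2 v th muh \<longleftrightarrow>
     (\<exists>V. open V \<and> z0 \<in> V \<and> V \<subseteq> U \<and>
        (\<forall>z\<in>V. (nabla n B1 ^^ n) v z =
                 lin_comb n {2..n} (\<lambda>k. th k z) (\<lambda>k. (nabla n B1 ^^ (n - k)) v z) \<and>
               nabla_bar n B2 v z =
                 lin_comb n {1..n} (\<lambda>k. muh k z) (\<lambda>k. (nabla n B1 ^^ (k - 1)) v z)))"

section \<open>Rational functions and their extreme terms\<close>

definition rational_fun_on :: "complex set \<Rightarrow> (complex \<Rightarrow> complex) \<Rightarrow> bool" where
  "rational_fun_on S f \<longleftrightarrow>
     (\<exists>P Q :: complex poly. Q \<noteq> 0 \<and> (\<forall>l\<in>S. poly Q l \<noteq> 0 \<and> f l = poly P l / poly Q l))"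

text \<open>
  \<open>f l = c l^m + o(l^m)\<close> at infinity, respectively at \<open>0\<close>. If \<open>c = 0\<close>, the terms of order
  \<open>m\<close> and higher (respectively lower) vanish.
\<close>

definition highest_term :: "(complex \<Rightarrow> complex) \<Rightarrow> complex \<Rightarrow> int \<Rightarrow> bool" where
  "highest_term f c m \<longleftrightarrow> ((\<lambda>l. f l / l powi m) \<longlongrightarrow> c) at_infinity"

definition lowest_term :: "(complex \<Rightarrow> complex) \<Rightarrow> complex \<Rightarrow> int \<Rightarrow> bool" where
  "lowest_term f c m \<longleftrightarrow> ((\<lambda>l. f l / l powi m) \<longlongrightarrow> c) (at 0)"

end

theory Submission
  imports Defs
begin

text \<open>
  The two limits are exchanged by \<open>\<lambda> \<mapsto> 1 / \<lambda>\<close>, so consider only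
  \<open>e \<nabla> = M + e (\<partial> + A) + e\<^sup>2 N\<close> with \<open>M\<close> nilpotent and \<open>e \<rightarrow> 0\<close>.
  For a section \<open>\<tau>\<close> that is polynomial in \<open>e\<close>, the vectors \<open>(e \<nabla>)^j \<tau>\<close> are polynomial in
  \<open>e\<close> and tend to the cyclic basis \<open>M^j \<tau>\<close>, so Cramer's rule yields rational coordinates
  whose leading terms are read off in that basis; as \<open>M^n = 0\<close>, those of \<open>\<nabla>^n\<close> come from the
  first-order part \<open>\<Sum> M^i (\<partial> + A) M^(n-1-i)\<close>, whose coordinates are traces \<open>tr (A M^(k-1))\<close>
  once \<open>M\<close> is constant. The normalisation of \<open>s = f \<tau>\<close> determines \<open>\<partial>f / f\<close> as a
  rational function of \<open>e\<close> without pole at \<open>0\<close>, so that passing from \<open>\<tau>\<close> to \<open>s\<close> changes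
  neither rationality nor the leading terms.
\<close>

section \<open>Calculus of smooth functions and Wirtinger derivatives\<close>

text \<open>The factor \<open>f\<close> is given for one \<lambda> at a time, with no regularity in
  \<lambda>, so it has to cancel before any limit is taken: only the quotients \<partial>^m f / f at
  \<open>z0\<close> enter, and the normalisation determines them all. They arise by repeated
  differentiation in z, so the identity that removes their pole at e = 0, the vanishing of M^n on
  the section, is needed on a neighbourhood of \<open>z0\<close> and not only at \<open>z0\<close>.
  To first order in e, \<open>f\<close> adds to \<nabla>^n s only a multiple of the basis vector of
  index n - 1, and it adds to the (0,1)-derivative only a multiple of s; these are the directions
  with k = 1, which the statement excludes. The powers of \<lambda> come from counting: \<nabla>^j
  is e^(-j) times an operator regular at e = 0, so the coordinate of \<nabla>^n s along
  \<nabla>^(n-k) s carries e^(-k) and gains one factor e because M^n = 0, while that of the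
  (0,1)-derivative along \<nabla>^(k-1) s carries e^(k-2).\<close>

lemma frechet_derivative_cong_open:
  assumes "open U" "z \<in> U" "\<And>w. w \<in> U \<Longrightarrow> f w = g w"
  shows "frechet_derivative f (at z) = frechet_derivative g (at z)"
proof -
  \<comment> \<open>\<open>frechet_derivative\<close> is a choice among all such \<open>f'\<close>,
    so equal predicates give equal values even where neither function is differentiable.\<close>
  have "(f has_derivative f') (at z) \<longleftrightarrow> (g has_derivative f') (at z)" for f'
    using has_derivative_transform_within_open[of f f' z UNIV U g]
      has_derivative_transform_within_open[of g f' z UNIV U f] assms by metis
  then show ?thesis by (simp add: frechet_derivative_def)
qed

lemma Ck_on_cong:
  assumes "open U" "\<And>z. z \<in> U \<Longrightarrow> f z = g z" "Ck_on k U f"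
  shows "Ck_on k U g"
  using assms(2,3)
proof (induction k arbitrary: f g)
  case 0
  then show ?case by (simp cong: continuous_on_cong)
next
  case (Suc k)
  have "g differentiable (at z)" if "z \<in> U" for z
    using Suc.prems that assms(1) has_derivative_transform_within_open[of f _ z UNIV U g]
    unfolding differentiable_def by (metis Ck_on.simps(2) differentiable_def)
  moreover have "Ck_on k U (\<lambda>z. frechet_derivative g (at z) v)" for v
    using Suc.IH[of "\<lambda>z. frechet_derivative f (at z) v" "\<lambda>z. frechet_derivative g (at z) v"]
      frechet_derivative_cong_open[OF assms(1), of _ f g] Suc.prems by auto
  ultimately show ?case by simp
qed

lemma Ck_on_Suc_imp: "Ck_on (Suc k) U f \<Longrightarrow> Ck_on k U f"
proof (induction k arbitrary: f)
  case 0
  then show ?case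
    by (auto intro!: continuous_at_imp_continuous_on differentiable_imp_continuous_within)
qed auto

lemma Ck_on_const: "Ck_on k U (\<lambda>z. c)"
  by (induction k arbitrary: c) simp_all

lemma frechet_derivative_add:
  fixes f g :: "complex \<Rightarrow> complex"
  assumes "f differentiable (at z)" "g differentiable (at z)"
  shows "frechet_derivative (\<lambda>z. f z + g z) (at z) v =
    frechet_derivative f (at z) v + frechet_derivative g (at z) v"
proof -
  have "((\<lambda>z. f z + g z) has_derivative
      (\<lambda>v. frechet_derivative f (at z) v + frechet_derivative g (at z) v)) (at z)"
    using assms by (intro has_derivative_add) (auto simp: frechet_derivative_works[symmetric])
  then show ?thesis by (metis frechet_derivative_at)
qed

lemma Ck_on_add:
  assumes "open U" "Ck_on k U f" "Ck_on k U g"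
  shows "Ck_on k U (\<lambda>z. f z + g z)"
  using assms(2,3)
proof (induction k arbitrary: f g)
  case 0
  then show ?case by (simp add: continuous_on_add)
next
  case (Suc k)
  have "Ck_on k U (\<lambda>z. frechet_derivative f (at z) v + frechet_derivative g (at z) v)" for v
    using Suc by simp
  moreover have "frechet_derivative f (at z) v + frechet_derivative g (at z) v =
      frechet_derivative (\<lambda>z. f z + g z) (at z) v" if "z \<in> U" for z v
    using Suc.prems that by (simp add: frechet_derivative_add)
  ultimately have "Ck_on k U (\<lambda>z. frechet_derivative (\<lambda>z. f z + g z) (at z) v)" for v
    by (rule Ck_on_cong[OF assms(1), rotated])
  then show ?case using Suc.prems by simp
qed

lemma frechet_derivative_mult:
  fixes f g :: "complex \<Rightarrow> complex"
  assumes "f differentiable (at z)" "g differentiable (at z)"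
  shows "frechet_derivative (\<lambda>z. f z * g z) (at z) v =
    f z * frechet_derivative g (at z) v + frechet_derivative f (at z) v * g z"
proof -
  have "((\<lambda>z. f z * g z) has_derivative
      (\<lambda>v. f z * frechet_derivative g (at z) v + frechet_derivative f (at z) v * g z)) (at z)"
    using assms by (intro has_derivative_mult) (auto simp: frechet_derivative_works[symmetric])
  then show ?thesis by (metis frechet_derivative_at)
qed

lemma Ck_on_mult:
  assumes "open U" "Ck_on k U f" "Ck_on k U g"
  shows "Ck_on k U (\<lambda>z. f z * g z)"
  using assms(2,3)
proof (induction k arbitrary: f g)
  case 0
  then show ?case by (simp add: continuous_on_mult)
next
  case (Suc k)
  \<comment> \<open>The undifferentiated factors are of class k + 1 and are first lowered to class
    k, to which the induction hypothesis applies.\<close>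
  have "Ck_on k U (\<lambda>z. f z * frechet_derivative g (at z) v + frechet_derivative f (at z) v * g z)" for v
    using Suc.prems by (intro Ck_on_add assms(1) Suc.IH Ck_on_Suc_imp[OF Suc.prems(1)]
        Ck_on_Suc_imp[OF Suc.prems(2)]) simp_all
  moreover have "f z * frechet_derivative g (at z) v + frechet_derivative f (at z) v * g z =
      frechet_derivative (\<lambda>z. f z * g z) (at z) v" if "z \<in> U" for z v
    using Suc.prems that by (simp add: frechet_derivative_mult)
  ultimately have "Ck_on k U (\<lambda>z. frechet_derivative (\<lambda>z. f z * g z) (at z) v)" for v
    by (rule Ck_on_cong[OF assms(1), rotated])
  then show ?case using Suc.prems by simp
qed

lemma Ck_on_subset: "Ck_on k U f \<Longrightarrow> V \<subseteq> U \<Longrightarrow> Ck_on k V f"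
  by (induction k arbitrary: f) (auto intro: continuous_on_subset)

lemma smooth_on_subset: "smooth_on U f \<Longrightarrow> V \<subseteq> U \<Longrightarrow> smooth_on V f"
  unfolding smooth_on_def by (blast intro: Ck_on_subset)

lemma smooth_on_const: "smooth_on U (\<lambda>z. c)"
  by (simp add: smooth_on_def Ck_on_const)

lemma smooth_on_add:
  "open U \<Longrightarrow> smooth_on U f \<Longrightarrow> smooth_on U g \<Longrightarrow> smooth_on U (\<lambda>z. f z + g z)"
  by (simp add: smooth_on_def Ck_on_add)

lemma smooth_on_mult:
  "open U \<Longrightarrow> smooth_on U f \<Longrightarrow> smooth_on U g \<Longrightarrow> smooth_on U (\<lambda>z. f z * g z)"
  by (simp add: smooth_on_def Ck_on_mult)

lemma smooth_on_cong:
  "open U \<Longrightarrow> smooth_on U f \<Longrightarrow> (\<And>z. z \<in> U \<Longrightarrow> f z = g z) \<Longrightarrow> smooth_on U g"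
  using Ck_on_cong unfolding smooth_on_def by blast

lemma smooth_on_sum:
  assumes "open U" "\<And>i. i \<in> I \<Longrightarrow> smooth_on U (f i)"
  shows "smooth_on U (\<lambda>z. \<Sum>i\<in>I. f i z)"
  using assms(2)
  by (induction I rule: infinite_finite_induct) (auto intro: smooth_on_const smooth_on_add assms(1))

lemma smooth_on_differentiable: "smooth_on U f \<Longrightarrow> z \<in> U \<Longrightarrow> f differentiable (at z)"
  unfolding smooth_on_def by (metis Ck_on.simps(2))

lemma smooth_on_continuous: "smooth_on U f \<Longrightarrow> continuous_on U f"
  unfolding smooth_on_def by (metis Ck_on.simps(1))

lemma smooth_on_frechet: "smooth_on U f \<Longrightarrow> smooth_on U (\<lambda>z. frechet_derivative f (at z) v)"
  unfolding smooth_on_def by (metis Ck_on.simps(2))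

lemma smooth_on_dz:
  assumes "open U" "smooth_on U f"
  shows "smooth_on U (dz f)"
proof -
  have "smooth_on U (\<lambda>z. 1/2 * (frechet_derivative f (at z) 1 +
      (- \<i>) * frechet_derivative f (at z) \<i>))"
    by (intro smooth_on_mult smooth_on_add smooth_on_const smooth_on_frechet assms)
  then show ?thesis by (rule smooth_on_cong[OF assms(1)]) (simp add: dz_def)
qed

lemma smooth_on_dz_pow: "open U \<Longrightarrow> smooth_on U f \<Longrightarrow> smooth_on U ((dz ^^ m) f)"
  by (induction m) (auto intro: smooth_on_dz)

section \<open>Rules for the Wirtinger derivatives\<close>

lemma dz_cong:
  assumes "open U" "z \<in> U" "\<And>w. w \<in> U \<Longrightarrow> f w = g w"
  shows "dz f z = dz g z"
  by (simp add: dz_def frechet_derivative_cong_open[OF assms])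

lemma dzbar_cong:
  assumes "open U" "z \<in> U" "\<And>w. w \<in> U \<Longrightarrow> f w = g w"
  shows "dzbar f z = dzbar g z"
  by (simp add: dzbar_def frechet_derivative_cong_open[OF assms])

lemma dz_const [simp]: "dz (\<lambda>w. c) z = 0"
  by (simp add: dz_def)

lemma dzbar_const [simp]: "dzbar (\<lambda>w. c) z = 0"
  by (simp add: dzbar_def)

context
  fixes U z f g
  assumes sm: "smooth_on U f" "smooth_on U g" and z: "z \<in> U"
begin

lemma dz_add: "dz (\<lambda>z. f z + g z) z = dz f z + dz g z"
  using smooth_on_differentiable[OF sm(1) z] smooth_on_differentiable[OF sm(2) z]
  by (simp add: dz_def frechet_derivative_add field_simps)

lemma dz_mult: "dz (\<lambda>z. f z * g z) z = dz f z * g z + f z * dz g z"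
  using smooth_on_differentiable[OF sm(1) z] smooth_on_differentiable[OF sm(2) z]
  by (simp add: dz_def frechet_derivative_mult field_simps)

lemma dzbar_add: "dzbar (\<lambda>z. f z + g z) z = dzbar f z + dzbar g z"
  using smooth_on_differentiable[OF sm(1) z] smooth_on_differentiable[OF sm(2) z]
  by (simp add: dzbar_def frechet_derivative_add field_simps)

lemma dzbar_mult: "dzbar (\<lambda>z. f z * g z) z = dzbar f z * g z + f z * dzbar g z"
  using smooth_on_differentiable[OF sm(1) z] smooth_on_differentiable[OF sm(2) z]
  by (simp add: dzbar_def frechet_derivative_mult field_simps)

end

lemma dz_cmult: "smooth_on U f \<Longrightarrow> z \<in> U \<Longrightarrow> dz (\<lambda>z. c * f z) z = c * dz f z"
  using dz_mult[OF smooth_on_const[of U c]] by simp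

lemma dzbar_cmult: "smooth_on U f \<Longrightarrow> z \<in> U \<Longrightarrow> dzbar (\<lambda>z. c * f z) z = c * dzbar f z"
  using dzbar_mult[OF smooth_on_const[of U c]] by simp

lemma dz_sum:
  assumes "open U" "\<And>i. i \<in> I \<Longrightarrow> smooth_on U (f i)" "z \<in> U"
  shows "dz (\<lambda>z. \<Sum>i\<in>I. f i z) z = (\<Sum>i\<in>I. dz (f i) z)"
  using assms(2)
proof (induction I rule: infinite_finite_induct)
  case (insert i I)
  then show ?case
    using dz_add[of U "f i" "\<lambda>z. \<Sum>i\<in>I. f i z"] smooth_on_sum[OF assms(1), of I f] assms(3) by simp
qed auto

lemma dzbar_sum:
  assumes "open U" "\<And>i. i \<in> I \<Longrightarrow> smooth_on U (f i)" "z \<in> U"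
  shows "dzbar (\<lambda>z. \<Sum>i\<in>I. f i z) z = (\<Sum>i\<in>I. dzbar (f i) z)"
  using assms(2)
proof (induction I rule: infinite_finite_induct)
  case (insert i I)
  then show ?case
    using dzbar_add[of U "f i" "\<lambda>z. \<Sum>i\<in>I. f i z"] smooth_on_sum[OF assms(1), of I f] assms(3) by simp
qed auto

section \<open>Polynomials in the parameter with smooth coefficients\<close>

text \<open>Generated by closure rules instead of a list of coefficients, so that the derivative in
  z or the splitting at e = 0 takes a single induction and no degree has to be tracked. The
  congruence rule leaves the values at points outside \<open>W\<close> arbitrary.\<close>

inductive polyfn :: "complex set \<Rightarrow> (complex \<Rightarrow> complex \<Rightarrow> complex) \<Rightarrow> bool" for W where
  polyfn_coeff: "smooth_on W c \<Longrightarrow> polyfn W (\<lambda>e z. c z)"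
| polyfn_param: "polyfn W (\<lambda>e z. e)"
| polyfn_add: "polyfn W F \<Longrightarrow> polyfn W G \<Longrightarrow> polyfn W (\<lambda>e z. F e z + G e z)"
| polyfn_mult: "polyfn W F \<Longrightarrow> polyfn W G \<Longrightarrow> polyfn W (\<lambda>e z. F e z * G e z)"
| polyfn_cong: "polyfn W F \<Longrightarrow> (\<And>e z. z \<in> W \<Longrightarrow> F e z = G e z) \<Longrightarrow> polyfn W G"

lemma polyfn_const: "polyfn W (\<lambda>e z. c)"
  by (intro polyfn_coeff smooth_on_const)

lemma polyfn_sum: "(\<And>i. i \<in> I \<Longrightarrow> polyfn W (F i)) \<Longrightarrow> polyfn W (\<lambda>e z. \<Sum>i\<in>I. F i e z)"
  by (induction I rule: infinite_finite_induct) (auto intro: polyfn_const polyfn_add)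

lemma polyfn_power: "polyfn W F \<Longrightarrow> polyfn W (\<lambda>e z. F e z ^ m)"
  by (induction m) (auto intro: polyfn_const polyfn_mult)

lemma polyfn_smooth:
  assumes "open W" "polyfn W F"
  shows "smooth_on W (F e)"
  using assms(2)
  by (induction) (auto intro: smooth_on_const smooth_on_add smooth_on_mult smooth_on_cong assms(1))

lemma polyfn_dz:
  assumes W: "open W" and "polyfn W F"
  shows "polyfn W (\<lambda>e. dz (F e))"
  using assms(2)
proof induction
  case (polyfn_coeff c)
  then show ?case by (intro polyfn.polyfn_coeff smooth_on_dz W)
next
  case polyfn_param
  show ?case by (simp add: polyfn_const)
next
  case (polyfn_add F G)
  show ?case
    by (rule polyfn_cong[OF polyfn.polyfn_add[OF polyfn_add.IH]])
      (simp add: dz_add[OF polyfn_smooth[OF W] polyfn_smooth[OF W]] polyfn_add)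
next
  case (polyfn_mult F G)
  show ?case
    by (rule polyfn_cong[OF polyfn.polyfn_add[OF
          polyfn.polyfn_mult[OF polyfn_mult.IH(1) polyfn_mult.hyps(2)]
          polyfn.polyfn_mult[OF polyfn_mult.hyps(1) polyfn_mult.IH(2)]]])
      (simp add: dz_mult[OF polyfn_smooth[OF W] polyfn_smooth[OF W]] polyfn_mult)
next
  case (polyfn_cong F G)
  show ?case
    by (rule polyfn.polyfn_cong[OF polyfn_cong.IH]) (rule dz_cong[OF W], auto simp: polyfn_cong)
qed

lemma polyfn_poly:
  assumes "polyfn W F" "z \<in> W"
  shows "\<exists>p. \<forall>e. F e z = poly p e"
  using assms(1)
proof induction
  case (polyfn_coeff c)
  show ?case by (rule exI[of _ "[:c z:]"]) simp
next
  case polyfn_param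
  show ?case by (rule exI[of _ "[:0, 1:]"]) simp
next
  case (polyfn_add F G)
  then show ?case by (metis poly_add)
next
  case (polyfn_mult F G)
  then show ?case by (metis poly_mult)
next
  case (polyfn_cong F G)
  then show ?case using assms(2) by metis
qed

lemma polyfn_tendsto:
  assumes "polyfn W F" "z \<in> W"
  shows "((\<lambda>e. F e z) \<longlongrightarrow> F 0 z) (at 0)"
proof -
  obtain p where "\<And>e. F e z = poly p e" using polyfn_poly[OF assms] by metis
  then show ?thesis using poly_isCont[of 0 p] by (simp add: isCont_def)
qed

lemma polyfn_differentiable:
  assumes "polyfn W F" "z \<in> W"
  shows "(\<lambda>e. F e z) field_differentiable (at e)"
proof -
  obtain p where "(\<lambda>e. F e z) = poly p" using polyfn_poly[OF assms] by (metis ext)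
  then show ?thesis using poly_DERIV field_differentiable_def by metis
qed

text \<open>Division by e with remainder, uniformly in z: the quotient has smooth coefficients
  again, so it can still be differentiated in z after a factor e has been cancelled.\<close>

lemma polyfn_split:
  assumes W: "open W" and "polyfn W F"
  shows "\<exists>G. polyfn W G \<and> (\<forall>e. \<forall>z\<in>W. F e z = F 0 z + e * G e z)"
  using assms(2)
proof induction
  case (polyfn_coeff c)
  show ?case by (rule exI[of _ "\<lambda>e z. 0"]) (simp add: polyfn_const)
next
  case polyfn_param
  show ?case by (rule exI[of _ "\<lambda>e z. 1"]) (simp add: polyfn_const)
next
  case (polyfn_add F1 F2)
  then obtain G1 G2 where G: "polyfn W G1" "polyfn W G2"
    "\<And>e z. z \<in> W \<Longrightarrow> F1 e z = F1 0 z + e * G1 e z"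
    "\<And>e z. z \<in> W \<Longrightarrow> F2 e z = F2 0 z + e * G2 e z" by metis
  have "F1 e z + F2 e z = F1 0 z + F2 0 z + e * (G1 e z + G2 e z)" if "z \<in> W" for e z
    by (subst G(3)[OF that], subst G(4)[OF that]) (simp add: algebra_simps)
  then show ?case using polyfn.polyfn_add[OF G(1,2)] by blast
next
  case (polyfn_mult F1 F2)
  then obtain G1 G2 where G: "polyfn W G1" "polyfn W G2"
    "\<And>e z. z \<in> W \<Longrightarrow> F1 e z = F1 0 z + e * G1 e z"
    "\<And>e z. z \<in> W \<Longrightarrow> F2 e z = F2 0 z + e * G2 e z" by metis
  \<comment> \<open>Telescoping: F1 F2 - F1(0) F2(0) = (F1 - F1(0)) F2 + F1(0) (F2 - F2(0)).\<close>
  have "F1 e z * F2 e z = F1 0 z * F2 0 z + e * (G1 e z * F2 e z + F1 0 z * G2 e z)"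
    if "z \<in> W" for e z
    using G(3)[OF that, of e] G(4)[OF that, of e] by (simp add: algebra_simps)
  moreover have "polyfn W (\<lambda>e z. G1 e z * F2 e z + F1 0 z * G2 e z)"
    by (intro polyfn.polyfn_add polyfn.polyfn_mult G polyfn_mult.hyps polyfn_coeff
        polyfn_smooth[OF W])
  ultimately show ?case by blast
next
  case (polyfn_cong F G)
  then show ?case by (metis (no_types, lifting))
qed

section \<open>Rational functions\<close>

lemma rational_fun_on_const: "rational_fun_on S (\<lambda>e. c)"
  unfolding rational_fun_on_def by (intro exI[of _ "[:c:]"] exI[of _ 1]) simp

lemma rational_fun_on_poly: "rational_fun_on S (poly p)"
  unfolding rational_fun_on_def by (intro exI[of _ p] exI[of _ 1]) simp

lemma rational_fun_on_cong:
  "rational_fun_on S f \<Longrightarrow> (\<And>e. e \<in> S \<Longrightarrow> f e = g e) \<Longrightarrow> rational_fun_on S g"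
  unfolding rational_fun_on_def by metis

lemma rational_fun_on_id: "rational_fun_on S (\<lambda>e. e)"
  by (rule rational_fun_on_cong[OF rational_fun_on_poly[of S "[:0, 1:]"]]) simp

lemma rational_fun_on_polyfn:
  assumes "polyfn W F" "z \<in> W"
  shows "rational_fun_on S (\<lambda>e. F e z)"
  using polyfn_poly[OF assms] rational_fun_on_cong[OF rational_fun_on_poly] by metis

lemma rational_fun_on_add:
  assumes "rational_fun_on S f" "rational_fun_on S g"
  shows "rational_fun_on S (\<lambda>e. f e + g e)"
proof -
  obtain P1 Q1 P2 Q2 where *: "Q1 \<noteq> 0" "Q2 \<noteq> 0"
    "\<And>e. e \<in> S \<Longrightarrow> poly Q1 e \<noteq> 0 \<and> f e = poly P1 e / poly Q1 e"
    "\<And>e. e \<in> S \<Longrightarrow> poly Q2 e \<noteq> 0 \<and> g e = poly P2 e / poly Q2 e"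
    using assms unfolding rational_fun_on_def by metis
  show ?thesis unfolding rational_fun_on_def
    by (intro exI[of _ "P1 * Q2 + P2 * Q1"] exI[of _ "Q1 * Q2"]) (simp add: * add_frac_eq)
qed

lemma rational_fun_on_mult:
  assumes "rational_fun_on S f" "rational_fun_on S g"
  shows "rational_fun_on S (\<lambda>e. f e * g e)"
proof -
  obtain P1 Q1 P2 Q2 where *: "Q1 \<noteq> 0" "Q2 \<noteq> 0"
    "\<And>e. e \<in> S \<Longrightarrow> poly Q1 e \<noteq> 0 \<and> f e = poly P1 e / poly Q1 e"
    "\<And>e. e \<in> S \<Longrightarrow> poly Q2 e \<noteq> 0 \<and> g e = poly P2 e / poly Q2 e"
    using assms unfolding rational_fun_on_def by metis
  show ?thesis unfolding rational_fun_on_def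
    by (intro exI[of _ "P1 * P2"] exI[of _ "Q1 * Q2"]) (simp add: *)
qed

lemma rational_fun_on_inverse:
  assumes "rational_fun_on S f" "\<And>e. e \<in> S \<Longrightarrow> f e \<noteq> 0"
  shows "rational_fun_on S (\<lambda>e. inverse (f e))"
proof -
  obtain P Q where *: "Q \<noteq> 0" "\<And>e. e \<in> S \<Longrightarrow> poly Q e \<noteq> 0 \<and> f e = poly P e / poly Q e"
    using assms unfolding rational_fun_on_def by metis
  have nz: "poly P e \<noteq> 0" if "e \<in> S" for e using assms(2)[OF that] *(2)[OF that] by auto
  show ?thesis
  \<comment> \<open>The numerator becomes the new denominator and must be a nonzero polynomial; only
    a point of \<open>S\<close> can witness this.\<close>
  proof (cases "S = {}")
    case True
    then show ?thesis using rational_fun_on_cong[OF rational_fun_on_const] by blast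
  next
    case False
    then have "P \<noteq> 0" using nz by auto
    then show ?thesis unfolding rational_fun_on_def
      by (intro exI[of _ Q] exI[of _ P]) (simp add: * nz)
  qed
qed

lemma rational_fun_on_divide:
  assumes "rational_fun_on S f" "rational_fun_on S g" "\<And>e. e \<in> S \<Longrightarrow> g e \<noteq> 0"
  shows "rational_fun_on S (\<lambda>e. f e / g e)"
  using rational_fun_on_mult[OF assms(1) rational_fun_on_inverse[OF assms(2,3)]]
  by (simp add: divide_inverse)

lemma rational_fun_on_sum:
  "(\<And>i. i \<in> I \<Longrightarrow> rational_fun_on S (f i)) \<Longrightarrow> rational_fun_on S (\<lambda>e. \<Sum>i\<in>I. f i e)"
  by (induction I rule: infinite_finite_induct) (auto intro: rational_fun_on_const rational_fun_on_add)

lemma rational_fun_on_power: "rational_fun_on S f \<Longrightarrow> rational_fun_on S (\<lambda>e. f e ^ m)"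
  by (induction m) (auto intro: rational_fun_on_const rational_fun_on_mult)

section \<open>Determinants and adjugates\<close>

text \<open>The Leibniz formula builds the determinant from sums and products of entries, so it
  stays in every ring of functions that contains the constants. \<open>C\<close> is kept abstract
  because this fact and its analogue for the adjugate serve polynomial dependence, continuity and
  rationality.\<close>

lemma det_mat_closed:
  fixes f :: "nat \<Rightarrow> nat \<Rightarrow> 'b \<Rightarrow> complex"
  assumes const: "\<And>c. C (\<lambda>x. c)"
    and add: "\<And>f g. C f \<Longrightarrow> C g \<Longrightarrow> C (\<lambda>x. f x + g x)"
    and mult: "\<And>f g. C f \<Longrightarrow> C g \<Longrightarrow> C (\<lambda>x. f x * g x)"
    and f: "\<And>i j. i < n \<Longrightarrow> j < n \<Longrightarrow> C (f i j)"
  shows "C (\<lambda>x. det (mat n n (\<lambda>(i,j). f i j x)))"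
proof -
  have prod: "C (\<lambda>x. \<Prod>i\<in>I. g i x)" if "\<And>i. i \<in> I \<Longrightarrow> C (g i)" for I :: "nat set" and g
    using that by (induction I rule: infinite_finite_induct) (auto intro: const mult)
  have sum: "C (\<lambda>x. \<Sum>i\<in>I. g i x)" if "\<And>i. i \<in> I \<Longrightarrow> C (g i)"
    for I :: "(nat \<Rightarrow> nat) set" and g
    using that by (induction I rule: infinite_finite_induct) (auto intro: const add)
  have "C (\<lambda>x. \<Sum>p\<in>{p. p permutes {0..<n}}. signof p * (\<Prod>i = 0..<n. f i (p i) x))"
    by (intro sum mult const prod f) auto
  also have "(\<lambda>x. \<Sum>p\<in>{p. p permutes {0..<n}}. signof p * (\<Prod>i = 0..<n. f i (p i) x)) =
      (\<lambda>x. det (mat n n (\<lambda>(i,j). f i j x)))"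
    by (rule ext, subst det_def'[of _ n]) (auto intro!: sum.cong prod.cong)
  finally show ?thesis .
qed

lemma adj_mat_closed:
  fixes f :: "nat \<Rightarrow> nat \<Rightarrow> 'b \<Rightarrow> complex"
  assumes const: "\<And>c. C (\<lambda>x. c)"
    and add: "\<And>f g. C f \<Longrightarrow> C g \<Longrightarrow> C (\<lambda>x. f x + g x)"
    and mult: "\<And>f g. C f \<Longrightarrow> C g \<Longrightarrow> C (\<lambda>x. f x * g x)"
    and f: "\<And>i j. i < n \<Longrightarrow> j < n \<Longrightarrow> C (f i j)"
    and kl: "k < n" "l < n"
  shows "C (\<lambda>x. adj_mat (mat n n (\<lambda>(i,j). f i j x)) $$ (k,l))"
proof -
  \<comment> \<open>Re-indexing that skips row \<open>l\<close> and column \<open>k\<close>; the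
    adjugate is transposed, so its entry (k,l) is the cofactor at (l,k).\<close>
  let ?g = "\<lambda>i j. f (if i < l then i else Suc i) (if j < k then j else Suc j)"
  have "mat_delete (mat n n (\<lambda>(i,j). f i j x)) l k = mat (n-1) (n-1) (\<lambda>(i,j). ?g i j x)" for x
    unfolding mat_delete_def by (rule eq_matI) auto
  then have "adj_mat (mat n n (\<lambda>(i,j). f i j x)) $$ (k,l) =
      (-1)^(l+k) * det (mat (n-1) (n-1) (\<lambda>(i,j). ?g i j x))" for x
    using kl by (simp add: adj_mat_def cofactor_def)
  moreover have "C (\<lambda>x. (-1)^(l+k) * det (mat (n-1) (n-1) (\<lambda>(i,j). ?g i j x)))"
    by (intro mult const det_mat_closed[where C = C] add) (auto intro!: f)
  ultimately show ?thesis by simp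
qed

lemma adj_mat_row:
  fixes X :: "complex mat"
  assumes "X \<in> carrier_mat n n" "k < n" "i < n"
  shows "(\<Sum>a<n. adj_mat X $$ (k,a) * X $$ (a,i)) = (if i = k then det X else 0)"
proof -
  have "(adj_mat X * X) $$ (k,i) = (\<Sum>a<n. adj_mat X $$ (k,a) * X $$ (a,i))"
    using assms adj_mat(1)[OF assms(1)] by (auto simp: scalar_prod_def atLeast0LessThan)
  then show ?thesis using assms adj_mat(3)[OF assms(1)] by (auto split: if_splits)
qed

lemma adj_mat_inverse:
  fixes X :: "complex mat"
  assumes X: "X \<in> carrier_mat n n" and "det X \<noteq> 0"
  shows "inverse (det X) \<cdot>\<^sub>m adj_mat X \<in> carrier_mat n n"
    "X * (inverse (det X) \<cdot>\<^sub>m adj_mat X) = 1\<^sub>m n" "(inverse (det X) \<cdot>\<^sub>m adj_mat X) * X = 1\<^sub>m n"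
  using adj_mat[OF X] assms
  by (auto simp: mult_smult_distrib[of _ n n _ n] mult_smult_assoc_mat[of _ n n _ n] intro!: eq_matI)

lemma invertible_mat_iff_det:
  fixes X :: "complex mat"
  assumes X: "X \<in> carrier_mat n n"
  shows "invertible_mat X \<longleftrightarrow> det X \<noteq> 0"
proof
  assume "invertible_mat X"
  then obtain B where B: "inverts_mat X B" "inverts_mat B X" unfolding invertible_mat_def by blast
  then have "X * B = 1\<^sub>m n" "B * X = 1\<^sub>m (dim_row B)" using X unfolding inverts_mat_def by auto
  then have "B \<in> carrier_mat n n"
    by (metis X carrier_matD(2) carrier_matI index_mult_mat(2) index_mult_mat(3) index_one_mat(2) index_one_mat(3))
  then have "det X * det B = 1" using det_mult[OF X, of B] \<open>X * B = 1\<^sub>m n\<close> by (metis det_one)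
  then show "det X \<noteq> 0" by auto
next
  assume "det X \<noteq> 0"
  then show "invertible_mat X" unfolding invertible_mat_def inverts_mat_def
    using X adj_mat_inverse[OF X] by (intro conjI exI[of _ "inverse (det X) \<cdot>\<^sub>m adj_mat X"]) auto
qed

lemma mat_pow_mult_vec_Suc:
  fixes X :: "complex mat"
  assumes "X \<in> carrier_mat n n" "v \<in> carrier_vec n"
  shows "X ^\<^sub>m Suc j *\<^sub>v v = X *\<^sub>v (X ^\<^sub>m j *\<^sub>v v)"
proof -
  have "X * X ^\<^sub>m j = X ^\<^sub>m j * X"
  proof (induction j)
    case 0
    then show ?case using assms by simp
  next
    case (Suc j)
    have "X * X ^\<^sub>m Suc j = (X * X ^\<^sub>m j) * X"
      using assms by (simp add: assoc_mult_mat[of _ n n _ n _ n])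
    then show ?case using Suc by simp
  qed
  then have "X ^\<^sub>m Suc j *\<^sub>v v = (X * X ^\<^sub>m j) *\<^sub>v v" by simp
  also have "\<dots> = X *\<^sub>v (X ^\<^sub>m j *\<^sub>v v)"
    using assms by (intro assoc_mult_mat_vec[of _ n n _ n]) auto
  finally show ?thesis .
qed

lemma index_mult_mat_vec_sum:
  assumes "X \<in> carrier_mat n n" "v \<in> carrier_vec n" "a < n"
  shows "(X *\<^sub>v v) $ a = (\<Sum>b<n. X $$ (a,b) * v $ b)"
  using assms by (auto simp: scalar_prod_def atLeast0LessThan)

lemma index_mult_mat_sum:
  assumes "X \<in> carrier_mat n n" "Y \<in> carrier_mat n n" "a < n" "c < n"
  shows "(X * Y) $$ (a,c) = (\<Sum>b<n. X $$ (a,b) * Y $$ (b,c))"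
  using assms by (auto simp: scalar_prod_def atLeast0LessThan)

section \<open>Coordinates in a cyclic basis of a nilpotent matrix\<close>

locale cyclic_basis =
  fixes n :: nat and X :: "complex mat" and x :: "nat \<Rightarrow> nat \<Rightarrow> complex"
  assumes n: "n > 0" and X: "X \<in> carrier_mat n n"
    and x_Suc: "\<And>j a. a < n \<Longrightarrow> x (Suc j) a = (\<Sum>b<n. X $$ (a,b) * x j b)"
    and det_nz: "det (mat n n (\<lambda>(a,j). x j a)) \<noteq> 0"
    and nil: "\<exists>m. \<forall>a<n. x m a = 0"
begin

text \<open>Cramer's rule for the basis x 0, ..., x (n - 1). The form adjugate over determinant is
  the one that will appear as the value at e = 0 of the rational expressions for the
  coordinates.\<close>

definition coord :: "nat \<Rightarrow> (nat \<Rightarrow> complex) \<Rightarrow> complex" where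
  "coord k v = (\<Sum>a<n. adj_mat (mat n n (\<lambda>(a,j). x j a)) $$ (k,a) * v a)
     / det (mat n n (\<lambda>(a,j). x j a))"

lemma coord_basis: "k < n \<Longrightarrow> j < n \<Longrightarrow> coord k (x j) = (if j = k then 1 else 0)"
  using adj_mat_row[of "mat n n (\<lambda>(a,j). x j a)" n k j] det_nz by (simp add: coord_def)

lemma coord_cong: "(\<And>a. a < n \<Longrightarrow> v a = w a) \<Longrightarrow> coord k v = coord k w"
  by (simp add: coord_def)

lemma coord_add: "coord k (\<lambda>a. v a + w a) = coord k v + coord k w"
  by (simp add: coord_def algebra_simps sum.distrib add_divide_distrib)

lemma coord_cmult: "coord k (\<lambda>a. c * v a) = c * coord k v"
  by (simp add: coord_def sum_distrib_left mult_ac)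

lemma coord_zero: "(\<And>a. a < n \<Longrightarrow> v a = 0) \<Longrightarrow> coord k v = 0"
  by (simp add: coord_def)

lemma coord_sum: "coord k (\<lambda>a. \<Sum>i\<in>I. v i a) = (\<Sum>i\<in>I. coord k (v i))"
  by (induction I rule: infinite_finite_induct) (simp_all add: coord_zero coord_add)

text \<open>The product of matrix and adjugate in the other order than in
  \<open>coord_basis\<close>: there it gives independence of the \<open>x j\<close>, here it gives
  that they span.\<close>

lemma mat_adj_mat:
  assumes "a < n" "b < n"
  shows "(\<Sum>j<n. x j a * (adj_mat (mat n n (\<lambda>(a,j). x j a)) $$ (j,b)
    / det (mat n n (\<lambda>(a,j). x j a)))) = (if a = b then 1 else 0)"
proof -
  let ?F = "mat n n (\<lambda>(a,j). x j a)"
  have F: "?F \<in> carrier_mat n n" by simp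
  have "(?F * adj_mat ?F) $$ (a,b) = (\<Sum>j<n. x j a * adj_mat ?F $$ (j,b))"
    using assms adj_mat(1)[OF F] by (subst index_mult_mat_sum[of _ n]) auto
  then have "(\<Sum>j<n. x j a * adj_mat ?F $$ (j,b)) = (if a = b then det ?F else 0)"
    using adj_mat(2)[OF F] assms by (auto split: if_splits)
  then show ?thesis using det_nz by (simp flip: sum_divide_distrib)
qed

lemma coord_expand:
  assumes "a < n"
  shows "v a = (\<Sum>j<n. coord j v * x j a)"
proof -
  let ?F = "mat n n (\<lambda>(a,j). x j a)"
  have "(\<Sum>j<n. coord j v * x j a) = (\<Sum>j<n. \<Sum>b<n. x j a * (adj_mat ?F $$ (j,b) / det ?F) * v b)"
    by (simp add: coord_def sum_divide_distrib sum_distrib_left sum_distrib_right mult_ac)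
  also have "\<dots> = (\<Sum>b<n. (\<Sum>j<n. x j a * (adj_mat ?F $$ (j,b) / det ?F)) * v b)"
    by (subst sum.swap) (simp add: sum_distrib_right)
  also have "\<dots> = (\<Sum>b<n. if a = b then v b else 0)"
    using mat_adj_mat[OF assms] by (intro sum.cong) auto
  also have "\<dots> = v a" using assms by simp
  finally show ?thesis by simp
qed

text \<open>
  If \<open>x n \<noteq> 0\<close>, the least \<open>m\<close> with \<open>x m = 0\<close> exceeds \<open>n\<close>; applying \<open>X ^ (m - 1 - j)\<close> to
  the expansion of \<open>x n\<close>, where \<open>j\<close> is its least occurring index, leaves a multiple of
  \<open>x (m - 1)\<close> alone.
\<close>

lemma x_n_zero: "a < n \<Longrightarrow> x n a = 0"
proof (rule ccontr)
  assume a: "a < n" "x n a \<noteq> 0"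
  have step: "x m' a = 0" if "\<forall>a<n. x m a = 0" "m \<le> m'" "a < n" for m m' a
    using that(2,3) by (induction m' arbitrary: a rule: dec_induct) (auto simp: x_Suc that(1))
  define m where "m = (LEAST m. \<forall>a<n. x m a = 0)"
  have m: "\<forall>a<n. x m a = 0" unfolding m_def by (rule LeastI_ex) (rule nil)
  have "m > n" using a step[OF m, of n a] by (meson not_le)
  obtain b where b: "b < n" "x (m - 1) b \<noteq> 0"
    using not_less_Least[of "m - 1" "\<lambda>m. \<forall>a<n. x m a = 0"] \<open>m > n\<close> by (auto simp: m_def)
  define c where "c j = coord j (x n)" for j
  have exp: "x (n + p) a = (\<Sum>j<n. c j * x (j + p) a)" if "a < n" for a p
    using that
  proof (induction p arbitrary: a)
    case 0
    then show ?case using coord_expand[of a "x n"] by (simp add: c_def)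
  next
    case (Suc p)
    have "x (n + Suc p) a = (\<Sum>b<n. X $$ (a,b) * (\<Sum>j<n. c j * x (j + p) b))"
      using Suc by (simp add: x_Suc)
    also have "\<dots> = (\<Sum>j<n. c j * (\<Sum>b<n. X $$ (a,b) * x (j + p) b))"
      by (simp add: sum_distrib_left) (subst sum.swap, simp add: mult_ac)
    finally show ?case using Suc.prems by (simp add: x_Suc)
  qed
  have "\<exists>j. j < n \<and> c j \<noteq> 0"
  proof (rule ccontr)
    assume "\<not> ?thesis"
    then have "x n a = 0" using coord_expand[OF a(1), of "x n"] by (simp add: c_def)
    with a(2) show False by simp
  qed
  then obtain j where j: "j < n" "c j \<noteq> 0" "\<And>i. i < j \<Longrightarrow> c i = 0"
    using exists_least_iff[of "\<lambda>j. j < n \<and> c j \<noteq> 0"] by (auto dest: dual_order.strict_trans)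
  \<comment> \<open>From \<open>j < n\<close> the index n + (m - 1 - j) is at least m, so the orbit
    has already died out on the left-hand side.\<close>
  have "0 = x (n + (m - 1 - j)) b"
    using step[OF m, of "n + (m - 1 - j)" b] j(1) \<open>m > n\<close> b(1) by simp
  also have "\<dots> = (\<Sum>i<n. c i * x (i + (m - 1 - j)) b)" by (rule exp[OF b(1)])
  also have "\<dots> = (\<Sum>i<n. if i = j then c j * x (m - 1) b else 0)"
  proof (rule sum.cong)
    fix i assume "i \<in> {..<n}"
    consider "i < j" | "i = j" | "j < i" by linarith
    then show "c i * x (i + (m - 1 - j)) b = (if i = j then c j * x (m - 1) b else 0)"
      using j step[OF m, of "i + (m - 1 - j)" b] b(1) \<open>m > n\<close> by cases auto
  qed simp
  also have "\<dots> = c j * x (m - 1) b" using j(1) by simp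
  finally show False using j(2) b(2) by simp
qed

lemma x_zero: "n \<le> m \<Longrightarrow> a < n \<Longrightarrow> x m a = 0"
  by (induction m arbitrary: a rule: dec_induct) (auto simp: x_Suc x_n_zero)

text \<open>In the basis \<open>x\<close> the matrix \<open>X\<close> is the pure shift: it sends x
  j to x (j + 1), and the top vector to x n = 0, so nothing re-enters at lower indices.\<close>

lemma coord_shift:
  assumes "k < n"
  shows "coord k (\<lambda>a. \<Sum>b<n. X $$ (a,b) * v b) = (if k = 0 then 0 else coord (k - 1) v)"
proof -
  have "coord k (\<lambda>a. \<Sum>b<n. X $$ (a,b) * v b) =
      coord k (\<lambda>a. \<Sum>b<n. X $$ (a,b) * (\<Sum>j<n. coord j v * x j b))"
    using coord_expand by (intro coord_cong sum.cong) auto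
  also have "\<dots> = coord k (\<lambda>a. \<Sum>j<n. coord j v * x (Suc j) a)"
  proof (rule coord_cong)
    fix a assume "a < n"
    then show "(\<Sum>b<n. X $$ (a,b) * (\<Sum>j<n. coord j v * x j b)) = (\<Sum>j<n. coord j v * x (Suc j) a)"
      by (simp add: x_Suc sum_distrib_left) (subst sum.swap, simp add: mult_ac)
  qed
  also have "\<dots> = (\<Sum>j<n. coord j v * coord k (x (Suc j)))"
    by (simp add: coord_sum coord_cmult)
  also have "\<dots> = (\<Sum>j<n. if k = Suc j then coord j v else 0)"
  proof (rule sum.cong)
    fix j assume "j \<in> {..<n}"
    then show "coord j v * coord k (x (Suc j)) = (if k = Suc j then coord j v else 0)"
      using assms x_n_zero by (cases "Suc j = n") (auto simp: coord_basis coord_zero)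
  qed simp
  also have "\<dots> = (if k = 0 then 0 else coord (k - 1) v)"
    using assms by (cases k) auto
  finally show ?thesis .
qed

text \<open>The right-hand side is the trace of \<open>Y\<close> written in the basis
  \<open>x\<close>; exchanging the sums makes the basis matrix meet its inverse, which leaves the
  diagonal of \<open>Y\<close>.\<close>

lemma trace_coord_sum:
  assumes "Y \<in> carrier_mat n n"
  shows "mat_trace Y = (\<Sum>r<n. coord r (\<lambda>a. \<Sum>b<n. Y $$ (a,b) * x r b))"
proof -
  let ?F = "mat n n (\<lambda>(a,j). x j a)"
  have "(\<Sum>r<n. coord r (\<lambda>a. \<Sum>b<n. Y $$ (a,b) * x r b)) =
      (\<Sum>r<n. \<Sum>a<n. \<Sum>b<n. Y $$ (a,b) * (x r b * (adj_mat ?F $$ (r,a) / det ?F)))"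
    by (simp add: coord_def sum_divide_distrib sum_distrib_left sum_distrib_right mult_ac)
  also have "\<dots> = (\<Sum>a<n. \<Sum>r<n. \<Sum>b<n. Y $$ (a,b) * (x r b * (adj_mat ?F $$ (r,a) / det ?F)))"
    by (rule sum.swap)
  also have "\<dots> = (\<Sum>a<n. \<Sum>b<n. \<Sum>r<n. Y $$ (a,b) * (x r b * (adj_mat ?F $$ (r,a) / det ?F)))"
    by (intro sum.cong refl sum.swap)
  also have "\<dots> = (\<Sum>a<n. \<Sum>b<n. Y $$ (a,b) * (if b = a then 1 else 0))"
    by (intro sum.cong refl, subst sum_distrib_left[symmetric], subst mat_adj_mat) auto
  also have "\<dots> = (\<Sum>a<n. \<Sum>b<n. if b = a then Y $$ (a,b) else 0)"
    by (intro sum.cong) auto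
  also have "\<dots> = (\<Sum>a<n. Y $$ (a,a))" by simp
  also have "\<dots> = mat_trace Y"
    using assms by (auto simp: mat_trace_def diag_mat_def sum_list_sum_nth atLeast0LessThan)
  finally show ?thesis by simp
qed

lemma pow_mult_x:
  assumes "a < n"
  shows "(\<Sum>b<n. (X ^\<^sub>m k) $$ (a,b) * x j b) = x (j + k) a"
  using assms
proof (induction k arbitrary: j)
  case 0
  have "(\<Sum>b<n. (1\<^sub>m n) $$ (a,b) * x j b) = (\<Sum>b<n. if b = a then x j b else 0)"
    using 0 by (intro sum.cong) auto
  then show ?case using 0 X by auto
next
  case (Suc k)
  have "(\<Sum>b<n. (X ^\<^sub>m Suc k) $$ (a,b) * x j b) =
      (\<Sum>b<n. \<Sum>c<n. (X ^\<^sub>m k) $$ (a,c) * X $$ (c,b) * x j b)"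
    using Suc.prems X by (simp add: index_mult_mat_sum[of _ n] sum_distrib_right del: index_mult_mat(1))
  also have "\<dots> = (\<Sum>c<n. (X ^\<^sub>m k) $$ (a,c) * (\<Sum>b<n. X $$ (c,b) * x j b))"
    by (subst sum.swap) (simp add: sum_distrib_left mult_ac)
  also have "\<dots> = x (Suc j + k) a"
    using Suc.IH[OF Suc.prems, of "Suc j"] by (simp add: x_Suc)
  finally show ?case by simp
qed

text \<open>
  In the basis \<open>x\<close>, where \<open>X\<close> is the shift, the entries of \<open>\<Sum> X^i C X^(n-1-i) x 0\<close> are sums
  along the diagonals of \<open>C\<close>; the perturbation \<open>\<rho>\<close> only reaches the last coordinate.
\<close>

lemma coord_first_order:
  assumes C: "C \<in> carrier_mat n n"
    and w: "\<And>j a. a < n \<Longrightarrow> w (Suc j) a =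
      (\<Sum>b<n. X $$ (a,b) * w j b) + (\<Sum>b<n. C $$ (a,b) * x j b) + \<rho> j a"
    and \<rho>: "\<And>j a. a < n \<Longrightarrow> \<rho> (Suc j) a = (\<Sum>b<n. X $$ (a,b) * \<rho> j b)"
    and k: "2 \<le> k" "k \<le> n"
  shows "coord (n - k) (w n) = mat_trace (C * X ^\<^sub>m (k - 1))"
proof -
  define C' where "C' r j = coord r (\<lambda>a. \<Sum>b<n. C $$ (a,b) * x j b)" for r j
  have \<rho>': "coord r (\<rho> (Suc j)) = (if r = 0 then 0 else coord (r - 1) (\<rho> j))" if "r < n" for r j
    using coord_shift[OF that, of "\<rho> j"] coord_cong[of "\<rho> (Suc j)", OF \<rho>] by simp
  have \<rho>0: "coord r (\<rho> j) = 0" if "r < j" "r < n" for r j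
    using that
  proof (induction r arbitrary: j)
    case 0
    then show ?case using \<rho>'[of 0 "j - 1"] by simp
  next
    case (Suc r)
    then show ?case using \<rho>'[of "Suc r" "j - 1"] by simp
  qed
  have w': "coord r (w (Suc j)) = (if r = 0 then 0 else coord (r - 1) (w j)) + C' r j + coord r (\<rho> j)"
    if "r < n" for r j
    using coord_cong[of "w (Suc j)", OF w] that by (simp add: coord_add coord_shift C'_def)
  \<comment> \<open>For r < j the recursion stops at coordinate 0 before it reaches
    \<open>w 0\<close>, and every \<open>\<rho>\<close> it meets has vanishing coordinate. With r =
    n - k and j = n - 1 this strict inequality is exactly \<open>2 \<le> k\<close>.\<close>
  have "coord r (w (Suc j)) = (\<Sum>i\<le>r. C' i (i + j - r))" if "r < j" "r < n" for r j
    using that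
  proof (induction r arbitrary: j)
    case 0
    then show ?case using w'[of 0 j] \<rho>0[of 0 j] by simp
  next
    case (Suc r)
    have "coord (Suc r) (w (Suc j)) = coord r (w (Suc (j - 1))) + C' (Suc r) j"
      using w'[of "Suc r" j] \<rho>0[of "Suc r" j] Suc.prems by simp
    also have "\<dots> = (\<Sum>i\<le>r. C' i (i + (j - 1) - r)) + C' (Suc r) j"
      using Suc.IH[of "j - 1"] Suc.prems by simp
    finally show ?case using Suc.prems by simp
  qed
  from this[of "n - k" "n - 1"] have "coord (n - k) (w n) = (\<Sum>i\<le>n - k. C' i (i + (n - 1) - (n - k)))"
    using k by simp
  also have "\<dots> = (\<Sum>i\<in>{..n - k}. C' i (i + (k - 1)))"
    using k by (intro sum.cong) auto
  \<comment> \<open>The sum becomes a full trace at no cost: for i > n - k the index i + (k - 1) is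
    at least n, where the orbit is zero.\<close>
  also have "\<dots> = (\<Sum>i<n. C' i (i + (k - 1)))"
  proof (rule sum.mono_neutral_left)
    show "\<forall>i\<in>{..<n} - {..n - k}. C' i (i + (k - 1)) = 0"
      unfolding C'_def using k by (intro ballI coord_zero sum.neutral) (auto intro!: x_zero)
  qed (use k in auto)
  also have "\<dots> = (\<Sum>i<n. coord i (\<lambda>a. \<Sum>b<n. (C * X ^\<^sub>m (k - 1)) $$ (a,b) * x i b))"
  proof (rule sum.cong[OF refl])
    fix i
    have "(\<Sum>b<n. C $$ (a,b) * x (i + (k - 1)) b) = (\<Sum>b<n. (C * X ^\<^sub>m (k - 1)) $$ (a,b) * x i b)"
      if a: "a < n" for a
    proof -
      have "(\<Sum>b<n. C $$ (a,b) * x (i + (k - 1)) b) =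
          (\<Sum>b<n. C $$ (a,b) * (\<Sum>c<n. (X ^\<^sub>m (k - 1)) $$ (b,c) * x i c))"
        by (simp add: pow_mult_x)
      also have "\<dots> = (\<Sum>c<n. (\<Sum>b<n. C $$ (a,b) * (X ^\<^sub>m (k - 1)) $$ (b,c)) * x i c)"
        by (simp add: sum_distrib_left sum_distrib_right) (subst sum.swap, simp add: mult_ac)
      finally show ?thesis using a C X
        by (simp add: index_mult_mat_sum[of _ n] del: index_mult_mat(1))
    qed
    then show "C' i (i + (k - 1)) = coord i (\<lambda>a. \<Sum>b<n. (C * X ^\<^sub>m (k - 1)) $$ (a,b) * x i b)"
      unfolding C'_def by (rule coord_cong)
  qed
  also have "\<dots> = mat_trace (C * X ^\<^sub>m (k - 1))"
    using C X by (intro trace_coord_sum[symmetric]) auto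
  finally show ?thesis .
qed

end

section \<open>Iterated covariant derivatives\<close>

lemma smooth_matD:
  "smooth_mat n U B \<Longrightarrow> z \<in> U \<Longrightarrow> B z \<in> carrier_mat n n"
  "smooth_mat n U B \<Longrightarrow> i < n \<Longrightarrow> j < n \<Longrightarrow> smooth_on U (\<lambda>z. B z $$ (i,j))"
  by (auto simp: smooth_mat_def)

lemma smooth_vecD:
  "smooth_vec n U v \<Longrightarrow> z \<in> U \<Longrightarrow> v z \<in> carrier_vec n"
  "smooth_vec n U v \<Longrightarrow> i < n \<Longrightarrow> smooth_on U (\<lambda>z. v z $ i)"
  by (auto simp: smooth_vec_def)

lemma smooth_mat_conn_form:
  assumes "open U" "smooth_mat n U X" "smooth_mat n U A" "smooth_mat n U Y"
  shows "smooth_mat n U (conn_form X A Y l)"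
proof -
  have "smooth_on U (\<lambda>z. conn_form X A Y l z $$ (i,j))" if "i < n" "j < n" for i j
  proof (rule smooth_on_cong[OF assms(1)])
    show "smooth_on U (\<lambda>z. (l * X z $$ (i,j) + A z $$ (i,j)) + inverse l * Y z $$ (i,j))"
      using assms that by (intro smooth_on_add smooth_on_mult smooth_on_const smooth_matD)
  qed (use assms that in \<open>auto simp: conn_form_def dest!: smooth_matD(1)\<close>)
  then show ?thesis
    using assms by (auto simp: smooth_mat_def conn_form_def)
qed

lemma conn_form_index:
  assumes "X z \<in> carrier_mat n n" "A z \<in> carrier_mat n n" "Y z \<in> carrier_mat n n" "i < n" "j < n"
  shows "conn_form X A Y l z $$ (i,j) = l * X z $$ (i,j) + A z $$ (i,j) + inverse l * Y z $$ (i,j)"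
  using assms by (auto simp: conn_form_def)

lemma nabla_index:
  assumes "B z \<in> carrier_mat n n" "v z \<in> carrier_vec n" "a < n"
  shows "nabla n B v z $ a = dz (\<lambda>w. v w $ a) z + (\<Sum>b<n. B z $$ (a,b) * v z $ b)"
  using assms index_mult_mat_vec_sum[OF assms] by (simp add: nabla_def vec_deriv_def)

lemma nabla_index_smooth:
  assumes "smooth_mat n U B" "smooth_vec n U v" "z \<in> U" "a < n"
  shows "nabla n B v z $ a = dz (\<lambda>w. v w $ a) z + (\<Sum>b<n. B z $$ (a,b) * v z $ b)"
  using assms by (intro nabla_index smooth_matD(1) smooth_vecD(1))

lemma nabla_bar_index:
  assumes "B z \<in> carrier_mat n n" "v z \<in> carrier_vec n" "a < n"
  shows "nabla_bar n B v z $ a = dzbar (\<lambda>w. v w $ a) z + (\<Sum>b<n. B z $$ (a,b) * v z $ b)"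
  using assms index_mult_mat_vec_sum[OF assms] by (simp add: nabla_bar_def vec_deriv_def)

lemma smooth_vec_nabla:
  assumes "open U" "smooth_mat n U B" "smooth_vec n U v"
  shows "smooth_vec n U (nabla n B v)"
proof -
  have "smooth_on U (\<lambda>z. nabla n B v z $ i)" if "i < n" for i
  proof (rule smooth_on_cong[OF assms(1)])
    show "smooth_on U (\<lambda>z. dz (\<lambda>w. v w $ i) z + (\<Sum>b<n. B z $$ (i,b) * v z $ b))"
      using assms that
      by (intro smooth_on_add smooth_on_sum smooth_on_mult smooth_on_dz smooth_matD smooth_vecD) auto
  qed (use assms that in \<open>simp add: nabla_index smooth_matD(1) smooth_vecD(1)\<close>)
  then show ?thesis
    using assms by (auto simp: smooth_vec_def smooth_mat_def nabla_def vec_deriv_def)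
qed

lemma smooth_vec_nabla_pow:
  "open U \<Longrightarrow> smooth_mat n U B \<Longrightarrow> smooth_vec n U v \<Longrightarrow> smooth_vec n U ((nabla n B ^^ j) v)"
  by (induction j) (auto intro: smooth_vec_nabla)

lemma nabla_cong:
  assumes "open U" "\<And>z. z \<in> U \<Longrightarrow> v z = w z" "z \<in> U"
  shows "nabla n B v z = nabla n B w z"
proof -
  have "dz (\<lambda>z. v z $ i) z = dz (\<lambda>z. w z $ i) z" for i
    using assms by (intro dz_cong[OF assms(1)]) auto
  then show ?thesis using assms by (simp add: nabla_def vec_deriv_def)
qed

lemma nabla_pow_cong:
  assumes "open U" "\<And>z. z \<in> U \<Longrightarrow> v z = w z" "z \<in> U"
  shows "(nabla n B ^^ j) v z = (nabla n B ^^ j) w z"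
  using assms(3)
proof (induction j arbitrary: z)
  case 0
  then show ?case using assms(2) by simp
next
  case (Suc j)
  then show ?case using nabla_cong[OF assms(1) Suc.IH] by simp
qed

text \<open>Pascal's rule, as needed for the inductive step of the Leibniz formula with
  \<open>D m\<close> = \<partial>^m f and \<open>V i\<close> = \<nabla>^i v.\<close>

lemma leibniz_sum:
  fixes D V :: "nat \<Rightarrow> complex"
  shows "(\<Sum>i\<le>j. of_nat (j choose i) * D (Suc j - i) * V i) +
    (\<Sum>i\<le>j. of_nat (j choose i) * D (j - i) * V (Suc i)) =
    (\<Sum>i\<le>Suc j. of_nat (Suc j choose i) * D (Suc j - i) * V i)"
proof -
  have "(\<Sum>i\<le>Suc j. of_nat (Suc j choose i) * D (Suc j - i) * V i) =
      D (Suc j) * V 0 + (\<Sum>i\<le>j. of_nat (Suc j choose Suc i) * D (j - i) * V (Suc i))"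
    by (subst sum.atMost_Suc_shift) simp
  also have "\<dots> = (D (Suc j) * V 0 + (\<Sum>i\<le>j. of_nat (j choose Suc i) * D (j - i) * V (Suc i))) +
      (\<Sum>i\<le>j. of_nat (j choose i) * D (j - i) * V (Suc i))"
    by (simp add: algebra_simps sum.distrib)
  also have "D (Suc j) * V 0 + (\<Sum>i\<le>j. of_nat (j choose Suc i) * D (j - i) * V (Suc i)) =
      (\<Sum>i\<le>Suc j. of_nat (j choose i) * D (Suc j - i) * V i)"
    by (subst sum.atMost_Suc_shift) simp
  also have "\<dots> = (\<Sum>i\<le>j. of_nat (j choose i) * D (Suc j - i) * V i)" by simp
  finally show ?thesis by simp
qed

text \<open>The connection matrix is linear over functions, hence \<nabla>(f v) = (\<partial>f) v +
  f \<nabla>v, and the binomial formula follows as for ordinary derivatives.\<close>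

lemma nabla_pow_leibniz:
  assumes U: "open U" and B: "smooth_mat n U B" and v: "smooth_vec n U v" and f: "smooth_on U f"
    and "z \<in> U" "a < n"
  shows "(nabla n B ^^ j) (\<lambda>z. f z \<cdot>\<^sub>v v z) z $ a =
    (\<Sum>i\<le>j. of_nat (j choose i) * (dz ^^ (j - i)) f z * (nabla n B ^^ i) v z $ a)"
  using assms(5,6)
proof (induction j arbitrary: z a)
  case 0
  then show ?case using v by (auto dest: smooth_vecD)
next
  case (Suc j)
  let ?V = "\<lambda>i. (nabla n B ^^ i) v"
  let ?W = "(nabla n B ^^ j) (\<lambda>z. f z \<cdot>\<^sub>v v z)"
  have V: "smooth_vec n U (?V i)" for i by (rule smooth_vec_nabla_pow[OF U B v])
  have "smooth_vec n U (\<lambda>z. f z \<cdot>\<^sub>v v z)"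
  proof -
    have "smooth_on U (\<lambda>z. (f z \<cdot>\<^sub>v v z) $ i)" if "i < n" for i
      by (rule smooth_on_cong[OF U smooth_on_mult[OF U f smooth_vecD(2)[OF v that]]])
        (simp add: that carrier_vecD[OF smooth_vecD(1)[OF v]])
    then show ?thesis using v by (auto simp: smooth_vec_def)
  qed
  then have W: "smooth_vec n U ?W" by (rule smooth_vec_nabla_pow[OF U B])
  have D: "smooth_on U ((dz ^^ m) f)" for m by (rule smooth_on_dz_pow[OF U f])
  have "dz (\<lambda>w. ?W w $ a) z =
      dz (\<lambda>w. \<Sum>i\<le>j. of_nat (j choose i) * ((dz ^^ (j - i)) f w * ?V i w $ a)) z"
    using Suc by (intro dz_cong[OF U]) (simp_all add: mult_ac)
  also have "\<dots> = (\<Sum>i\<le>j. dz (\<lambda>w. of_nat (j choose i) * ((dz ^^ (j - i)) f w * ?V i w $ a)) z)"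
    using Suc.prems by (intro dz_sum[OF U] smooth_on_mult[OF U] smooth_on_const D smooth_vecD(2)[OF V])
  also have "\<dots> = (\<Sum>i\<le>j. of_nat (j choose i) * ((dz ^^ (Suc j - i)) f z * ?V i z $ a +
      (dz ^^ (j - i)) f z * dz (\<lambda>w. ?V i w $ a) z))"
  proof (rule sum.cong[OF refl])
    fix i assume "i \<in> {..j}"
    then have "dz ((dz ^^ (j - i)) f) = (dz ^^ (Suc j - i)) f" by (simp add: Suc_diff_le)
    then show "dz (\<lambda>w. of_nat (j choose i) * ((dz ^^ (j - i)) f w * ?V i w $ a)) z =
        of_nat (j choose i) * ((dz ^^ (Suc j - i)) f z * ?V i z $ a +
        (dz ^^ (j - i)) f z * dz (\<lambda>w. ?V i w $ a) z)"
      using dz_cmult[OF smooth_on_mult[OF U D smooth_vecD(2)[OF V Suc.prems(2)]] Suc.prems(1)]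
        dz_mult[OF D smooth_vecD(2)[OF V Suc.prems(2)] Suc.prems(1)] by simp
  qed
  finally have 1: "dz (\<lambda>w. ?W w $ a) z = \<dots>" .
  have "(\<Sum>b<n. B z $$ (a,b) * ?W z $ b) =
      (\<Sum>b<n. \<Sum>i\<le>j. of_nat (j choose i) * (dz ^^ (j - i)) f z * (B z $$ (a,b) * ?V i z $ b))"
    using Suc.prems by (simp add: Suc.IH sum_distrib_left mult_ac)
  also have "\<dots> = (\<Sum>i\<le>j. of_nat (j choose i) * (dz ^^ (j - i)) f z * (\<Sum>b<n. B z $$ (a,b) * ?V i z $ b))"
    by (subst sum.swap) (simp add: sum_distrib_left)
  finally have 2: "(\<Sum>b<n. B z $$ (a,b) * ?W z $ b) = \<dots>" .
  have 3: "?V (Suc i) z $ a = dz (\<lambda>w. ?V i w $ a) z + (\<Sum>b<n. B z $$ (a,b) * ?V i z $ b)" for i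
    using nabla_index_smooth[OF B V Suc.prems]
    by simp
  have "(nabla n B ^^ Suc j) (\<lambda>z. f z \<cdot>\<^sub>v v z) z $ a =
      dz (\<lambda>w. ?W w $ a) z + (\<Sum>b<n. B z $$ (a,b) * ?W z $ b)"
    using nabla_index_smooth[OF B W Suc.prems]
    by simp
  also have "\<dots> = (\<Sum>i\<le>j. of_nat (j choose i) * (dz ^^ (Suc j - i)) f z * ?V i z $ a) +
    (\<Sum>i\<le>j. of_nat (j choose i) * (dz ^^ (j - i)) f z * ?V (Suc i) z $ a)"
    unfolding 1 2 3 sum.distrib[symmetric] by (intro sum.cong refl) (simp add: algebra_simps)
  finally show ?case
    using leibniz_sum[of j "\<lambda>m. (dz ^^ m) f z" "\<lambda>i. ?V i z $ a"] by simp
qed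

text \<open>Differentiating \<partial>^m f Q^m = f Y_m, multiplying by Q and eliminating Q
  \<partial>f by the equation gives the recursion Y_(m+1) = Q \<partial>Y_m - R Y_m / n - m
  (\<partial>Q) Y_m. It does not mention \<open>f\<close>, so one family \<open>Y\<close>,
  polynomial in e, serves all e, \<open>V\<close> and \<open>f\<close>; multiplying by powers of
  \<open>Q\<close> avoids any division.\<close>

lemma log_derivative_iterates:
  assumes U: "open U" and Q: "polyfn U Q" and R: "polyfn U R" and n: "n > 0"
  obtains Y where "\<And>m. polyfn U (Y m)" "Y 0 = (\<lambda>e z. 1)"
    "\<And>e V f m z. open V \<Longrightarrow> V \<subseteq> U \<Longrightarrow> smooth_on V f \<Longrightarrow>
      (\<And>z. z \<in> V \<Longrightarrow> of_nat n * dz f z * Q e z = - (f z * R e z)) \<Longrightarrow> z \<in> V \<Longrightarrow>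
      (dz ^^ m) f z * Q e z ^ m = f z * Y m e z"
proof -
  define Y where "Y = rec_nat (\<lambda>e z. 1) (\<lambda>m y e z. Q e z * dz (y e) z +
    (- 1 / of_nat n) * (R e z * y e z) + (- of_nat m) * (dz (Q e) z * y e z))"
  have Y_Suc: "Y (Suc m) = (\<lambda>e z. Q e z * dz (Y m e) z + (- 1 / of_nat n) * (R e z * Y m e z) +
      (- of_nat m) * (dz (Q e) z * Y m e z))" for m
    by (simp add: Y_def)
  have Y0: "Y 0 = (\<lambda>e z. 1)" by (simp add: Y_def)
  have Y: "polyfn U (Y m)" for m
  proof (induction m)
    case (Suc m)
    then show ?case unfolding Y_Suc
      by (intro polyfn_add polyfn_mult polyfn_const Q R polyfn_dz[OF U])
  qed (simp add: Y0 polyfn_const)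
  show thesis
  proof (rule that[of Y])
    fix e V f m z
    assume V: "open V" "V \<subseteq> U" and f: "smooth_on V f" and
      eq: "\<And>z. z \<in> V \<Longrightarrow> of_nat n * dz f z * Q e z = - (f z * R e z)" and "z \<in> V"
    have Qs: "smooth_on V (Q e)" by (rule smooth_on_subset[OF polyfn_smooth[OF U Q] V(2)])
    have Qm: "smooth_on V (\<lambda>z. Q e z ^ m)" for m
      by (rule smooth_on_subset[OF polyfn_smooth[OF U polyfn_power[OF Q]] V(2)])
    have Ys: "smooth_on V (Y m e)" for m by (rule smooth_on_subset[OF polyfn_smooth[OF U Y] V(2)])
    have D: "smooth_on V ((dz ^^ m) f)" for m by (rule smooth_on_dz_pow[OF V(1) f])
    \<comment> \<open>The extra factor \<open>Q\<close> avoids the exponent m - 1, so that m = 0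
      needs no separate treatment.\<close>
    have dQ: "dz (\<lambda>z. Q e z ^ m) z * Q e z = of_nat m * dz (Q e) z * Q e z ^ m" if "z \<in> V" for m z
    proof (induction m)
      case (Suc m)
      have "dz (\<lambda>z. Q e z ^ Suc m) z = dz (Q e) z * Q e z ^ m + Q e z * dz (\<lambda>z. Q e z ^ m) z"
        using dz_mult[OF Qs Qm that] by simp
      then show ?case using Suc by (simp add: algebra_simps)
    qed simp
    show "(dz ^^ m) f z * Q e z ^ m = f z * Y m e z"
      using \<open>z \<in> V\<close>
    proof (induction m arbitrary: z)
      case 0
      then show ?case by (simp add: Y0)
    next
      case (Suc m)
      have "dz (\<lambda>z. (dz ^^ m) f z * Q e z ^ m) z = dz (\<lambda>z. f z * Y m e z) z"
        using Suc by (intro dz_cong[OF V(1)])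
      then have "(dz ^^ Suc m) f z * Q e z ^ m + (dz ^^ m) f z * dz (\<lambda>z. Q e z ^ m) z =
          dz f z * Y m e z + f z * dz (Y m e) z"
        using dz_mult[OF D Qm Suc.prems] dz_mult[OF f Ys Suc.prems] by simp
      then have "((dz ^^ Suc m) f z * Q e z ^ m + (dz ^^ m) f z * dz (\<lambda>z. Q e z ^ m) z) * Q e z =
          (dz f z * Y m e z + f z * dz (Y m e) z) * Q e z" by simp
      moreover have "(dz ^^ m) f z * dz (\<lambda>z. Q e z ^ m) z * Q e z =
          of_nat m * dz (Q e) z * ((dz ^^ m) f z * Q e z ^ m)"
        using dQ[OF Suc.prems, of m] by (simp add: mult_ac)
      ultimately have "(dz ^^ Suc m) f z * Q e z ^ Suc m =
          dz f z * Q e z * Y m e z + f z * dz (Y m e) z * Q e z - of_nat m * dz (Q e) z * (f z * Y m e z)"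
        using Suc.IH[OF Suc.prems] by (simp add: algebra_simps)
      also have "dz f z * Q e z = (- 1 / of_nat n) * (f z * R e z)"
        using eq[OF Suc.prems] n by (simp add: field_simps)
      finally show ?case by (simp add: Y_Suc algebra_simps)
    qed
  qed (simp_all add: Y Y0)
qed

section \<open>The pencil near e = 0 and a section polynomial in e\<close>

locale nilpotent_pencil =
  fixes n :: nat and U :: "complex set" and z0 :: complex
    and M A N :: "complex \<Rightarrow> complex mat" and d :: nat and \<sigma> :: "nat \<Rightarrow> complex \<Rightarrow> complex vec"
  assumes n: "n \<ge> 2" and U: "open U" and z0: "z0 \<in> U"
    and M: "smooth_mat n U M" and A: "smooth_mat n U A" and N: "smooth_mat n U N"
    and nilpotent: "\<And>z. z \<in> U \<Longrightarrow> nilpotent_mat n (M z)"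
    and \<sigma>: "\<And>j. j \<le> d \<Longrightarrow> smooth_vec n U (\<sigma> j)"
    and cyclic: "cyclic_vec n (M z0) (\<sigma> 0 z0)"
begin

definition tau :: "complex \<Rightarrow> complex \<Rightarrow> complex vec" where
  "tau e z = lin_comb n {..d} (\<lambda>j. e ^ j) (\<lambda>j. \<sigma> j z)"

abbreviation B :: "complex \<Rightarrow> complex \<Rightarrow> complex mat" where
  "B e \<equiv> conn_form N A M e"

text \<open>
  The components of \<open>(e \<nabla>)^j tau\<close> for \<open>\<nabla> = \<partial> + e N + A + e^(-1) M\<close>; these make sense at
  \<open>e = 0\<close> too.
\<close>

primrec E :: "nat \<Rightarrow> nat \<Rightarrow> complex \<Rightarrow> complex \<Rightarrow> complex" where
  "E 0 = (\<lambda>a e z. \<Sum>j\<le>d. e ^ j * \<sigma> j z $ a)"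
| "E (Suc j) = (\<lambda>a e z. (\<Sum>b<n. M z $$ (a,b) * E j b e z)
     + e * (dz (E j a e) z + (\<Sum>b<n. A z $$ (a,b) * E j b e z))
     + e ^ 2 * (\<Sum>b<n. N z $$ (a,b) * E j b e z))"

definition Q :: "complex \<Rightarrow> complex \<Rightarrow> complex" where
  "Q e z = det (mat n n (\<lambda>(a,j). E j a e z))"

definition K :: "nat \<Rightarrow> nat \<Rightarrow> complex \<Rightarrow> complex \<Rightarrow> complex" where
  "K k a e z = adj_mat (mat n n (\<lambda>(a,j). E j a e z)) $$ (k,a)"

text \<open>By Cramer's rule P / Q is the coordinate of (e \<nabla>)^n tau along (e \<nabla>)^(n-1)
  tau wherever \<open>Q\<close> is nonzero: the component that the normalisation of s has to
  remove.\<close>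

definition P :: "complex \<Rightarrow> complex \<Rightarrow> complex" where
  "P e z = (\<Sum>a<n. K (n - 1) a e z * E n a e z)"

lemma polyfn_E: "a < n \<Longrightarrow> polyfn U (E j a)"
proof (induction j arbitrary: a)
  case 0
  then show ?case using \<sigma>
    by (auto intro!: polyfn_sum polyfn_mult polyfn_power polyfn_param polyfn_coeff smooth_vecD(2))
next
  case (Suc j)
  then show ?case using M A N
    by (auto intro!: polyfn_add polyfn_sum polyfn_mult polyfn_power polyfn_param polyfn_dz[OF U]
        polyfn_coeff smooth_matD(2))
qed

lemma polyfn_Q: "polyfn U Q"
proof -
  \<comment> \<open>The closure lemma speaks of functions of one argument, so e and z are passed as
    a pair.\<close>
  have "polyfn U (\<lambda>e z. (\<lambda>x. det (mat n n (\<lambda>(a,j). E j a (fst x) (snd x)))) (e, z))"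
    by (rule det_mat_closed[where C = "\<lambda>F. polyfn U (\<lambda>e z. F (e, z))"])
      (auto intro: polyfn_const polyfn_add polyfn_mult polyfn_E)
  then show ?thesis by (simp add: Q_def[abs_def])
qed

lemma polyfn_K:
  assumes "k < n" "a < n"
  shows "polyfn U (K k a)"
proof -
  have "polyfn U (\<lambda>e z. (\<lambda>x. adj_mat (mat n n (\<lambda>(a,j). E j a (fst x) (snd x))) $$ (k,a)) (e, z))"
    by (rule adj_mat_closed[where C = "\<lambda>F. polyfn U (\<lambda>e z. F (e, z))"])
      (auto intro: polyfn_const polyfn_add polyfn_mult polyfn_E assms)
  then show ?thesis by (simp add: K_def[abs_def])
qed

lemma polyfn_P: "polyfn U P"
  unfolding P_def[abs_def] using n
  by (intro polyfn_sum polyfn_mult polyfn_K polyfn_E) auto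

lemma K_E:
  assumes "k < n" "j < n"
  shows "(\<Sum>a<n. K k a e z * E j a e z) = (if j = k then Q e z else 0)"
  using adj_mat_row[of "mat n n (\<lambda>(a,j). E j a e z)" n k j] assms by (simp add: K_def Q_def)

lemma smooth_tau: "smooth_vec n U (tau e)"
proof -
  have "smooth_on U (\<lambda>z. \<Sum>j\<le>d. e ^ j * \<sigma> j z $ i)" if "i < n" for i
    using \<sigma> that by (intro smooth_on_sum smooth_on_mult smooth_on_const smooth_vecD U) auto
  then show ?thesis by (simp add: smooth_vec_def tau_def lin_comb_def)
qed

lemma smooth_B: "smooth_mat n U (B e)"
  by (rule smooth_mat_conn_form[OF U N A M])

lemma nabla_tau:
  assumes "e \<noteq> 0" "z \<in> U" "a < n"
  shows "(nabla n (B e) ^^ j) (tau e) z $ a = inverse e ^ j * E j a e z"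
  using assms(2,3)
proof (induction j arbitrary: z a)
  case 0
  then show ?case by (simp add: tau_def lin_comb_def)
next
  case (Suc j)
  have "dz (\<lambda>w. (nabla n (B e) ^^ j) (tau e) w $ a) z = dz (\<lambda>w. inverse e ^ j * E j a e w) z"
    using Suc by (intro dz_cong[OF U])
  also have "\<dots> = inverse e ^ j * dz (E j a e) z"
    by (rule dz_cmult[OF polyfn_smooth[OF U polyfn_E[OF Suc.prems(2)]] Suc.prems(1)])
  finally have "(nabla n (B e) ^^ Suc j) (tau e) z $ a = inverse e ^ j * dz (E j a e) z +
      (\<Sum>b<n. B e z $$ (a,b) * (inverse e ^ j * E j b e z))"
    using nabla_index_smooth[OF smooth_B smooth_vec_nabla_pow[OF U smooth_B smooth_tau] Suc.prems]
      Suc by simp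
  also have "(\<Sum>b<n. B e z $$ (a,b) * (inverse e ^ j * E j b e z)) =
      inverse e ^ j * (e * (\<Sum>b<n. N z $$ (a,b) * E j b e z) + (\<Sum>b<n. A z $$ (a,b) * E j b e z) +
        inverse e * (\<Sum>b<n. M z $$ (a,b) * E j b e z))"
    unfolding sum_distrib_left sum.distrib[symmetric]
  proof (rule sum.cong[OF refl])
    fix b assume "b \<in> {..<n}"
    then have "B e z $$ (a,b) = e * N z $$ (a,b) + A z $$ (a,b) + inverse e * M z $$ (a,b)"
      using Suc.prems M A N by (intro conn_form_index smooth_matD) auto
    then show "B e z $$ (a,b) * (inverse e ^ j * E j b e z) =
        inverse e ^ j * (e * (N z $$ (a,b) * E j b e z) + A z $$ (a,b) * E j b e z +
        inverse e * (M z $$ (a,b) * E j b e z))"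
      by (simp add: algebra_simps)
  qed
  finally show ?case
    using assms(1) by (simp add: field_simps power2_eq_square)
qed

lemma E_at_0:
  assumes "z \<in> U" "a < n"
  shows "E j a 0 z = (M z ^\<^sub>m j *\<^sub>v \<sigma> 0 z) $ a"
  using assms(2)
proof (induction j arbitrary: a)
  case 0
  have "(\<Sum>j\<le>d. 0 ^ j * \<sigma> j z $ a) = (\<Sum>j\<le>d. if j = 0 then \<sigma> j z $ a else 0)"
    by (intro sum.cong) auto
  then show ?case
    using smooth_vecD(1)[OF \<sigma>[of 0] assms(1)] smooth_matD(1)[OF M assms(1)] by simp
next
  case (Suc j)
  note MC = smooth_matD(1)[OF M assms(1)] and SC = smooth_vecD(1)[OF \<sigma>[of 0] assms(1), simplified]
  have "M z ^\<^sub>m j *\<^sub>v \<sigma> 0 z \<in> carrier_vec n"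
    using MC SC by (intro mult_mat_vec_carrier[of _ n n]) auto
  then have "(M z ^\<^sub>m Suc j *\<^sub>v \<sigma> 0 z) $ a = (\<Sum>b<n. M z $$ (a,b) * (M z ^\<^sub>m j *\<^sub>v \<sigma> 0 z) $ b)"
    unfolding mat_pow_mult_vec_Suc[OF MC SC] by (rule index_mult_mat_vec_sum[OF MC _ Suc.prems])
  then show ?case using Suc by simp
qed

lemma cyclic_iff_Q:
  assumes "z \<in> U"
  shows "cyclic_vec n (M z) (\<sigma> 0 z) \<longleftrightarrow> Q 0 z \<noteq> 0"
proof -
  have "mat_of_cols n (map (\<lambda>j. M z ^\<^sub>m j *\<^sub>v \<sigma> 0 z) [0..<n]) = mat n n (\<lambda>(a,j). E j a 0 z)"
    using E_at_0[OF assms] by (intro eq_matI) (auto simp: mat_of_cols_index)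
  then show ?thesis
    unfolding cyclic_vec_def Q_def by (metis invertible_mat_iff_det mat_carrier)
qed

lemma Q_z0: "Q 0 z0 \<noteq> 0"
  using cyclic_iff_Q[OF z0] cyclic by simp

text \<open>The set on which \<open>\<sigma> 0\<close> stays cyclic for \<open>M\<close>. An open
  neighbourhood of \<open>z0\<close> is required because the consequences of M^n = 0 are
  differentiated in z.\<close>

definition W :: "complex set" where "W = {z \<in> U. Q 0 z \<noteq> 0}"

lemma W: "open W" "z0 \<in> W" "W \<subseteq> U"
proof -
  have "W = U \<inter> Q 0 -` (- {0})" by (auto simp: W_def)
  then show "open W"
    using continuous_open_preimage[OF smooth_on_continuous[OF polyfn_smooth[OF U polyfn_Q]] U,
      of "- {0}" 0] by (simp add: open_Compl)
qed (use z0 Q_z0 in \<open>auto simp: W_def\<close>)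

lemma cyclic_basis_W:
  assumes "z \<in> W"
  shows "cyclic_basis n (M z) (\<lambda>j a. E j a 0 z)"
proof
  have z: "z \<in> U" using assms W by auto
  show "0 < n" using n by simp
  show "M z \<in> carrier_mat n n" by (rule smooth_matD(1)[OF M z])
  show "det (mat n n (\<lambda>(a,j). E j a 0 z)) \<noteq> 0" using assms by (simp add: W_def Q_def)
  obtain m where "M z ^\<^sub>m m = 0\<^sub>m n n" using nilpotent[OF z] by (auto simp: nilpotent_mat_def)
  then show "\<exists>m. \<forall>a<n. E m a 0 z = 0"
    using E_at_0[OF z] smooth_vecD(1)[OF \<sigma>[of 0] z] by (intro exI[of _ m]) auto
qed simp

text \<open>At e = 0 the vector (e \<nabla>)^n tau is M^n (\<sigma> 0) = 0. Hence \<open>P\<close>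
  is divisible by e on \<open>W\<close>, which keeps \<partial>f / f free of a pole at e =
  0.\<close>

lemma P_0: "z \<in> W \<Longrightarrow> P 0 z = 0"
  using cyclic_basis.x_n_zero[OF cyclic_basis_W] by (simp add: P_def)

section \<open>The scalar factor at one parameter value\<close>

context
  fixes e V f s
  assumes e: "e \<noteq> 0" and V: "open V" "V \<subseteq> U" and f: "smooth_on V f"
    and s: "\<And>z. z \<in> V \<Longrightarrow> s z = f z \<cdot>\<^sub>v tau e z"
begin

lemma nabla_section:
  assumes "z \<in> V" "a < n"
  shows "(nabla n (B e) ^^ j) s z $ a =
    (\<Sum>i\<le>j. of_nat (j choose i) * (dz ^^ (j - i)) f z * (inverse e ^ i * E i a e z))"
proof -
  have B: "smooth_mat n V (B e)"
    using smooth_B V(2) unfolding smooth_mat_def by (blast intro: smooth_on_subset)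
  have t: "smooth_vec n V (tau e)"
    using smooth_tau V(2) unfolding smooth_vec_def by (blast intro: smooth_on_subset)
  have "(nabla n (B e) ^^ j) s z = (nabla n (B e) ^^ j) (\<lambda>z. f z \<cdot>\<^sub>v tau e z) z"
    by (rule nabla_pow_cong[OF V(1) s assms(1)])
  then show ?thesis
    using nabla_pow_leibniz[OF V(1) B t f assms, of j] nabla_tau[OF e _ assms(2), of z] assms(1) V(2)
    by (simp add: subset_iff)
qed

text \<open>By the Leibniz formula the frame of s is the matrix of the (e \<nabla>)^j tau times an
  upper triangular matrix with diagonal entries f e^(-i), none of which is zero.\<close>

lemma invertible_frame_iff:
  assumes z: "z \<in> V" and "f z \<noteq> 0"
  shows "invertible_mat (frame n (B e) s z) \<longleftrightarrow> Q e z \<noteq> 0"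
proof -
  define T where "T = mat n n (\<lambda>(i,j). if i \<le> j
    then of_nat (j choose i) * (dz ^^ (j - i)) f z * inverse e ^ i else 0)"
  define F where "F = mat n n (\<lambda>(a,j). E j a e z)"
  have T: "T \<in> carrier_mat n n" and F: "F \<in> carrier_mat n n" by (simp_all add: T_def F_def)
  have "frame n (B e) s z = F * T"
  proof (rule eq_matI)
    fix a j assume "a < dim_row (F * T)" "j < dim_col (F * T)"
    then have aj: "a < n" "j < n" using F T by auto
    have "(F * T) $$ (a,j) = (\<Sum>i<n. E i a e z * (if i \<le> j
        then of_nat (j choose i) * (dz ^^ (j - i)) f z * inverse e ^ i else 0))"
      using aj by (subst index_mult_mat_sum[OF F T]) (auto simp: F_def T_def)
    also have "\<dots> = (\<Sum>i\<le>j. E i a e z * (if i \<le> j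
        then of_nat (j choose i) * (dz ^^ (j - i)) f z * inverse e ^ i else 0))"
      using aj by (intro sum.mono_neutral_right) auto
    also have "\<dots> = (nabla n (B e) ^^ j) s z $ a"
      unfolding nabla_section[OF z aj(1)] by (intro sum.cong) auto
    finally show "frame n (B e) s z $$ (a,j) = (F * T) $$ (a,j)"
      using aj by (simp add: frame_def mat_of_cols_index)
  qed (use F T in \<open>auto simp: frame_def\<close>)
  moreover have "det T \<noteq> 0"
  proof -
    have "det T = prod_list (diag_mat T)"
      by (rule det_upper_triangular[OF _ T]) (auto simp: T_def upper_triangular_def)
    moreover have "0 \<notin> set (diag_mat T)"
      using e assms(2) by (auto simp: diag_mat_def T_def)
    ultimately show ?thesis by (simp add: prod_list_zero_iff)
  qed
  moreover have "invertible_mat (F * T) \<longleftrightarrow> det F * det T \<noteq> 0"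
    using invertible_mat_iff_det[of "F * T" n] det_mult[OF F T] F T by simp
  ultimately show ?thesis by (simp add: Q_def F_def)
qed

text \<open>
  Row \<open>n - 1\<close> of the adjugate kills \<open>tau, ..., \<nabla>^(n-2) tau\<close>, so it turns the normalisation
  of \<open>s\<close> into a differential equation for the factor \<open>f\<close>.
\<close>

lemma scalar_factor_equation:
  assumes z: "z \<in> V"
    and th: "(nabla n (B e) ^^ n) s z =
      lin_comb n {2..n} th (\<lambda>k. (nabla n (B e) ^^ (n - k)) s z)"
  shows "of_nat n * dz f z * Q e z * e = - (f z * P e z)"
proof -
  define \<phi> where "\<phi> v = (\<Sum>a<n. K (n - 1) a e z * v a)" for v
  have \<phi>_sum: "\<phi> (\<lambda>a. \<Sum>i\<in>I. c i * v i a) = (\<Sum>i\<in>I. c i * \<phi> (v i))" for I :: "nat set" and c v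
    unfolding \<phi>_def sum_distrib_left by (subst sum.swap) (simp add: mult_ac)
  have \<phi>_E: "\<phi> (\<lambda>a. E i a e z) = (if i = n - 1 then Q e z else 0)" if "i < n" for i
    using K_E[of "n - 1" i e z] that by (simp add: \<phi>_def)
  have \<phi>_cong: "\<phi> v = \<phi> w" if "\<And>a. a < n \<Longrightarrow> v a = w a" for v w
    using that by (simp add: \<phi>_def)
  have \<phi>_s: "\<phi> (\<lambda>a. (nabla n (B e) ^^ j) s z $ a) =
      (\<Sum>i\<le>j. of_nat (j choose i) * (dz ^^ (j - i)) f z * inverse e ^ i * \<phi> (\<lambda>a. E i a e z))" for j
  proof -
    have "\<phi> (\<lambda>a. (nabla n (B e) ^^ j) s z $ a) = \<phi> (\<lambda>a. \<Sum>i\<le>j.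
        (of_nat (j choose i) * (dz ^^ (j - i)) f z * inverse e ^ i) * E i a e z)"
      by (intro \<phi>_cong) (simp add: nabla_section[OF z] mult_ac)
    then show ?thesis by (simp add: \<phi>_sum)
  qed
  have low: "\<phi> (\<lambda>a. (nabla n (B e) ^^ j) s z $ a) = 0" if "j < n - 1" for j
    unfolding \<phi>_s using that by (intro sum.neutral) (auto simp: \<phi>_E)
  have "\<phi> (\<lambda>a. (nabla n (B e) ^^ n) s z $ a) =
      \<phi> (\<lambda>a. \<Sum>k\<in>{2..n}. th k * (nabla n (B e) ^^ (n - k)) s z $ a)"
    by (intro \<phi>_cong) (simp add: th lin_comb_def)
  \<comment> \<open>This is where the missing term \<nabla>^(n-1) s of the normalisation is used: k
    \<ge> 2 gives n - k < n - 1, so \<open>low\<close> applies to every summand.\<close>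
  also have "\<dots> = 0"
    unfolding \<phi>_sum using n by (intro sum.neutral) (auto simp: low)
  finally have "0 = \<phi> (\<lambda>a. (nabla n (B e) ^^ n) s z $ a)" by simp
  \<comment> \<open>In the Leibniz expansion \<open>\<phi>\<close> annihilates all indices below n -
    1. Index n - 1 brings the first derivative of \<open>f\<close> with coefficient n, and index n
    brings \<open>P\<close>.\<close>
  also have "\<dots> = (\<Sum>i\<in>{n - 1, n}. of_nat (n choose i) * (dz ^^ (n - i)) f z * inverse e ^ i * \<phi> (\<lambda>a. E i a e z))"
    unfolding \<phi>_s using n by (intro sum.mono_neutral_right) (auto simp: \<phi>_E)
  also have "\<dots> = of_nat n * dz f z * inverse e ^ (n - 1) * Q e z + f z * inverse e ^ n * P e z"
  proof -
    have "n choose (n - 1) = n" using n by (metis One_nat_def Suc_leD binomial_symmetric choose_one diff_diff_cancel diff_le_self numeral_2_eq_2)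
    moreover have "n - (n - 1) = 1" "n - 1 \<noteq> n" using n by auto
    ultimately show ?thesis using n by (simp add: \<phi>_E) (simp add: \<phi>_def P_def)
  qed
  also have "inverse e ^ n = inverse e ^ (n - 1) * inverse e" using n by (cases n) auto
  finally have "inverse e ^ (n - 1) * (of_nat n * dz f z * Q e z + f z * P e z * inverse e) = 0"
    by (simp add: algebra_simps)
  then have "of_nat n * dz f z * Q e z + f z * P e z * inverse e = 0" using e by simp
  then show ?thesis using e by (simp add: field_simps add_eq_0_iff)
qed

end

text \<open>\<open>y m\<close> stands for \<partial>^m f / f at \<open>z0\<close>. After cancelling
  e, the equation for \<open>f\<close> has coefficients polynomial in e and no longer mentions s, so
  one family \<open>y\<close> serves every e and every admissible \<open>f\<close>; its denominators
  are powers of \<open>Q\<close>, nonzero at e = 0.\<close>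

lemma scalar_factor_iterates:
  obtains y where "y 0 = (\<lambda>e. 1)" "\<And>m. rational_fun_on {e. Q e z0 \<noteq> 0} (y m)"
    "\<And>m. isCont (y m) 0"
    "\<And>e V f s th m. e \<noteq> 0 \<Longrightarrow> open V \<Longrightarrow> V \<subseteq> U \<Longrightarrow> smooth_on V f \<Longrightarrow>
      (\<And>z. z \<in> V \<Longrightarrow> s z = f z \<cdot>\<^sub>v tau e z) \<Longrightarrow>
      (\<And>z. z \<in> V \<Longrightarrow> (nabla n (B e) ^^ n) s z =
        lin_comb n {2..n} (\<lambda>k. th k z) (\<lambda>k. (nabla n (B e) ^^ (n - k)) s z)) \<Longrightarrow>
      z0 \<in> V \<Longrightarrow> Q e z0 \<noteq> 0 \<Longrightarrow> (dz ^^ m) f z0 = f z0 * y m e"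
proof -
  obtain R where R: "polyfn U R" "\<And>e z. z \<in> U \<Longrightarrow> P e z = P 0 z + e * R e z"
    using polyfn_split[OF U polyfn_P] by blast
  obtain Y where Y: "\<And>m. polyfn U (Y m)" "Y 0 = (\<lambda>e z. 1)"
    "\<And>e V f m z. open V \<Longrightarrow> V \<subseteq> U \<Longrightarrow> smooth_on V f \<Longrightarrow>
      (\<And>z. z \<in> V \<Longrightarrow> of_nat n * dz f z * Q e z = - (f z * R e z)) \<Longrightarrow> z \<in> V \<Longrightarrow>
      (dz ^^ m) f z * Q e z ^ m = f z * Y m e z"
    using log_derivative_iterates[OF U polyfn_Q R(1), of n] n by auto
  show thesis
  proof (rule that[of "\<lambda>m e. Y m e z0 / Q e z0 ^ m"])
    show "(\<lambda>e. Y 0 e z0 / Q e z0 ^ 0) = (\<lambda>e. 1)" by (simp add: Y)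
    show "rational_fun_on {e. Q e z0 \<noteq> 0} (\<lambda>e. Y m e z0 / Q e z0 ^ m)" for m
      by (intro rational_fun_on_divide rational_fun_on_power rational_fun_on_polyfn[OF _ z0] Y polyfn_Q)
        auto
    show "isCont (\<lambda>e. Y m e z0 / Q e z0 ^ m) 0" for m
      using tendsto_divide[OF polyfn_tendsto[OF Y(1) z0]
          tendsto_power[OF polyfn_tendsto[OF polyfn_Q z0]]] Q_z0 by (auto simp: isCont_def)
  next
    fix e V f s th m
    assume e: "e \<noteq> 0" and V: "open V" "V \<subseteq> U" and f: "smooth_on V f"
      and s: "\<And>z. z \<in> V \<Longrightarrow> s z = f z \<cdot>\<^sub>v tau e z"
      and th: "\<And>z. z \<in> V \<Longrightarrow> (nabla n (B e) ^^ n) s z =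
        lin_comb n {2..n} (\<lambda>k. th k z) (\<lambda>k. (nabla n (B e) ^^ (n - k)) s z)"
      and zV: "z0 \<in> V" and Qe: "Q e z0 \<noteq> 0"
    have "(dz ^^ m) f z0 * Q e z0 ^ m = f z0 * Y m e z0"
    \<comment> \<open>The neighbourhood is cut down to \<open>W\<close>, since P = e R holds only
      where P vanishes at e = 0.\<close>
    proof (rule Y(3))
      show "open (V \<inter> W)" "V \<inter> W \<subseteq> U" "z0 \<in> V \<inter> W" using V W zV by auto
      show "smooth_on (V \<inter> W) f" using f by (rule smooth_on_subset) simp
      fix z assume z: "z \<in> V \<inter> W"
      have "of_nat n * dz f z * Q e z * e = - (f z * P e z)"
        using z by (intro scalar_factor_equation[OF e V f s _ th]) auto
      moreover have "P e z = e * R e z" using R(2)[of z e] P_0[of z] z W(3) by auto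
      ultimately have "e * (of_nat n * dz f z * Q e z) = e * - (f z * R e z)"
        by (simp add: mult_ac)
      then show "of_nat n * dz f z * Q e z = - (f z * R e z)"
        using e by (simp only: mult_cancel_left) simp
    qed
    then show "(dz ^^ m) f z0 = f z0 * (Y m e z0 / Q e z0 ^ m)"
      using Qe by (simp add: field_simps)
  qed
qed

end

section \<open>First-order terms in e\<close>

context nilpotent_pencil
begin

sublocale basis: cyclic_basis n "M z0" "\<lambda>j a. E j a 0 z0"
  by (rule cyclic_basis_W[OF W(2)])

definition E_slope :: "nat \<Rightarrow> nat \<Rightarrow> complex" where
  "E_slope j a = deriv (\<lambda>e. E j a e z0) 0"

lemma E_DERIV: "a < n \<Longrightarrow> ((\<lambda>e. E j a e z0) has_field_derivative E_slope j a) (at 0)"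
  unfolding E_slope_def DERIV_deriv_iff_field_differentiable
  by (rule polyfn_differentiable[OF polyfn_E z0])

text \<open>Differentiation of the recursion for \<open>E\<close> in e at 0: the matrix
  \<open>N\<close> carries e^2 and contributes from second order on, while \<partial> + A carries e
  and acts on the values at e = 0.\<close>

lemma E_slope_Suc:
  assumes "a < n"
  shows "E_slope (Suc j) a = (\<Sum>b<n. M z0 $$ (a,b) * E_slope j b) +
    (dz (E j a 0) z0 + (\<Sum>b<n. A z0 $$ (a,b) * E j b 0 z0))"
proof -
  \<comment> \<open>Existence of this derivative suffices: in the product rule it is multiplied by e
    = 0.\<close>
  obtain T where T: "((\<lambda>e. dz (E j a e) z0) has_field_derivative T) (at 0)"
    using polyfn_differentiable[OF polyfn_dz[OF U polyfn_E[OF assms, of j]] z0]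
    unfolding field_differentiable_def by blast
  have sum: "((\<lambda>e. \<Sum>b<n. X z0 $$ (a,b) * E j b e z0) has_field_derivative
      (\<Sum>b<n. X z0 $$ (a,b) * E_slope j b)) (at 0)" for X :: "complex \<Rightarrow> complex mat"
    by (intro DERIV_sum DERIV_cmult E_DERIV) simp
  have "((\<lambda>e. E (Suc j) a e z0) has_field_derivative (\<Sum>b<n. M z0 $$ (a,b) * E_slope j b) +
      (dz (E j a 0) z0 + (\<Sum>b<n. A z0 $$ (a,b) * E j b 0 z0))) (at 0)"
    unfolding E.simps by (rule derivative_eq_intros sum T refl | simp)+
  then show ?thesis using DERIV_unique E_DERIV[OF assms] by blast
qed

end

section \<open>The normalised frame as the parameter tends to zero\<close>

text \<open>Fixes as a parameter the family \<open>y\<close> that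
  \<open>scalar_factor_iterates\<close> provides existentially, so that definitions can be built on
  it.\<close>

locale nilpotent_pencil_factor = nilpotent_pencil +
  fixes y :: "nat \<Rightarrow> complex \<Rightarrow> complex"
  assumes y0: "y 0 = (\<lambda>e. 1)" and y_cont: "\<And>m. isCont (y m) 0"
    and y_rational: "\<And>m. rational_fun_on {e. Q e z0 \<noteq> 0} (y m)"
    and y_iterates: "\<And>e V f s th m. e \<noteq> 0 \<Longrightarrow> open V \<Longrightarrow> V \<subseteq> U \<Longrightarrow> smooth_on V f \<Longrightarrow>
      (\<And>z. z \<in> V \<Longrightarrow> s z = f z \<cdot>\<^sub>v tau e z) \<Longrightarrow>
      (\<And>z. z \<in> V \<Longrightarrow> (nabla n (B e) ^^ n) s z =
        lin_comb n {2..n} (\<lambda>k. th k z) (\<lambda>k. (nabla n (B e) ^^ (n - k)) s z)) \<Longrightarrow>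
      z0 \<in> V \<Longrightarrow> Q e z0 \<noteq> 0 \<Longrightarrow> (dz ^^ m) f z0 = f z0 * y m e"
begin

text \<open>
  \<open>G j\<close> is \<open>e^j \<nabla>^j s / f\<close> at \<open>z0\<close> for \<open>s = f tau\<close>, since \<open>y m = \<partial>^m f / f\<close>.
\<close>

definition G :: "nat \<Rightarrow> nat \<Rightarrow> complex \<Rightarrow> complex" where
  "G j a e = (\<Sum>i\<le>j. of_nat (j choose i) * e ^ (j - i) * y (j - i) e * E i a e z0)"

definition Gmat :: "complex \<Rightarrow> complex mat" where
  "Gmat e = mat n n (\<lambda>(a,j). G j a e)"

lemma Gmat_carrier: "Gmat e \<in> carrier_mat n n"
  by (simp add: Gmat_def)

lemma G_zero: "G 0 a e = E 0 a e z0"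
  by (simp add: G_def y0)

lemma G_at_0: "G j a 0 = E j a 0 z0"
proof -
  have "G j a 0 = (\<Sum>i\<le>j. if i = j then E i a 0 z0 else 0)"
    unfolding G_def by (intro sum.cong) (auto simp: y0)
  then show ?thesis by simp
qed

lemma isCont_E: "a < n \<Longrightarrow> isCont (\<lambda>e. E j a e z0) 0"
  using polyfn_tendsto[OF polyfn_E z0] by (simp add: isCont_def)

lemma isCont_Q: "isCont (\<lambda>e. Q e z0) 0"
  using polyfn_tendsto[OF polyfn_Q z0] by (simp add: isCont_def)

lemma isCont_G: "a < n \<Longrightarrow> isCont (G j a) 0"
  unfolding G_def by (intro continuous_intros y_cont isCont_E)

lemma rational_G: "a < n \<Longrightarrow> rational_fun_on {e. Q e z0 \<noteq> 0} (G j a)"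
  unfolding G_def
  by (intro rational_fun_on_sum rational_fun_on_mult rational_fun_on_const rational_fun_on_power
      rational_fun_on_id y_rational rational_fun_on_polyfn[OF polyfn_E z0])

lemma isCont_adj_Gmat:
  assumes "k < n" "a < n"
  shows "isCont (\<lambda>e. adj_mat (Gmat e) $$ (k,a)) 0"
  unfolding Gmat_def
  by (rule adj_mat_closed[where C = "\<lambda>f. isCont f 0"])
    (auto intro: continuous_intros isCont_G assms)

lemma rational_adj_Gmat:
  assumes "k < n" "a < n"
  shows "rational_fun_on {e. Q e z0 \<noteq> 0} (\<lambda>e. adj_mat (Gmat e) $$ (k,a))"
  unfolding Gmat_def
  by (rule adj_mat_closed[where C = "rational_fun_on {e. Q e z0 \<noteq> 0}"])
    (auto intro: rational_fun_on_const rational_fun_on_add rational_fun_on_mult rational_G assms)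

text \<open>\<open>Gmat\<close> is the matrix of the \<open>E j\<close> times a unipotent upper
  triangular matrix (\<open>y 0\<close> = 1). So passing from tau to the normalised section creates
  no new denominator in Cramer's rule.\<close>

lemma det_Gmat: "det (Gmat e) = Q e z0"
proof -
  define T where "T = mat n n (\<lambda>(i,j). if i \<le> j
    then of_nat (j choose i) * e ^ (j - i) * y (j - i) e else 0)"
  define F where "F = mat n n (\<lambda>(a,j). E j a e z0)"
  have T: "T \<in> carrier_mat n n" and F: "F \<in> carrier_mat n n" by (simp_all add: T_def F_def)
  have "Gmat e = F * T"
  proof (rule eq_matI)
    fix a j assume "a < dim_row (F * T)" "j < dim_col (F * T)"
    then have aj: "a < n" "j < n" using F T by auto
    have "(F * T) $$ (a,j) = (\<Sum>i<n. E i a e z0 * (if i \<le> j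
        then of_nat (j choose i) * e ^ (j - i) * y (j - i) e else 0))"
      using aj by (subst index_mult_mat_sum[OF F T]) (auto simp: F_def T_def)
    also have "\<dots> = (\<Sum>i\<le>j. E i a e z0 * (if i \<le> j
        then of_nat (j choose i) * e ^ (j - i) * y (j - i) e else 0))"
      using aj by (intro sum.mono_neutral_right) auto
    also have "\<dots> = G j a e"
      unfolding G_def by (intro sum.cong) auto
    finally show "Gmat e $$ (a,j) = (F * T) $$ (a,j)"
      using aj by (simp add: Gmat_def)
  qed (use F T in \<open>auto simp: Gmat_def\<close>)
  moreover have "det T = 1"
  proof -
    have "det T = prod_list (diag_mat T)"
      by (rule det_upper_triangular[OF _ T]) (auto simp: T_def upper_triangular_def)
    also have "diag_mat T = replicate n 1"
      by (rule nth_equalityI) (auto simp: diag_mat_def T_def y0)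
    finally show ?thesis by simp
  qed
  ultimately show ?thesis using det_mult[OF F T] by (simp add: Q_def F_def)
qed

text \<open>Cramer's rule with the denominator cleared. The map \<open>\<pi>\<close> accommodates
  the two numberings of the frame: n - i for the coordinates of \<nabla>^n s and i - 1 for those of
  the (0,1)-derivative.\<close>

lemma adj_Gmat_solve:
  fixes I :: "nat set"
  assumes v: "\<And>a. a < n \<Longrightarrow> v a = (\<Sum>i\<in>I. c i * G (\<pi> i) a e)"
    and \<pi>: "finite I" "inj_on \<pi> I" "\<pi> ` I \<subseteq> {..<n}" and k: "k \<in> I"
  shows "(\<Sum>a<n. adj_mat (Gmat e) $$ (\<pi> k,a) * v a) = c k * Q e z0"
proof -
  have "(\<Sum>a<n. adj_mat (Gmat e) $$ (\<pi> k,a) * v a) =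
      (\<Sum>a<n. \<Sum>i\<in>I. c i * (adj_mat (Gmat e) $$ (\<pi> k,a) * G (\<pi> i) a e))"
    by (simp add: v sum_distrib_left mult_ac)
  also have "\<dots> = (\<Sum>i\<in>I. c i * (\<Sum>a<n. adj_mat (Gmat e) $$ (\<pi> k,a) * G (\<pi> i) a e))"
    by (subst sum.swap) (simp add: sum_distrib_left)
  also have "\<dots> = (\<Sum>i\<in>I. if i = k then c i * Q e z0 else 0)"
  proof (rule sum.cong[OF refl])
    fix i assume i: "i \<in> I"
    then have "\<pi> i < n" "\<pi> k < n" "\<pi> i = \<pi> k \<longleftrightarrow> i = k" using \<pi> k by (auto dest: inj_onD)
    then show "c i * (\<Sum>a<n. adj_mat (Gmat e) $$ (\<pi> k,a) * G (\<pi> i) a e) =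
        (if i = k then c i * Q e z0 else 0)"
      using adj_mat_row[of "Gmat e" n "\<pi> k" "\<pi> i", OF Gmat_carrier] det_Gmat[of e] by (auto simp: Gmat_def)
  qed
  also have "\<dots> = c k * Q e z0" using \<pi>(1) k by simp
  finally show ?thesis .
qed

text \<open>All derivatives of \<open>f\<close> in \<open>G\<close> come with positive powers of e,
  so \<open>Gmat\<close> tends to the cyclic basis of \<open>M z0\<close> and Cramer's expression
  tends to \<open>basis.coord\<close>.\<close>

lemma coord_limit:
  assumes k: "k < n" and v: "\<And>a. a < n \<Longrightarrow> (v a \<longlongrightarrow> w a) (at 0)"
  shows "((\<lambda>e. (\<Sum>a<n. adj_mat (Gmat e) $$ (k,a) * v a e) / Q e z0) \<longlongrightarrow> basis.coord k w) (at 0)"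
proof -
  have "((\<lambda>e. (\<Sum>a<n. adj_mat (Gmat e) $$ (k,a) * v a e) / Q e z0) \<longlongrightarrow>
      (\<Sum>a<n. adj_mat (Gmat 0) $$ (k,a) * w a) / Q 0 z0) (at 0)"
    using isCont_adj_Gmat[OF k] isCont_Q Q_z0
    by (intro tendsto_divide tendsto_sum tendsto_mult v) (auto simp: isCont_def)
  then show ?thesis by (simp add: basis.coord_def Gmat_def G_at_0 Q_def)
qed

text \<open>\<open>E n\<close> vanishes at e = 0, so G n / e has a limit. It is the sum of the slope
  of \<open>E n\<close> and of the Leibniz term with a single derivative of \<open>f\<close>; all
  further terms keep a power of e.\<close>

lemma G_n_slope:
  assumes a: "a < n"
  shows "((\<lambda>e. G n a e / e) \<longlongrightarrow> of_nat n * y 1 0 * E (n - 1) a 0 z0 + E_slope n a) (at 0)"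
proof -
  let ?L = "\<lambda>e. \<Sum>i<n. of_nat (n choose i) * e ^ (n - i - 1) * y (n - i) e * E i a e z0"
  have "((\<lambda>e. ?L e + E n a e z0 / e) \<longlongrightarrow> ?L 0 + E_slope n a) (at 0)"
  proof (rule tendsto_add)
    have "isCont ?L 0" by (intro continuous_intros y_cont isCont_E a)
    then show "(?L \<longlongrightarrow> ?L 0) (at 0)" by (simp add: isCont_def)
    show "((\<lambda>e. E n a e z0 / e) \<longlongrightarrow> E_slope n a) (at 0)"
      using E_DERIV[OF a, of n] basis.x_n_zero[OF a] by (simp add: DERIV_def)
  qed
  moreover have "?L 0 = of_nat n * y 1 0 * E (n - 1) a 0 z0"
  proof -
    have "?L 0 = (\<Sum>i\<in>{n - 1}. of_nat (n choose i) * 0 ^ (n - i - 1) * y (n - i) 0 * E i a 0 z0)"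
      using n by (intro sum.mono_neutral_right) auto
    moreover have "n choose (n - 1) = n" using n
      by (metis One_nat_def Suc_leD binomial_symmetric choose_one diff_diff_cancel diff_le_self numeral_2_eq_2)
    moreover have "n - (n - 1) = 1" using n by simp
    ultimately show ?thesis by simp
  qed
  moreover have "eventually (\<lambda>e. ?L e + E n a e z0 / e = G n a e / e) (at 0)"
  proof -
    have "?L e + E n a e z0 / e = G n a e / e" if "e \<noteq> 0" for e
    proof -
      have "G n a e = (\<Sum>i<n. of_nat (n choose i) * e ^ (n - i) * y (n - i) e * E i a e z0) + E n a e z0"
        unfolding G_def by (simp add: lessThan_Suc_atMost[symmetric] y0)
      also have "(\<Sum>i<n. of_nat (n choose i) * e ^ (n - i) * y (n - i) e * E i a e z0) = e * ?L e"
        unfolding sum_distrib_left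
      proof (rule sum.cong[OF refl])
        fix i assume "i \<in> {..<n}"
        then have "e ^ (n - i) = e * e ^ (n - i - 1)" by (metis Suc_diff_1 lessThan_iff power_Suc zero_less_diff)
        then show "of_nat (n choose i) * e ^ (n - i) * y (n - i) e * E i a e z0 =
            e * (of_nat (n choose i) * e ^ (n - i - 1) * y (n - i) e * E i a e z0)" by simp
      qed
      finally show ?thesis using that by (simp add: add_divide_distrib)
    qed
    then show ?thesis by (simp add: eventually_at_filter)
  qed
  ultimately show ?thesis by (simp add: Lim_transform_eventually)
qed

end

section \<open>Cramer's formulas at one parameter value\<close>

context nilpotent_pencil_factor
begin

context
  fixes e :: complex and V :: "complex set" and f :: "complex \<Rightarrow> complex"
    and s :: "complex \<Rightarrow> complex vec" and th :: "nat \<Rightarrow> complex \<Rightarrow> complex"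
  assumes e: "e \<noteq> 0" and V: "open V" "V \<subseteq> U" "z0 \<in> V" and f: "smooth_on V f"
    and s: "\<And>z. z \<in> V \<Longrightarrow> s z = f z \<cdot>\<^sub>v tau e z" and fz: "f z0 \<noteq> 0"
    and th: "\<And>z. z \<in> V \<Longrightarrow> (nabla n (B e) ^^ n) s z =
        lin_comb n {2..n} (\<lambda>k. th k z) (\<lambda>k. (nabla n (B e) ^^ (n - k)) s z)"
    and Qe: "Q e z0 \<noteq> 0"
begin

lemma nabla_section_G:
  assumes "a < n"
  shows "(nabla n (B e) ^^ j) s z0 $ a = f z0 * inverse e ^ j * G j a e"
proof -
  have inv: "inverse e ^ i = inverse e ^ j * e ^ (j - i)" if "i \<le> j" for i
    using that e by (simp add: power_diff field_simps)
  have "of_nat (j choose i) * (dz ^^ (j - i)) f z0 * (inverse e ^ i * E i a e z0) =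
      f z0 * inverse e ^ j * (of_nat (j choose i) * e ^ (j - i) * y (j - i) e * E i a e z0)"
    if "i \<le> j" for i
    using y_iterates[where m = "j - i" and s = s and th = th, OF e V(1,2) f s th V(3) Qe] inv[OF that] by simp
  then have "(\<Sum>i\<le>j. of_nat (j choose i) * (dz ^^ (j - i)) f z0 * (inverse e ^ i * E i a e z0)) =
      f z0 * inverse e ^ j * G j a e"
    unfolding G_def sum_distrib_left by (intro sum.cong) auto
  then show ?thesis
    using nabla_section[where s = s and j = j, OF e V(1,2) f s V(3) assms] by simp
qed

text \<open>Comparing \<nabla>^n s = f e^(-n) G n with \<nabla>^(n-i) s = f e^(-(n-i)) G (n-i)
  cancels \<open>f\<close> and attaches e^i to the coefficient \<open>th i\<close>.\<close>

lemma th_eq: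
  assumes k: "k \<in> {2..n}"
  shows "th k z0 = inverse e ^ k * ((\<Sum>a<n. adj_mat (Gmat e) $$ (n - k,a) * G n a e) / Q e z0)"
proof -
  have "G n a e = (\<Sum>i\<in>{2..n}. (th i z0 * e ^ i) * G (n - i) a e)" if a: "a < n" for a
  proof -
    have "f z0 * inverse e ^ n * G n a e = (\<Sum>i\<in>{2..n}. th i z0 * (f z0 * inverse e ^ (n - i) * G (n - i) a e))"
      unfolding nabla_section_G[OF a, symmetric] th[OF V(3)] using a by (simp add: lin_comb_def)
    also have "\<dots> = f z0 * inverse e ^ n * (\<Sum>i\<in>{2..n}. (th i z0 * e ^ i) * G (n - i) a e)"
      unfolding sum_distrib_left using e by (intro sum.cong) (auto simp: power_diff field_simps)
    finally show ?thesis using e fz by simp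
  qed
  then have "(\<Sum>a<n. adj_mat (Gmat e) $$ (n - k,a) * G n a e) = (th k z0 * e ^ k) * Q e z0"
    by (rule adj_Gmat_solve[where \<pi> = "\<lambda>i. n - i"]) (use k n in \<open>auto simp: inj_on_def\<close>)
  then show ?thesis using e Qe by (simp add: field_simps)
qed

text \<open>Dividing e times the (0,1)-derivative of s by \<open>f\<close> gives that of tau plus a
  multiple of tau = \<open>G 0\<close>. The extra term only affects i = 1, so for k \<ge> 2 the
  factor drops out, although the normalisation does not control its (0,1)-derivative.\<close>

lemma muh_eq:
  fixes muh :: "nat \<Rightarrow> complex" and R1 A2 R2 :: "complex \<Rightarrow> complex mat"
  assumes k: "k \<in> {2..n}"
    and R: "R1 z0 \<in> carrier_mat n n" "A2 z0 \<in> carrier_mat n n" "R2 z0 \<in> carrier_mat n n"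
    and muh: "nabla_bar n (conn_form R2 A2 R1 e) s z0 =
      lin_comb n {1..n} muh (\<lambda>k. (nabla n (B e) ^^ (k - 1)) s z0)"
  shows "muh k = e ^ (k - 2) * ((\<Sum>a<n. adj_mat (Gmat e) $$ (k - 1,a) *
    ((\<Sum>b<n. R1 z0 $$ (a,b) * E 0 b e z0)
     + e * (dzbar (E 0 a e) z0 + (\<Sum>b<n. A2 z0 $$ (a,b) * E 0 b e z0))
     + e ^ 2 * (\<Sum>b<n. R2 z0 $$ (a,b) * E 0 b e z0))) / Q e z0)"
proof -
  let ?H = "\<lambda>a. (\<Sum>b<n. R1 z0 $$ (a,b) * E 0 b e z0)
     + e * (dzbar (E 0 a e) z0 + (\<Sum>b<n. A2 z0 $$ (a,b) * E 0 b e z0))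
     + e ^ 2 * (\<Sum>b<n. R2 z0 $$ (a,b) * E 0 b e z0)"
  \<comment> \<open>The correction at i = 1 absorbs the (0,1)-derivative of \<open>f\<close>; for i
    \<ge> 2 the power of e is e^(2-i).\<close>
  let ?c = "\<lambda>i. e * inverse e ^ (i - 1) * muh i - (if i = 1 then e * dzbar f z0 / f z0 else 0)"
  have sc: "s z $ a = f z * E 0 a e z" if "z \<in> V" "a < n" for z a
    using s[OF that(1)] that(2) by (simp add: tau_def lin_comb_def)
  have "?H a = (\<Sum>i\<in>{1..n}. ?c i * G (i - 1) a e)" if a: "a < n" for a
  proof -
    have "dzbar (\<lambda>w. s w $ a) z0 = dzbar (\<lambda>w. f w * E 0 a e w) z0"
      using sc a by (intro dzbar_cong[OF V(1,3)])
    also have "\<dots> = dzbar f z0 * E 0 a e z0 + f z0 * dzbar (E 0 a e) z0"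
      by (rule dzbar_mult[OF f smooth_on_subset[OF polyfn_smooth[OF U polyfn_E[OF a]] V(2)] V(3)])
    finally have 1: "dzbar (\<lambda>w. s w $ a) z0 = \<dots>" .
    have 2: "(\<Sum>b<n. conn_form R2 A2 R1 e z0 $$ (a,b) * s z0 $ b) =
        f z0 * (e * (\<Sum>b<n. R2 z0 $$ (a,b) * E 0 b e z0) + (\<Sum>b<n. A2 z0 $$ (a,b) * E 0 b e z0) +
        inverse e * (\<Sum>b<n. R1 z0 $$ (a,b) * E 0 b e z0))"
      unfolding sum_distrib_left sum.distrib[symmetric]
    proof (rule sum.cong[OF refl])
      fix b assume b: "b \<in> {..<n}"
      then show "conn_form R2 A2 R1 e z0 $$ (a,b) * s z0 $ b = f z0 * (e * (R2 z0 $$ (a,b) * E 0 b e z0) +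
          A2 z0 $$ (a,b) * E 0 b e z0 + inverse e * (R1 z0 $$ (a,b) * E 0 b e z0))"
        using conn_form_index[of R2 z0 n A2 R1 a b e, OF R(3,2,1) a] sc[OF V(3), of b] by (simp add: algebra_simps)
    qed
    have c: "conn_form R2 A2 R1 e z0 \<in> carrier_mat n n" using R by (simp add: conn_form_def)
    have sv: "s z0 \<in> carrier_vec n" using s[OF V(3)] by (simp add: tau_def lin_comb_def)
    have "nabla_bar n (conn_form R2 A2 R1 e) s z0 $ a =
        dzbar f z0 * E 0 a e z0 + f z0 * inverse e * ?H a"
      unfolding nabla_bar_index[of "conn_form R2 A2 R1 e" z0 n s, OF c sv a] 1 2
      using e by (simp add: field_simps power2_eq_square)
    moreover have "nabla_bar n (conn_form R2 A2 R1 e) s z0 $ a =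
        (\<Sum>i\<in>{1..n}. muh i * (f z0 * inverse e ^ (i - 1) * G (i - 1) a e))"
      unfolding muh using a nabla_section_G[OF a] by (simp add: lin_comb_def)
    ultimately have "f z0 * ?H a = e * (\<Sum>i\<in>{1..n}. muh i * (f z0 * inverse e ^ (i - 1) * G (i - 1) a e))
        - e * dzbar f z0 * E 0 a e z0"
      using e by (simp add: field_simps)
    also have "E 0 a e z0 = G 0 a e" by (simp add: G_zero)
    also have "e * (\<Sum>i\<in>{1..n}. muh i * (f z0 * inverse e ^ (i - 1) * G (i - 1) a e))
        - e * dzbar f z0 * G 0 a e =
        f z0 * ((\<Sum>i\<in>{1..n}. (e * inverse e ^ (i - 1) * muh i) * G (i - 1) a e)
          - (\<Sum>i\<in>{1..n}. if i = 1 then (e * dzbar f z0 / f z0) * G (i - 1) a e else 0))"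
      using n fz by (simp add: sum_distrib_left right_diff_distrib mult_ac)
    also have "(\<Sum>i\<in>{1..n}. (e * inverse e ^ (i - 1) * muh i) * G (i - 1) a e)
          - (\<Sum>i\<in>{1..n}. if i = 1 then (e * dzbar f z0 / f z0) * G (i - 1) a e else 0) =
        (\<Sum>i\<in>{1..n}. ?c i * G (i - 1) a e)"
      unfolding sum_subtractf[symmetric] by (intro sum.cong) (auto simp: left_diff_distrib)
    finally show ?thesis using fz by (simp only: mult_cancel_left) simp
  qed
  then have "(\<Sum>a<n. adj_mat (Gmat e) $$ (k - 1,a) * ?H a) = ?c k * Q e z0"
    by (rule adj_Gmat_solve[where \<pi> = "\<lambda>i. i - 1"]) (use k in \<open>auto simp: inj_on_def\<close>)
  moreover have "?c k = inverse e ^ (k - 2) * muh k"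
  proof -
    obtain i where "k = i + 2" using k by (metis atLeastAtMost_iff le_add_diff_inverse2)
    then show ?thesis using e by simp
  qed
  ultimately have *: "(\<Sum>a<n. adj_mat (Gmat e) $$ (k - 1,a) * ?H a) = inverse e ^ (k - 2) * muh k * Q e z0"
    by (simp only:)
  show ?thesis unfolding * using e Qe by (simp add: field_simps)
qed

end

section \<open>The coordinates as functions of the parameter\<close>

context
  fixes s :: "complex \<Rightarrow> complex \<Rightarrow> complex vec" and th muh :: "nat \<Rightarrow> complex \<Rightarrow> complex \<Rightarrow> complex"
    and R1 A2 R2 :: "complex \<Rightarrow> complex mat" and \<nu> :: "nat \<Rightarrow> complex" and S :: "complex set"
  assumes R: "R1 z0 \<in> carrier_mat n n" "A2 z0 \<in> carrier_mat n n" "R2 z0 \<in> carrier_mat n n"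
    and R1: "R1 z0 = beltrami_mat n \<nu> (M z0)"
    and s: "\<And>e. e \<noteq> 0 \<Longrightarrow> \<exists>V f. open V \<and> z0 \<in> V \<and> V \<subseteq> U \<and> smooth_on V f \<and>
      (\<forall>z\<in>V. f z \<noteq> 0 \<and> s e z = f z \<cdot>\<^sub>v tau e z)"
    and S: "S = {e. e \<noteq> 0 \<and> invertible_mat (frame n (B e) (s e) z0)}"
    and coordinates: "\<And>e. e \<in> S \<Longrightarrow> coordinates_near n U z0 (B e) (conn_form R2 A2 R1 e) (s e)
      (\<lambda>k. th k e) (\<lambda>k. muh k e)"
begin

text \<open>The components at \<open>z0\<close> of e times the (0,1)-derivative of tau. The
  derivative is expanded over the coefficients of tau because \<open>polyfn\<close> has no closure
  rule for \<open>dzbar\<close>; in this form the dependence on e is visibly polynomial.\<close>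

definition H :: "nat \<Rightarrow> complex \<Rightarrow> complex" where
  "H a e = (\<Sum>b<n. R1 z0 $$ (a,b) * E 0 b e z0)
     + e * ((\<Sum>j\<le>d. e ^ j * dzbar (\<lambda>z. \<sigma> j z $ a) z0) + (\<Sum>b<n. A2 z0 $$ (a,b) * E 0 b e z0))
     + e ^ 2 * (\<Sum>b<n. R2 z0 $$ (a,b) * E 0 b e z0)"

lemma S_iff: "e \<in> S \<longleftrightarrow> e \<noteq> 0 \<and> Q e z0 \<noteq> 0"
proof (cases "e = 0")
  case False
  then obtain V f where V: "open V" "z0 \<in> V" "V \<subseteq> U" "smooth_on V f"
    "\<And>z. z \<in> V \<Longrightarrow> f z \<noteq> 0" "\<And>z. z \<in> V \<Longrightarrow> s e z = f z \<cdot>\<^sub>v tau e z"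
    using s[OF False] by metis
  then show ?thesis
    using invertible_frame_iff[where s = "s e" and f = f, OF False V(1,3,4,6,2)] V(2,5)
    by (simp add: S False)
qed (simp add: S)

text \<open>The coordinates are prescribed only for parameters in \<open>S\<close>; their limits at
  0 make sense because \<open>Q\<close> is nonzero at e = 0, so that \<open>S\<close> contains a
  punctured neighbourhood of 0.\<close>

lemma eventually_S: "eventually (\<lambda>e. e \<in> S) (at 0)"
proof -
  have "eventually (\<lambda>e. Q e z0 \<noteq> 0) (at 0)"
    using isCont_Q Q_z0 tendsto_imp_eventually_ne unfolding isCont_def by blast
  moreover have "eventually (\<lambda>e::complex. e \<noteq> 0) (at 0)" by (simp add: eventually_at_filter)
  ultimately show ?thesis by eventually_elim (simp add: S_iff)
qed

lemma S_coordinates: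
  assumes e: "e \<in> S" and k: "k \<in> {2..n}"
  shows "th k e z0 = inverse e ^ k * ((\<Sum>a<n. adj_mat (Gmat e) $$ (n - k,a) * G n a e) / Q e z0)"
    and "muh k e z0 = e ^ (k - 2) * ((\<Sum>a<n. adj_mat (Gmat e) $$ (k - 1,a) * H a e) / Q e z0)"
proof -
  have e': "e \<noteq> 0" "Q e z0 \<noteq> 0" using e S_iff by auto
  obtain V f where V: "open V" "z0 \<in> V" "V \<subseteq> U" "smooth_on V f"
    "\<And>z. z \<in> V \<Longrightarrow> f z \<noteq> 0" "\<And>z. z \<in> V \<Longrightarrow> s e z = f z \<cdot>\<^sub>v tau e z"
    using s[OF e'(1)] by metis
  obtain V' where V': "open V'" "z0 \<in> V'" "V' \<subseteq> U"
    "\<And>z. z \<in> V' \<Longrightarrow> (nabla n (B e) ^^ n) (s e) z =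
       lin_comb n {2..n} (\<lambda>k. th k e z) (\<lambda>k. (nabla n (B e) ^^ (n - k)) (s e) z)"
    "\<And>z. z \<in> V' \<Longrightarrow> nabla_bar n (conn_form R2 A2 R1 e) (s e) z =
       lin_comb n {1..n} (\<lambda>k. muh k e z) (\<lambda>k. (nabla n (B e) ^^ (k - 1)) (s e) z)"
    using coordinates[OF e] unfolding coordinates_near_def by metis
  have X: "open (V \<inter> V')" "V \<inter> V' \<subseteq> U" "z0 \<in> V \<inter> V'" "smooth_on (V \<inter> V') f"
    using V V' by (auto intro: smooth_on_subset)
  show "th k e z0 = inverse e ^ k * ((\<Sum>a<n. adj_mat (Gmat e) $$ (n - k,a) * G n a e) / Q e z0)"
    using th_eq[OF e'(1) X V(6) _ V'(4) e'(2) k] V(2,5) by simp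
  have "dzbar (E 0 a e) z0 = (\<Sum>j\<le>d. e ^ j * dzbar (\<lambda>z. \<sigma> j z $ a) z0)" if "a < n" for a
  proof -
    have "dzbar (E 0 a e) z0 = (\<Sum>j\<le>d. dzbar (\<lambda>z. e ^ j * \<sigma> j z $ a) z0)"
      unfolding E.simps using \<sigma> that
      by (intro dzbar_sum[OF U _ z0] smooth_on_mult[OF U] smooth_on_const smooth_vecD) auto
    also have "\<dots> = (\<Sum>j\<le>d. e ^ j * dzbar (\<lambda>z. \<sigma> j z $ a) z0)"
      using \<sigma> that by (intro sum.cong dzbar_cmult[OF _ z0] smooth_vecD) auto
    finally show ?thesis .
  qed
  then show "muh k e z0 = e ^ (k - 2) * ((\<Sum>a<n. adj_mat (Gmat e) $$ (k - 1,a) * H a e) / Q e z0)"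
    using muh_eq[OF e'(1) X V(6) _ V'(4) e'(2) k R V'(5)] V(2,5) V'(2) by (simp add: H_def)
qed

lemma rational_th:
  assumes k: "k \<in> {2..n}"
  shows "rational_fun_on S (\<lambda>e. th k e z0)"
proof -
  have sub: "rational_fun_on S f" if "rational_fun_on {e. Q e z0 \<noteq> 0} f" for f
    using that S_iff unfolding rational_fun_on_def by blast
  have "rational_fun_on S (\<lambda>e. inverse e ^ k * ((\<Sum>a<n. adj_mat (Gmat e) $$ (n - k,a) * G n a e) / Q e z0))"
    using k S_iff
    by (intro rational_fun_on_mult rational_fun_on_power rational_fun_on_inverse rational_fun_on_id
        rational_fun_on_divide rational_fun_on_sum rational_fun_on_polyfn[OF polyfn_Q z0]
        sub[OF rational_adj_Gmat] sub[OF rational_G]) auto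
  then show ?thesis by (rule rational_fun_on_cong) (simp add: S_coordinates(1)[OF _ k])
qed

lemma rational_muh:
  assumes k: "k \<in> {2..n}"
  shows "rational_fun_on S (\<lambda>e. muh k e z0)"
proof -
  have sub: "rational_fun_on S f" if "rational_fun_on {e. Q e z0 \<noteq> 0} f" for f
    using that S_iff unfolding rational_fun_on_def by blast
  have "rational_fun_on S (H a)" if "a < n" for a
    unfolding H_def
    by (intro rational_fun_on_add rational_fun_on_sum rational_fun_on_mult rational_fun_on_const
        rational_fun_on_power rational_fun_on_id rational_fun_on_polyfn[OF polyfn_E z0]) auto
  then have "rational_fun_on S (\<lambda>e. e ^ (k - 2) * ((\<Sum>a<n. adj_mat (Gmat e) $$ (k - 1,a) * H a e) / Q e z0))"
    using k S_iff
    by (intro rational_fun_on_mult rational_fun_on_power rational_fun_on_id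
        rational_fun_on_divide rational_fun_on_sum rational_fun_on_polyfn[OF polyfn_Q z0]
        sub[OF rational_adj_Gmat]) auto
  then show ?thesis by (rule rational_fun_on_cong) (simp add: S_coordinates(2)[OF _ k])
qed

text \<open>The numerator in Cramer's formula vanishes to first order, which turns e^(-k) into
  e^(1-k). In the slope, the contribution of \<open>f\<close> is a multiple of the basis vector n -
  1, which has no coordinate at n - k since k \<ge> 2.\<close>

lemma lowest_term_th:
  assumes k: "k \<in> {2..n}"
  shows "lowest_term (\<lambda>e. th k e z0) (basis.coord (n - k) (E_slope n)) (1 - int k)"
proof -
  have "((\<lambda>e. (\<Sum>a<n. adj_mat (Gmat e) $$ (n - k,a) * (G n a e / e)) / Q e z0) \<longlongrightarrow>
      basis.coord (n - k) (\<lambda>a. of_nat n * y 1 0 * E (n - 1) a 0 z0 + E_slope n a)) (at 0)"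
    using k n by (intro coord_limit G_n_slope) auto
  also have "basis.coord (n - k) (\<lambda>a. of_nat n * y 1 0 * E (n - 1) a 0 z0 + E_slope n a) =
      basis.coord (n - k) (E_slope n)"
    using k n by (auto simp: basis.coord_add basis.coord_cmult basis.coord_basis)
  finally show ?thesis
    unfolding lowest_term_def
  proof (rule Lim_transform_eventually)
    show "eventually (\<lambda>e. (\<Sum>a<n. adj_mat (Gmat e) $$ (n - k,a) * (G n a e / e)) / Q e z0 =
        th k e z0 / e powi (1 - int k)) (at 0)"
      using eventually_S
    proof eventually_elim
      case (elim e)
      then have e: "e \<noteq> 0" using S_iff by simp
      obtain i where i: "k = Suc i" using k by (cases k) auto
      define X where "X = (\<Sum>a<n. adj_mat (Gmat e) $$ (n - k,a) * G n a e)"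
      have "e powi (1 - int k) = inverse e ^ i"
        by (simp add: i power_int_minus power_inverse)
      moreover have "(\<Sum>a<n. adj_mat (Gmat e) $$ (n - k,a) * (G n a e / e)) = inverse e * X"
        by (simp add: X_def sum_distrib_left divide_inverse mult_ac)
      moreover have "th k e z0 = inverse e ^ Suc i * (X / Q e z0)"
        using S_coordinates(1)[OF elim k] by (simp add: X_def i)
      ultimately show ?case using e by simp
    qed
  qed
qed

text \<open>At e = 0 only the polynomial \<open>R1\<close> in \<open>M\<close> survives: applied to
  \<sigma> 0 it gives the sum of the \<nu> i M^(i-1) (\<sigma> 0), whose coordinates in the cyclic
  basis are the \<nu> i themselves.\<close>

lemma lowest_term_muh:
  assumes k: "k \<in> {2..n}"
  shows "lowest_term (\<lambda>e. muh k e z0) (\<nu> k) (int k - 2)"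
proof -
  have "((\<lambda>e. (\<Sum>a<n. adj_mat (Gmat e) $$ (k - 1,a) * H a e) / Q e z0) \<longlongrightarrow>
      basis.coord (k - 1) (\<lambda>a. H a 0)) (at 0)"
  proof (rule coord_limit)
    fix a assume "a < n"
    have "isCont (H a) 0" unfolding H_def by (intro continuous_intros isCont_E) auto
    then show "(H a \<longlongrightarrow> H a 0) (at 0)" by (simp add: isCont_def)
  qed (use k in auto)
  also have "basis.coord (k - 1) (\<lambda>a. H a 0) = basis.coord (k - 1) (\<lambda>a. \<Sum>i\<in>{2..n}. \<nu> i * E (i - 1) a 0 z0)"
  proof (rule basis.coord_cong)
    fix a assume a: "a < n"
    have "H a 0 = (\<Sum>b<n. (\<Sum>i\<in>{2..n}. \<nu> i * (M z0 ^\<^sub>m (i - 1)) $$ (a,b)) * E 0 b 0 z0)"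
      using a unfolding H_def R1 by (simp add: beltrami_mat_def)
    also have "\<dots> = (\<Sum>i\<in>{2..n}. \<nu> i * (\<Sum>b<n. (M z0 ^\<^sub>m (i - 1)) $$ (a,b) * E 0 b 0 z0))"
      unfolding sum_distrib_right sum_distrib_left by (subst sum.swap) (simp add: mult_ac)
    also have "\<dots> = (\<Sum>i\<in>{2..n}. \<nu> i * E (i - 1) a 0 z0)"
      using basis.pow_mult_x[OF a, of _ 0] by simp
    finally show "H a 0 = \<dots>" .
  qed
  also have "\<dots> = (\<Sum>i\<in>{2..n}. if i = k then \<nu> i else 0)"
    unfolding basis.coord_sum basis.coord_cmult
    using k by (intro sum.cong) (auto simp: basis.coord_basis split: if_splits)
  also have "\<dots> = \<nu> k" using k by simp
  finally show ?thesis
    unfolding lowest_term_def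
  proof (rule Lim_transform_eventually)
    show "eventually (\<lambda>e. (\<Sum>a<n. adj_mat (Gmat e) $$ (k - 1,a) * H a e) / Q e z0 =
        muh k e z0 / e powi (int k - 2)) (at 0)"
      using eventually_S
    proof eventually_elim
      case (elim e)
      then have e: "e \<noteq> 0" using S_iff by simp
      have "int k - 2 = int (k - 2)" using k by auto
      then have "e powi (int k - 2) = e ^ (k - 2)" by (simp only: power_int_of_nat)
      then show ?case using e by (simp add: S_coordinates(2)[OF elim k])
    qed
  qed
qed

end

end

section \<open>Gauges in which the nilpotent matrix is constant\<close>

lemma mat_trace_sum: "X \<in> carrier_mat n n \<Longrightarrow> mat_trace X = (\<Sum>i<n. X $$ (i,i))"
  by (auto simp: mat_trace_def diag_mat_def sum_list_sum_nth atLeast0LessThan)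

lemma mat_trace_comm:
  assumes "X \<in> carrier_mat n n" "Y \<in> carrier_mat n n"
  shows "mat_trace (X * Y) = mat_trace (Y * X)"
proof -
  have "mat_trace (X * Y) = (\<Sum>i<n. \<Sum>j<n. X $$ (i,j) * Y $$ (j,i))"
    using assms by (subst mat_trace_sum[of _ n]) (auto simp: index_mult_mat_sum[of _ n] simp del: index_mult_mat(1))
  also have "\<dots> = (\<Sum>j<n. \<Sum>i<n. Y $$ (j,i) * X $$ (i,j))"
    by (subst sum.swap) (simp add: mult.commute)
  also have "\<dots> = mat_trace (Y * X)"
    using assms by (subst mat_trace_sum[of _ n]) (auto simp: index_mult_mat_sum[of _ n] simp del: index_mult_mat(1))
  finally show ?thesis .
qed

text \<open>h A g + h \<partial>g = h (A + (\<partial>g) h) g, so the transformed connection and the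
  transformed nilpotent are conjugated by the same \<open>g\<close>. The gauge then enters the trace
  only through (\<partial>g) h.\<close>

lemma trace_coord_eq:
  assumes M: "M z \<in> carrier_mat n n" and A: "A z \<in> carrier_mat n n"
    and g: "g z \<in> carrier_mat n n" and h: "h z \<in> carrier_mat n n"
    and gh: "g z * h z = 1\<^sub>m n" "h z * g z = 1\<^sub>m n"
  shows "trace_coord n g h A M k z =
    mat_trace ((A z + mat_deriv dz n g z * h z) * M z ^\<^sub>m (k - 1))"
proof -
  let ?d = "mat_deriv dz n g z" and ?P = "M z ^\<^sub>m (k - 1)"
  let ?C = "A z + ?d * h z"
  have d: "?d \<in> carrier_mat n n" by (simp add: mat_deriv_def)
  have C: "?C \<in> carrier_mat n n" and P: "?P \<in> carrier_mat n n" using A d h M by auto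
  note assoc = assoc_mult_mat[of _ n n _ n _ n]
  have "similar_mat_wit (gauge_endo g h M z) (M z) (h z) (g z)"
    using M g h gh by (intro similar_mat_witI[of _ _ n]) (auto simp: gauge_endo_def)
  then have pow: "gauge_endo g h M z ^\<^sub>m (k - 1) = h z * ?P * g z"
    by (rule similar_mat_wit_pow_id)
  have "?C * g z = A z * g z + ?d * h z * g z"
    using A d g h by (intro add_mult_distrib_mat[of _ n n]) auto
  also have "?d * h z * g z = ?d" using d g h gh by (simp add: assoc)
  finally have "h z * (?C * g z) = h z * (A z * g z) + h z * ?d"
    using A d g h by (simp add: mult_add_distrib_mat[of _ n n _ n])
  then have conn: "gauge_conn n g h A z = h z * (?C * g z)"
    using A g h by (simp add: gauge_conn_def assoc)
  have "gauge_conn n g h A z * (h z * ?P * g z) = h z * (?C * ((g z * h z) * (?P * g z)))"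
    unfolding conn using C P g h by (simp add: assoc)
  also have "\<dots> = h z * (?C * (?P * g z))"
    by (simp only: gh(1) left_mult_one_mat[OF mult_carrier_mat[OF P g]])
  also have "\<dots> = h z * (?C * ?P * g z)"
    using C P g by (simp add: assoc)
  finally have "trace_coord n g h A M k z = mat_trace (h z * (?C * ?P * g z))"
    unfolding trace_coord_def pow by simp
  also have "\<dots> = mat_trace (?C * ?P * g z * h z)"
    using C P g h by (intro mat_trace_comm[of _ n]) auto
  also have "?C * ?P * g z * h z = ?C * ?P"
    using C P g h gh(1) right_mult_one_mat[OF P] by (simp add: assoc)
  finally show ?thesis .
qed

text \<open>With J the constant matrix h M g, the relation differentiated is M g = g J and not h M g
  = J: a gauge comes with smooth \<open>g\<close> only, so no derivative of \<open>h\<close> may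
  occur. Multiplying by \<open>h\<close> on the right and using J h = h M gives the
  commutator.\<close>

lemma mat_deriv_adapted_gauge:
  assumes M: "smooth_mat n U M" and ad: "adapted_gauge n U z0 M V g h"
  shows "mat_deriv dz n M z0 =
    mat_deriv dz n g z0 * h z0 * M z0 - M z0 * (mat_deriv dz n g z0 * h z0)"
proof -
  have V: "open V" "z0 \<in> V" "V \<subseteq> U" and g: "smooth_mat n V g"
    and h: "\<And>z. z \<in> V \<Longrightarrow> h z \<in> carrier_mat n n"
    and gh: "\<And>z. z \<in> V \<Longrightarrow> g z * h z = 1\<^sub>m n" "\<And>z. z \<in> V \<Longrightarrow> h z * g z = 1\<^sub>m n"
    and const: "\<And>z. z \<in> V \<Longrightarrow> h z * M z * g z = h z0 * M z0 * g z0"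
    using ad unfolding adapted_gauge_def gauge_on_def gauge_endo_def by blast+
  note assoc = assoc_mult_mat[of _ n n _ n _ n]
  have Mc: "M z \<in> carrier_mat n n" if "z \<in> V" for z using smooth_matD(1)[OF M] V that by auto
  have gc: "g z \<in> carrier_mat n n" if "z \<in> V" for z using smooth_matD(1)[OF g that] .
  have MV: "smooth_mat n V M"
    using M V(3) unfolding smooth_mat_def by (blast intro: smooth_on_subset)
  define J where "J = h z0 * M z0 * g z0"
  define g' where "g' = mat_deriv dz n g z0"
  define M' where "M' = mat_deriv dz n M z0"
  have c: "J \<in> carrier_mat n n" "g' \<in> carrier_mat n n" "M' \<in> carrier_mat n n"
    "M z0 \<in> carrier_mat n n" "g z0 \<in> carrier_mat n n" "h z0 \<in> carrier_mat n n"
    using Mc[OF V(2)] gc[OF V(2)] h[OF V(2)]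
    by (auto simp: J_def g'_def M'_def mat_deriv_def intro!: mult_carrier_mat[of _ n n])
  have intertwine: "M z * g z = g z * J" if z: "z \<in> V" for z
  proof -
    have "g z * J = g z * (h z * M z * g z)" by (simp add: J_def const[OF z])
    also have "\<dots> = (g z * h z) * (M z * g z)" using Mc[OF z] gc[OF z] h[OF z] by (simp add: assoc)
    finally show ?thesis using Mc[OF z] gc[OF z] gh(1)[OF z] by simp
  qed
  have "M' * g z0 + M z0 * g' = g' * J"
  proof (rule eq_matI)
    fix a b assume "a < dim_row (g' * J)" "b < dim_col (g' * J)"
    then have ab: "a < n" "b < n" using c by auto
    have "dz (\<lambda>z. \<Sum>i<n. M z $$ (a,i) * g z $$ (i,b)) z0 = dz (\<lambda>z. \<Sum>i<n. J $$ (i,b) * g z $$ (a,i)) z0"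
    proof (rule dz_cong[OF V(1,2)])
      fix z assume z: "z \<in> V"
      have "(M z * g z) $$ (a,b) = (g z * J) $$ (a,b)" by (simp only: intertwine[OF z])
      then show "(\<Sum>i<n. M z $$ (a,i) * g z $$ (i,b)) = (\<Sum>i<n. J $$ (i,b) * g z $$ (a,i))"
        using index_mult_mat_sum[OF Mc[OF z] gc[OF z] ab] index_mult_mat_sum[OF gc[OF z] c(1) ab]
        by (simp add: mult.commute)
    qed
    also have "\<dots> = (\<Sum>i<n. J $$ (i,b) * dz (\<lambda>z. g z $$ (a,i)) z0)"
      using ab V(1,2) by (subst dz_sum[OF V(1) _ V(2)])
        (auto intro!: sum.cong dz_cmult[of V] smooth_on_mult smooth_on_const smooth_matD(2)[OF g])
    also have "\<dots> = (g' * J) $$ (a,b)"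
      unfolding index_mult_mat_sum[OF c(2,1) ab] using ab by (simp add: g'_def mat_deriv_def mult.commute)
    also have "dz (\<lambda>z. \<Sum>i<n. M z $$ (a,i) * g z $$ (i,b)) z0 =
        (\<Sum>i<n. dz (\<lambda>z. M z $$ (a,i)) z0 * g z0 $$ (i,b) + M z0 $$ (a,i) * dz (\<lambda>z. g z $$ (i,b)) z0)"
      using ab V(1,2) by (subst dz_sum[OF V(1) _ V(2)])
        (auto intro!: sum.cong dz_mult[of V] smooth_on_mult smooth_matD(2)[OF g] smooth_matD(2)[OF MV])
    also have "\<dots> = (M' * g z0) $$ (a,b) + (M z0 * g') $$ (a,b)"
      unfolding index_mult_mat_sum[OF c(3,5) ab] index_mult_mat_sum[OF c(4,2) ab]
      using ab by (simp add: g'_def M'_def mat_deriv_def sum.distrib)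
    finally show "(M' * g z0 + M z0 * g') $$ (a,b) = (g' * J) $$ (a,b)"
      using ab c by simp
  qed (use c in auto)
  then have "(M' * g z0 + M z0 * g') * h z0 = g' * J * h z0" by simp
  moreover have "(M' * g z0 + M z0 * g') * h z0 = M' + M z0 * (g' * h z0)"
    using c gh(1)[OF V(2)] by (simp add: add_mult_distrib_mat[of _ n n] assoc)
  moreover have "g' * J * h z0 = g' * h z0 * M z0"
    using c gh(1)[OF V(2)] by (simp add: J_def assoc)
  ultimately have "M' + M z0 * (g' * h z0) = g' * h z0 * M z0" by simp
  then have "M' = g' * h z0 * M z0 - M z0 * (g' * h z0)"
    using c by (auto simp: mat_eq_iff algebra_simps simp del: index_mult_mat(1))
  then show ?thesis by (simp add: M'_def g'_def)
qed

context nilpotent_pencil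
begin

text \<open>The cyclic frame with columns M^j (\<sigma> 0) is smooth and invertible on
  \<open>W\<close>, and in it \<open>M\<close> is the constant shift matrix because M^n (\<sigma> 0)
  = 0.\<close>

lemma adapted_gauge_exists: "\<exists>V g h. adapted_gauge n U z0 M V g h"
proof -
  define g where "g z = mat n n (\<lambda>(a,j). E j a 0 z)" for z
  define h where "h z = inverse (det (g z)) \<cdot>\<^sub>m adj_mat (g z)" for z
  define J :: "complex mat" where "J = mat n n (\<lambda>(i,j). if i = Suc j then 1 else 0)"
  have gc: "g z \<in> carrier_mat n n" for z by (simp add: g_def)
  have Jc: "J \<in> carrier_mat n n" by (simp add: J_def)
  have gh: "h z \<in> carrier_mat n n" "g z * h z = 1\<^sub>m n" "h z * g z = 1\<^sub>m n" if "z \<in> W" for z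
    using that adj_mat_inverse[OF gc[of z]] by (simp_all add: h_def W_def Q_def g_def)
  have "h z * M z * g z = J" if z: "z \<in> W" for z
  proof -
    have Mc: "M z \<in> carrier_mat n n" using z W smooth_matD(1)[OF M] by auto
    have "M z * g z = g z * J"
    proof (rule eq_matI)
      fix a j assume "a < dim_row (g z * J)" "j < dim_col (g z * J)"
      then have aj: "a < n" "j < n" using gc[of z] Jc by auto
      have "(M z * g z) $$ (a,j) = E (Suc j) a 0 z"
        using aj by (subst index_mult_mat_sum[OF Mc gc]) (auto simp: g_def)
      also have "\<dots> = (\<Sum>i<n. if i = Suc j then E i a 0 z else 0)"
        using aj cyclic_basis.x_n_zero[OF cyclic_basis_W[OF z] aj(1)]
        by (cases "Suc j = n") (auto simp del: E.simps)
      also have "\<dots> = (g z * J) $$ (a,j)"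
        using aj by (subst index_mult_mat_sum[OF gc Jc]) (simp_all add: g_def J_def mult_delta_right del: E.simps)
      finally show "(M z * g z) $$ (a,j) = (g z * J) $$ (a,j)" .
    qed (use Mc gc[of z] Jc in auto)
    then have "h z * M z * g z = (h z * g z) * J"
      using Mc gc[of z] Jc gh(1)[OF z] by (simp add: assoc_mult_mat[of _ n n _ n _ n])
    then show ?thesis using gh(3)[OF z] Jc by simp
  qed
  moreover have "smooth_mat n W g"
    using W(3) unfolding smooth_mat_def
    by (auto simp: g_def intro: smooth_on_subset polyfn_smooth[OF U polyfn_E])
  ultimately have "adapted_gauge n U z0 M W g h"
    using W gh by (auto simp: adapted_gauge_def gauge_on_def gauge_endo_def)
  then show ?thesis by blast
qed

text \<open>
  With \<open>\<Gamma> = \<partial>g h\<close> one has \<open>\<partial>M = [\<Gamma>, M]\<close>, so \<open>\<partial> + A\<close> acts on \<open>M^j (\<sigma> 0)\<close> as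
  \<open>A + \<Gamma>\<close>, up to \<open>M^j\<close> applied to a fixed vector.
\<close>

lemma coord_slope_eq_trace:
  assumes ad: "adapted_gauge n U z0 M V g h" and k: "k \<in> {2..n}"
  shows "basis.coord (n - k) (E_slope n) = trace_coord n g h A M k z0"
proof -
  have V: "z0 \<in> V" and g: "smooth_mat n V g" and hc: "h z0 \<in> carrier_mat n n"
    and gh: "g z0 * h z0 = 1\<^sub>m n" "h z0 * g z0 = 1\<^sub>m n"
    using ad unfolding adapted_gauge_def gauge_on_def by blast+
  define \<Gamma> where "\<Gamma> = mat_deriv dz n g z0 * h z0"
  \<comment> \<open>Start with the defect (\<partial> - \<Gamma>) (\<sigma> 0) at \<open>z0\<close>
    and apply powers of \<open>M z0\<close>.\<close>
  define \<rho> where "\<rho> = rec_nat (\<lambda>a. dz (E 0 a 0) z0 - (\<Sum>b<n. \<Gamma> $$ (a,b) * E 0 b 0 z0))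
    (\<lambda>j r a. \<Sum>b<n. M z0 $$ (a,b) * r b)"
  have \<rho>_Suc: "\<rho> (Suc j) a = (\<Sum>b<n. M z0 $$ (a,b) * \<rho> j b)" for j a by (simp add: \<rho>_def)
  have Mc: "M z0 \<in> carrier_mat n n" by (rule smooth_matD(1)[OF M z0])
  have Ac: "A z0 \<in> carrier_mat n n" by (rule smooth_matD(1)[OF A z0])
  have gc: "g z0 \<in> carrier_mat n n" by (rule smooth_matD(1)[OF g V])
  have \<Gamma>c: "\<Gamma> \<in> carrier_mat n n" 
    unfolding \<Gamma>_def by (rule mult_carrier_mat[OF _ hc]) (simp add: mat_deriv_def)
  have dM: "dz (\<lambda>z. M z $$ (a,b)) z0 =
      (\<Sum>c<n. \<Gamma> $$ (a,c) * M z0 $$ (c,b)) - (\<Sum>c<n. M z0 $$ (a,c) * \<Gamma> $$ (c,b))"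
    if ab: "a < n" "b < n" for a b
  proof -
    have "dz (\<lambda>z. M z $$ (a,b)) z0 = (\<Gamma> * M z0 - M z0 * \<Gamma>) $$ (a,b)"
      using ab unfolding \<Gamma>_def mat_deriv_adapted_gauge[OF M ad, symmetric] by (simp add: mat_deriv_def)
    then show ?thesis
      using ab Mc \<Gamma>c index_mult_mat_sum[OF Mc \<Gamma>c ab] index_mult_mat_sum[OF \<Gamma>c Mc ab]
      by (simp del: index_mult_mat(1))
  qed
  \<comment> \<open>\<partial>M = [\<Gamma>, M] says that \<partial> - \<Gamma> commutes with M, so
    the defect of M^j (\<sigma> 0) is M^j applied to the defect of \<sigma> 0; the two double sums
    containing M \<Gamma> cancel.\<close>
  have dE: "dz (E j a 0) z0 = (\<Sum>b<n. \<Gamma> $$ (a,b) * E j b 0 z0) + \<rho> j a" if "a < n" for j a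
    using that
  proof (induction j arbitrary: a)
    case 0
    then show ?case by (simp add: \<rho>_def)
  next
    case (Suc j)
    have "E (Suc j) a 0 = (\<lambda>z. \<Sum>b<n. M z $$ (a,b) * E j b 0 z)" by simp
    then have "dz (E (Suc j) a 0) z0 = (\<Sum>b<n. dz (\<lambda>z. M z $$ (a,b) * E j b 0 z) z0)"
      using Suc.prems by (simp only:)
        (intro dz_sum[OF U _ z0] smooth_on_mult U smooth_matD(2)[OF M] polyfn_smooth[OF U polyfn_E], auto)
    also have "\<dots> = (\<Sum>b<n. dz (\<lambda>z. M z $$ (a,b)) z0 * E j b 0 z0 + M z0 $$ (a,b) * dz (E j b 0) z0)"
      using Suc.prems
      by (intro sum.cong refl dz_mult[OF _ _ z0] smooth_matD(2)[OF M] polyfn_smooth[OF U polyfn_E]) auto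
    also have "\<dots> = (\<Sum>b<n. \<Sum>c<n. \<Gamma> $$ (a,c) * M z0 $$ (c,b) * E j b 0 z0)
        - (\<Sum>b<n. \<Sum>c<n. M z0 $$ (a,c) * \<Gamma> $$ (c,b) * E j b 0 z0)
        + (\<Sum>b<n. \<Sum>c<n. M z0 $$ (a,b) * \<Gamma> $$ (b,c) * E j c 0 z0)
        + (\<Sum>b<n. M z0 $$ (a,b) * \<rho> j b)"
      using Suc.prems
      by (simp add: dM Suc.IH algebra_simps sum.distrib sum_subtractf sum_distrib_left sum_distrib_right)
    also have "(\<Sum>b<n. \<Sum>c<n. M z0 $$ (a,c) * \<Gamma> $$ (c,b) * E j b 0 z0) =
        (\<Sum>b<n. \<Sum>c<n. M z0 $$ (a,b) * \<Gamma> $$ (b,c) * E j c 0 z0)"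
      by (rule sum.swap)
    also have "(\<Sum>b<n. \<Sum>c<n. \<Gamma> $$ (a,c) * M z0 $$ (c,b) * E j b 0 z0) =
        (\<Sum>c<n. \<Gamma> $$ (a,c) * E (Suc j) c 0 z0)"
      by (subst sum.swap) (simp add: sum_distrib_left mult_ac)
    finally show ?case by (simp add: \<rho>_Suc)
  qed
  have "E_slope (Suc j) a = (\<Sum>b<n. M z0 $$ (a,b) * E_slope j b) +
      (\<Sum>b<n. (A z0 + \<Gamma>) $$ (a,b) * E j b 0 z0) + \<rho> j a" if "a < n" for j a
    using that Ac \<Gamma>c by (simp add: E_slope_Suc dE algebra_simps sum.distrib)
  then have "basis.coord (n - k) (E_slope n) = mat_trace ((A z0 + \<Gamma>) * M z0 ^\<^sub>m (k - 1))"
    using Ac \<Gamma>c k by (intro basis.coord_first_order[of "A z0 + \<Gamma>" _ \<rho>]) (auto simp: \<rho>_Suc)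
  then show ?thesis
    using trace_coord_eq[of M z0 n A g h k, OF Mc Ac gc hc gh] by (simp add: \<Gamma>_def)
qed

text \<open>Stated so as to serve both ends: (\<open>M\<close>, \<open>N\<close>, \<open>R1\<close>,
  \<open>R2\<close>) is (\<Phi>2s, \<Phi>1, \<Phi>1s, \<Phi>2) at 0 and (\<Phi>1, \<Phi>2s, \<Phi>2,
  \<Phi>1s) at infinity. The limit for \<open>th\<close> is computed without a gauge, so its trace
  expression holds in every adapted gauge.\<close>

lemma lowest_terms:
  assumes R: "R1 z0 \<in> carrier_mat n n" "A2 z0 \<in> carrier_mat n n" "R2 z0 \<in> carrier_mat n n"
    and R1: "R1 z0 = beltrami_mat n \<nu> (M z0)"
    and s: "\<And>e. e \<noteq> 0 \<Longrightarrow> \<exists>V f. open V \<and> z0 \<in> V \<and> V \<subseteq> U \<and> smooth_on V f \<and>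
      (\<forall>z\<in>V. f z \<noteq> 0 \<and> s e z = f z \<cdot>\<^sub>v tau e z)"
    and S: "S = {e. e \<noteq> 0 \<and> invertible_mat (frame n (B e) (s e) z0)}"
    and coordinates: "\<And>e. e \<in> S \<Longrightarrow> coordinates_near n U z0 (B e) (conn_form R2 A2 R1 e) (s e)
      (\<lambda>k. th k e) (\<lambda>k. muh k e)"
    and k: "k \<in> {2..n}"
  shows "rational_fun_on S (\<lambda>e. muh k e z0) \<and> lowest_term (\<lambda>e. muh k e z0) (\<nu> k) (int k - 2) \<and>
    rational_fun_on S (\<lambda>e. th k e z0) \<and>
    (\<forall>V g h. adapted_gauge n U z0 M V g h \<longrightarrow>
      lowest_term (\<lambda>e. th k e z0) (trace_coord n g h A M k z0) (1 - int k))"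
proof -
  obtain y where y: "y 0 = (\<lambda>e. 1)" "\<And>m. rational_fun_on {e. Q e z0 \<noteq> 0} (y m)" "\<And>m. isCont (y m) 0"
    "\<And>e V f s th m. e \<noteq> 0 \<Longrightarrow> open V \<Longrightarrow> V \<subseteq> U \<Longrightarrow> smooth_on V f \<Longrightarrow>
      (\<And>z. z \<in> V \<Longrightarrow> s z = f z \<cdot>\<^sub>v tau e z) \<Longrightarrow>
      (\<And>z. z \<in> V \<Longrightarrow> (nabla n (B e) ^^ n) s z =
        lin_comb n {2..n} (\<lambda>k. th k z) (\<lambda>k. (nabla n (B e) ^^ (n - k)) s z)) \<Longrightarrow>
      z0 \<in> V \<Longrightarrow> Q e z0 \<noteq> 0 \<Longrightarrow> (dz ^^ m) f z0 = f z0 * y m e"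
    using scalar_factor_iterates by blast
  interpret nilpotent_pencil_factor n U z0 M A N d \<sigma> y
    by unfold_locales (use y in blast)+
  note facts = R R1 s S coordinates k
  show ?thesis
    using rational_muh[where s = s and th = th and muh = muh, OF facts]
      rational_th[where s = s and th = th and muh = muh, OF facts]
      lowest_term_muh[where s = s and th = th and muh = muh, OF facts]
      lowest_term_th[where s = s and th = th and muh = muh, OF facts]
      coord_slope_eq_trace[OF _ k] by auto
qed

end

section \<open>The exchange of zero and infinity\<close>

lemma nilpotent_mat_principal:
  assumes "principal_nilpotent n X"
  shows "nilpotent_mat n X"
proof -
  obtain P Q where PQ: "similar_mat_wit X (jordan_block n 0) P Q"
    using assms unfolding principal_nilpotent_def similar_mat_def by blast
  have X: "X \<in> carrier_mat n n" using assms by (simp add: principal_nilpotent_def)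
  have "jordan_block n 0 ^\<^sub>m n = (0\<^sub>m n n :: complex mat)"
    by (rule eq_matI) (auto simp: jordan_block_pow)
  moreover have "P \<in> carrier_mat n n" "Q \<in> carrier_mat n n"
    using similar_mat_witD2[OF X PQ] by auto
  ultimately have "X ^\<^sub>m n = 0\<^sub>m n n" using similar_mat_wit_pow_id[OF PQ, of n] by simp
  then show ?thesis using X by (auto simp: nilpotent_mat_def)
qed

text \<open>The connection form and its counterpart in 1 / \<lambda> are known to agree only on
  \<open>U\<close>, where the dimensions of the matrices are known; iterated derivatives therefore
  have to be compared on an open set.\<close>

lemma nabla_pow_cong_conn:
  assumes U: "open U" and B: "\<And>z. z \<in> U \<Longrightarrow> B z = B' z" and "z \<in> U"
  shows "(nabla n B ^^ j) v z = (nabla n B' ^^ j) v z"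
  using assms(3)
proof (induction j arbitrary: z)
  case (Suc j)
  have "nabla n B ((nabla n B ^^ j) v) z = nabla n B ((nabla n B' ^^ j) v) z"
    by (rule nabla_cong[OF U Suc.IH Suc.prems])
  moreover have "nabla n B w z = nabla n B' w z" for w
    using B[OF Suc.prems] by (simp add: nabla_def)
  ultimately show ?case by simp
qed simp

lemma conn_form_inverse:
  assumes "X z \<in> carrier_mat n n" "A z \<in> carrier_mat n n" "Y z \<in> carrier_mat n n"
  shows "conn_form Y A X (inverse l) z = conn_form X A Y l z"
  using assms by (auto simp: mat_eq_iff conn_form_def)

lemma highest_term_from_lowest_term:
  assumes "lowest_term (\<lambda>e. F (inverse e)) c m"
  shows "highest_term F c (- m)"
proof -
  have "((\<lambda>l. F l / l powi (- m)) \<circ> inverse) = (\<lambda>e. F (inverse e) / e powi m)"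
    by (auto simp: fun_eq_iff power_int_minus power_int_inverse)
  then show ?thesis
    using assms unfolding highest_term_def lowest_term_def lim_at_infinity_0 by simp
qed

text \<open>The substitution \<lambda> = 1 / e reverses the coefficients of the section; the
  leftover e^(-d) does not depend on z and can be moved into the scalar factor.\<close>

lemma lin_comb_reverse:
  assumes "e \<noteq> 0"
  shows "lin_comb n {..d} (\<lambda>j. inverse e ^ j) v =
    inverse e ^ d \<cdot>\<^sub>v lin_comb n {..d} (\<lambda>j. e ^ j) (\<lambda>j. v (d - j))"
proof -
  have "(\<Sum>j\<le>d. inverse e ^ j * v j $ i) = inverse e ^ d * (\<Sum>j\<le>d. e ^ j * v (d - j) $ i)" for i
    unfolding sum_distrib_left
    by (rule sum.reindex_bij_witness[of _ "\<lambda>j. d - j" "\<lambda>j. d - j"])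
      (use assms in \<open>auto simp: power_diff field_simps\<close>)
  then show ?thesis by (auto simp: lin_comb_def vec_eq_iff)
qed

theorem proposition13p2:
  fixes n :: nat and U :: "complex set" and z0 :: complex
    and \<Phi>1 \<Phi>2 \<Phi>1s \<Phi>2s A1 A2 :: "complex \<Rightarrow> complex mat"
    and \<mu> \<nu> :: "nat \<Rightarrow> complex \<Rightarrow> complex"
    and s :: "complex \<Rightarrow> complex \<Rightarrow> complex vec"
    and th muh :: "nat \<Rightarrow> complex \<Rightarrow> complex \<Rightarrow> complex"
    and B1 B2 :: "complex \<Rightarrow> complex \<Rightarrow> complex mat"
    and S :: "complex set"
  defines "B1 \<equiv> conn_form \<Phi>1 A1 \<Phi>2s"
    and "B2 \<equiv> conn_form \<Phi>2 A2 \<Phi>1s"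
    and "S \<equiv> {l. l \<noteq> 0 \<and> invertible_mat (frame n (B1 l) (s l) z0)}"
  assumes "n \<ge> 2" and "open U" and "z0 \<in> U"
    and "smooth_mat n U \<Phi>1" and "smooth_mat n U \<Phi>2"
    and "smooth_mat n U \<Phi>1s" and "smooth_mat n U \<Phi>2s"
    and "smooth_mat n U A1" and "smooth_mat n U A2"
    and "\<And>k. k \<in> {2..n} \<Longrightarrow> smooth_on U (\<mu> k)"
    and "\<And>z. z \<in> U \<Longrightarrow> principal_nilpotent n (\<Phi>1 z)"
    and "\<And>z. z \<in> U \<Longrightarrow> \<Phi>2 z = beltrami_mat n (\<lambda>k. \<mu> k z) (\<Phi>1 z)"
    and "\<And>z. z \<in> U \<Longrightarrow> conjugated_structure n (\<lambda>k. \<mu> k z) (\<lambda>k. \<nu> k z)"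
    and "\<And>z. z \<in> U \<Longrightarrow> nilpotent_mat n (\<Phi>1s z) \<and> nilpotent_mat n (\<Phi>2s z) \<and>
                         \<Phi>1s z * \<Phi>2s z = \<Phi>2s z * \<Phi>1s z"
    and "\<And>z. z \<in> U \<Longrightarrow> \<Phi>1s z = beltrami_mat n (\<lambda>k. \<nu> k z) (\<Phi>2s z)"
    and "\<And>z. z \<in> U \<Longrightarrow> mat_trace (A1 z) = 0 \<and> mat_trace (A2 z) = 0"
    and "generic_section n U z0 \<Phi>1 \<Phi>2s s"
    and "\<And>l. l \<in> S \<Longrightarrow> parabolic_at n U z0 (B1 l) (B2 l) (s l)"
    and "\<And>l. l \<in> S \<Longrightarrow> coordinates_near n U z0 (B1 l) (B2 l) (s l) (\<lambda>k. th k l) (\<lambda>k. muh k l)"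
  shows "(\<forall>k\<in>{2..n}.
            rational_fun_on S (\<lambda>l. muh k l z0) \<and>
            highest_term (\<lambda>l. muh k l z0) (\<mu> k z0) (2 - int k) \<and>
            lowest_term (\<lambda>l. muh k l z0) (\<nu> k z0) (int k - 2)) \<and>
         (\<forall>k\<in>{2..n}. rational_fun_on S (\<lambda>l. th k l z0)) \<and>
         (\<exists>V g h. adapted_gauge n U z0 \<Phi>1 V g h) \<and>
         (\<forall>V g h. adapted_gauge n U z0 \<Phi>1 V g h \<longrightarrow> (\<forall>k\<in>{2..n}.
            highest_term (\<lambda>l. th k l z0) (trace_coord n g h A1 \<Phi>1 k z0) (int k - 1))) \<and>
         (\<exists>V g h. adapted_gauge n U z0 \<Phi>2s V g h) \<and>
         (\<forall>V g h. adapted_gauge n U z0 \<Phi>2s V g h \<longrightarrow> (\<forall>k\<in>{2..n}.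
            lowest_term (\<lambda>l. th k l z0) (trace_coord n g h A1 \<Phi>2s k z0) (1 - int k)))"
proof -
  note n = assms(4) and U = assms(5) and z0 = assms(6) and sm = assms(7-12)
  note conn = conn_form_inverse[of _ _ n]
  obtain d \<sigma> where \<sigma>: "\<And>j. j \<le> d \<Longrightarrow> smooth_vec n U (\<sigma> j)"
    and cyclic: "cyclic_vec n (\<Phi>1 z0) (\<sigma> d z0)" "cyclic_vec n (\<Phi>2s z0) (\<sigma> 0 z0)"
    and s: "\<And>l. l \<noteq> 0 \<Longrightarrow> \<exists>V f. open V \<and> z0 \<in> V \<and> V \<subseteq> U \<and> smooth_on V f \<and>
      (\<forall>z\<in>V. f z \<noteq> 0 \<and> s l z = f z \<cdot>\<^sub>v lin_comb n {..d} (\<lambda>j. l ^ j) (\<lambda>j. \<sigma> j z))"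
    using assms(20) unfolding generic_section_def by auto
  interpret lower: nilpotent_pencil n U z0 \<Phi>2s A1 \<Phi>1 d \<sigma>
    using n U z0 sm \<sigma> cyclic assms(17) by unfold_locales auto
  \<comment> \<open>After the reversal the leading coefficient \<open>\<sigma> d\<close>, which is
    cyclic for \<Phi>1, takes the place of the lowest one.\<close>
  interpret upper: nilpotent_pencil n U z0 \<Phi>1 A1 \<Phi>2s d "\<lambda>j. \<sigma> (d - j)"
    using n U z0 sm \<sigma> cyclic nilpotent_mat_principal[OF assms(14)] by unfold_locales auto
  \<comment> \<open>The parameter set that \<open>lowest_terms\<close> prescribes for the exchanged
    form; inversion maps it into \<open>S\<close>, which transports the given coordinates.\<close>
  define S' where "S' = {e. e \<noteq> 0 \<and>
    invertible_mat (frame n (conn_form \<Phi>2s A1 \<Phi>1 e) (s (inverse e)) z0)}"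
  have B1': "conn_form \<Phi>2s A1 \<Phi>1 e z = B1 (inverse e) z" if "z \<in> U" for e z
    using conn[of \<Phi>1 z A1 \<Phi>2s "inverse e"] smooth_matD(1)[OF _ that] sm by (simp add: B1_def)
  have B2': "conn_form \<Phi>1s A2 \<Phi>2 e z = B2 (inverse e) z" if "z \<in> U" for e z
    using conn[of \<Phi>2 z A2 \<Phi>1s "inverse e"] smooth_matD(1)[OF _ that] sm by (simp add: B2_def)
  have nabla': "(nabla n (conn_form \<Phi>2s A1 \<Phi>1 e) ^^ j) v z = (nabla n (B1 (inverse e)) ^^ j) v z"
    if "z \<in> U" for e j v z
    by (rule nabla_pow_cong_conn[OF U B1' that])
  have "frame n (conn_form \<Phi>2s A1 \<Phi>1 e) v z0 = frame n (B1 (inverse e)) v z0" for e v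
    by (simp add: frame_def nabla'[OF z0])
  then have S': "inverse e \<in> S" if "e \<in> S'" for e
    using that by (simp add: S'_def S_def)
  have coord': "coordinates_near n U z0 (conn_form \<Phi>2s A1 \<Phi>1 e) (conn_form \<Phi>1s A2 \<Phi>2 e) (s (inverse e))
      (\<lambda>k. th k (inverse e)) (\<lambda>k. muh k (inverse e))" if e: "e \<in> S'" for e
  proof -
    obtain V where V: "open V" "z0 \<in> V" "V \<subseteq> U"
      "\<And>z. z \<in> V \<Longrightarrow> (nabla n (B1 (inverse e)) ^^ n) (s (inverse e)) z =
        lin_comb n {2..n} (\<lambda>k. th k (inverse e) z) (\<lambda>k. (nabla n (B1 (inverse e)) ^^ (n - k)) (s (inverse e)) z)"
      "\<And>z. z \<in> V \<Longrightarrow> nabla_bar n (B2 (inverse e)) (s (inverse e)) z =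
        lin_comb n {1..n} (\<lambda>k. muh k (inverse e) z) (\<lambda>k. (nabla n (B1 (inverse e)) ^^ (k - 1)) (s (inverse e)) z)"
      using assms(22)[OF S'[OF e]] unfolding coordinates_near_def by metis
    have "nabla_bar n (conn_form \<Phi>1s A2 \<Phi>2 e) v z = nabla_bar n (B2 (inverse e)) v z" if "z \<in> U" for v z
      using B2'[OF that] by (simp add: nabla_bar_def)
    then show ?thesis
      unfolding coordinates_near_def using V
      by (intro exI[of _ V]) (simp add: nabla' subset_iff)
  qed
  have s': "\<exists>V f. open V \<and> z0 \<in> V \<and> V \<subseteq> U \<and> smooth_on V f \<and>
      (\<forall>z\<in>V. f z \<noteq> 0 \<and> s (inverse e) z = f z \<cdot>\<^sub>v upper.tau e z)" if e: "e \<noteq> 0" for e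
  proof -
    obtain V f where V: "open V" "z0 \<in> V" "V \<subseteq> U" "smooth_on V f" "\<And>z. z \<in> V \<Longrightarrow> f z \<noteq> 0"
      "\<And>z. z \<in> V \<Longrightarrow> s (inverse e) z = f z \<cdot>\<^sub>v lin_comb n {..d} (\<lambda>j. inverse e ^ j) (\<lambda>j. \<sigma> j z)"
      using s[of "inverse e"] e by auto
    have "s (inverse e) z = (f z * inverse e ^ d) \<cdot>\<^sub>v upper.tau e z" if "z \<in> V" for z
      using V(6)[OF that] lin_comb_reverse[OF e, of n d "\<lambda>j. \<sigma> j z"]
      by (simp add: upper.tau_def smult_smult_assoc)
    moreover have "smooth_on V (\<lambda>z. f z * inverse e ^ d)"
      by (intro smooth_on_mult V smooth_on_const)
    ultimately show ?thesis
      using V e by (intro exI[of _ V] exI[of _ "\<lambda>z. f z * inverse e ^ d"]) auto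
  qed
  have low: "rational_fun_on S (\<lambda>l. muh k l z0) \<and> lowest_term (\<lambda>l. muh k l z0) (\<nu> k z0) (int k - 2) \<and>
      rational_fun_on S (\<lambda>l. th k l z0) \<and>
      (\<forall>V g h. adapted_gauge n U z0 \<Phi>2s V g h \<longrightarrow>
        lowest_term (\<lambda>l. th k l z0) (trace_coord n g h A1 \<Phi>2s k z0) (1 - int k))"
    if "k \<in> {2..n}" for k
  proof (rule lower.lowest_terms[where ?R1.0 = \<Phi>1s and ?A2.0 = A2 and ?R2.0 = \<Phi>2 and s = s and \<nu> = "\<lambda>k. \<nu> k z0"])
    show "\<Phi>1s z0 = beltrami_mat n (\<lambda>k. \<nu> k z0) (\<Phi>2s z0)" by (rule assms(18)[OF z0])
    show "S = {e. e \<noteq> 0 \<and> invertible_mat (frame n (conn_form \<Phi>1 A1 \<Phi>2s e) (s e) z0)}"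
      by (simp add: S_def B1_def)
    show "coordinates_near n U z0 (conn_form \<Phi>1 A1 \<Phi>2s e) (conn_form \<Phi>2 A2 \<Phi>1s e) (s e)
        (\<lambda>k. th k e) (\<lambda>k. muh k e)" if "e \<in> S" for e
      using assms(22)[OF that] by (simp add: B1_def B2_def)
    show "\<exists>V f. open V \<and> z0 \<in> V \<and> V \<subseteq> U \<and> smooth_on V f \<and>
        (\<forall>z\<in>V. f z \<noteq> 0 \<and> s e z = f z \<cdot>\<^sub>v lower.tau e z)" if "e \<noteq> 0" for e
      using s[OF that] by (simp add: lower.tau_def)
  qed (use that sm smooth_matD(1)[OF _ z0] in auto)
  \<comment> \<open>Only the leading terms are taken from this end, since rationality in \<lambda>
    is contained in \<open>low\<close>.\<close>
  have up: "lowest_term (\<lambda>e. muh k (inverse e) z0) (\<mu> k z0) (int k - 2) \<and>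
      (\<forall>V g h. adapted_gauge n U z0 \<Phi>1 V g h \<longrightarrow>
        lowest_term (\<lambda>e. th k (inverse e) z0) (trace_coord n g h A1 \<Phi>1 k z0) (1 - int k))"
    if "k \<in> {2..n}" for k
  proof -
    have "\<Phi>2 z0 = beltrami_mat n (\<lambda>k. \<mu> k z0) (\<Phi>1 z0)" by (rule assms(15)[OF z0])
    from upper.lowest_terms[where ?R1.0 = \<Phi>2 and ?A2.0 = A2 and ?R2.0 = \<Phi>1s and s = "\<lambda>e. s (inverse e)"
        and th = "\<lambda>k e. th k (inverse e)" and muh = "\<lambda>k e. muh k (inverse e)" and S = S',
        OF _ _ _ this s' S'_def coord' that]
    show ?thesis using sm smooth_matD(1)[OF _ z0] by auto
  qed
  have high: "highest_term (\<lambda>l. muh k l z0) (\<mu> k z0) (2 - int k)"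
    "\<And>V g h. adapted_gauge n U z0 \<Phi>1 V g h \<Longrightarrow>
      highest_term (\<lambda>l. th k l z0) (trace_coord n g h A1 \<Phi>1 k z0) (int k - 1)" if "k \<in> {2..n}" for k
    using up[OF that] highest_term_from_lowest_term[where F = "\<lambda>l. muh k l z0" and m = "int k - 2"]
      highest_term_from_lowest_term[where F = "\<lambda>l. th k l z0" and m = "1 - int k"] by auto
  show ?thesis
    using low high lower.adapted_gauge_exists upper.adapted_gauge_exists by simp
qed

end
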